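(* Let $\Omega=B(0,1)\subset\mathbb R^3$. There exist a random conductivity $\Gamma$ taking two values among smooth positive conductivities on $\overline\Omega$, and a deterministic smooth positive conductivity $\gamma_*$ on $\overline\Omega$, such that \[ \mathbb E[\Lambda_\Gamma]=\Lambda_{\gamma_*}\qquad\text{while}\qquad\gamma_*\ne\mathbb E\Gamma. \]
   Context: For a bounded domain $\Omega$ with smooth boundary and a positive conductivity $\gamma\in C^\infty(\overline\Omega;\mathbb R)$, the conductivity Dirichlet-to-Neumann map is $\Lambda_\gamma f=\gamma\partial_\nu u_f|_{\partial\Omega}$, where $\nabla\cdot(\gamma\nabla u_f)=0$ in $\Omega$, $u_f|_{\partial\Omega}=f$, and $\nu$ is the outer unit normal; it is a bounded operator $H^{1/2}(\partial\Omega)\to H^{-1/2}(\partial\Omega)$. $\mathbb E\Lambda_\Gamma$ is the weak expectation $\langle(\mathbb E\Lambda_\Gamma)f,g\rangle=\mathbb E\langle\Lambda_\Gamma f,g\rangle$, and $\mathbb E\Gamma$ is the pointwise mean. *)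

theory Defs
  imports "HOL-Analysis.Analysis" "HOL-Probability.Probability_Mass_Function"
begin

text \<open>
  All functions are real valued. \<open>\<Omega>\<close> is a bounded domain with smooth boundary, and
  \<open>\<sigma>\<close> is the surface measure on its boundary (for the unit ball: \<open>sphere_measure\<close> below).
\<close>

section \<open>Smooth functions and conductivities\<close>

primrec Ck_on :: "'a::euclidean_space set \<Rightarrow> nat \<Rightarrow> ('a \<Rightarrow> real) \<Rightarrow> bool" where
  "Ck_on S 0 f \<longleftrightarrow> continuous_on S f"
| "Ck_on S (Suc k) f \<longleftrightarrow>
     (\<forall>x\<in>S. f differentiable (at x)) \<and> (\<forall>v. Ck_on S k (\<lambda>x. frechet_derivative f (at x) v))"

definition smooth_on :: "'a::euclidean_space set \<Rightarrow> ('a \<Rightarrow> real) \<Rightarrow> bool" where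
  "smooth_on S f \<longleftrightarrow> (\<forall>k. Ck_on S k f)"

definition grad :: "('a::euclidean_space \<Rightarrow> real) \<Rightarrow> 'a \<Rightarrow> 'a" where
  "grad f x = (\<Sum>b\<in>Basis. frechet_derivative f (at x) b *\<^sub>R b)"

text \<open>
  \<open>C\<^sup>\<infinity>\<close> up to the boundary means: restriction of a smooth function on the whole space.
  Conductivities are extensional, so equality of conductivities is equality on the closed domain.
\<close>

definition conductivities :: "'a::euclidean_space set \<Rightarrow> ('a \<Rightarrow> real) set" where
  "conductivities \<Omega> = {\<gamma> \<in> extensional (closure \<Omega>).
     (\<exists>g. smooth_on UNIV g \<and> (\<forall>x\<in>closure \<Omega>. \<gamma> x = g x)) \<and> (\<forall>x\<in>closure \<Omega>. 0 < \<gamma> x)}"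


section \<open>Sobolev functions and traces\<close>

definition test_function :: "'a::euclidean_space set \<Rightarrow> ('a \<Rightarrow> real) \<Rightarrow> bool" where
  "test_function \<Omega> \<phi> \<longleftrightarrow> smooth_on UNIV \<phi> \<and>
     compact (closure {x. \<phi> x \<noteq> 0}) \<and> closure {x. \<phi> x \<noteq> 0} \<subseteq> \<Omega>"

definition square_integrable :: "'a measure \<Rightarrow> ('a \<Rightarrow> 'b::euclidean_space) \<Rightarrow> bool" where
  "square_integrable M f \<longleftrightarrow> f \<in> borel_measurable M \<and> integrable M (\<lambda>x. (norm (f x))\<^sup>2)"

text \<open>
  \<open>in_H1 \<Omega> u Du\<close>: \<open>u\<close> belongs to \<open>H\<^sup>1(\<Omega>)\<close> and \<open>Du\<close> is its weak gradient. The gradient is carried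
  along as a separate argument because it is only determined almost everywhere.
\<close>

definition in_H1 :: "'a::euclidean_space set \<Rightarrow> ('a \<Rightarrow> real) \<Rightarrow> ('a \<Rightarrow> 'a) \<Rightarrow> bool" where
  "in_H1 \<Omega> u Du \<longleftrightarrow>
     square_integrable (lebesgue_on \<Omega>) u \<and> square_integrable (lebesgue_on \<Omega>) Du \<and>
     (\<forall>\<phi> v. test_function \<Omega> \<phi> \<longrightarrow>
        (LINT x|lebesgue_on \<Omega>. u x * frechet_derivative \<phi> (at x) v)
          = - (LINT x|lebesgue_on \<Omega>. (Du x \<bullet> v) * \<phi> x))"

text \<open>
  Graph of the trace operator \<open>H\<^sup>1(\<Omega>) \<rightarrow> L\<^sup>2(\<partial>\<Omega>)\<close>, the continuous extension of
  restriction to the boundary from functions smooth up to the boundary (which are dense in \<open>H\<^sup>1(\<Omega>)\<close>).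
  Boundary functions are representatives, determined \<open>\<sigma>\<close>-almost everywhere.
\<close>

definition has_trace ::
  "'a::euclidean_space set \<Rightarrow> 'a measure \<Rightarrow> ('a \<Rightarrow> real) \<Rightarrow> ('a \<Rightarrow> 'a) \<Rightarrow> ('a \<Rightarrow> real) \<Rightarrow> bool" where
  "has_trace \<Omega> \<sigma> u Du f \<longleftrightarrow> in_H1 \<Omega> u Du \<and> square_integrable \<sigma> f \<and>
     (\<exists>\<phi> :: nat \<Rightarrow> 'a \<Rightarrow> real. (\<forall>n. smooth_on UNIV (\<phi> n)) \<and>
        (\<lambda>n. LINT x|lebesgue_on \<Omega>. (\<phi> n x - u x)\<^sup>2) \<longlonglongrightarrow> 0 \<and>
        (\<lambda>n. LINT x|lebesgue_on \<Omega>. (norm (grad (\<phi> n) x - Du x))\<^sup>2) \<longlonglongrightarrow> 0 \<and>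
        (\<lambda>n. LINT x|\<sigma>. (\<phi> n x - f x)\<^sup>2) \<longlonglongrightarrow> 0)"

text \<open>\<open>H\<^sup>1\<^sup>/\<^sup>2(\<partial>\<Omega>)\<close> as the range of the trace operator.\<close>

definition H_half :: "'a::euclidean_space set \<Rightarrow> 'a measure \<Rightarrow> ('a \<Rightarrow> real) set" where
  "H_half \<Omega> \<sigma> = {f. \<exists>u Du. has_trace \<Omega> \<sigma> u Du f}"

text \<open>
  Surface measure on the unit sphere of \<open>\<real>\<^sup>n\<close>: by integration in polar coordinates, a set \<open>A\<close> has
  \<open>n\<close> times the volume of the cone \<open>{x. 0 < norm x < 1 \<and> sgn x \<in> A}\<close>, where \<open>sgn x = x /\<^sub>R norm x\<close>.
\<close>

definition sphere_measure :: "'a::euclidean_space measure" where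
  "sphere_measure = scale_measure (of_nat DIM('a))
     (distr (lebesgue_on (ball 0 1 - {0})) (restrict_space borel (sphere 0 1)) sgn)"


section \<open>The Dirichlet-to-Neumann map\<close>

text \<open>
  Weak form of \<open>\<nabla>\<cdot>(\<gamma>\<nabla>u) = 0\<close> in \<open>\<Omega>\<close>, \<open>u = f\<close> on the boundary; the test space \<open>H\<^sup>1\<^sub>0(\<Omega>)\<close> is the
  kernel of the trace.
\<close>

definition weak_solution ::
  "'a::euclidean_space set \<Rightarrow> 'a measure \<Rightarrow> ('a \<Rightarrow> real) \<Rightarrow> ('a \<Rightarrow> real) \<Rightarrow> ('a \<Rightarrow> real) \<Rightarrow> ('a \<Rightarrow> 'a) \<Rightarrow> bool"
where
  "weak_solution \<Omega> \<sigma> \<gamma> f u Du \<longleftrightarrow> has_trace \<Omega> \<sigma> u Du f \<and>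
     (\<forall>w Dw. has_trace \<Omega> \<sigma> w Dw (\<lambda>_. 0) \<longrightarrow>
        (LINT x|lebesgue_on \<Omega>. \<gamma> x * (Du x \<bullet> Dw x)) = 0)"

text \<open>
  \<open>dn_map \<Omega> \<sigma> \<gamma> f g\<close> is the pairing of \<open>\<gamma> \<partial>\<^sub>\<nu> u\<^sub>f \<in> H\<^sup>-\<^sup>1\<^sup>/\<^sup>2(\<partial>\<Omega>)\<close> with \<open>g \<in> H\<^sup>1\<^sup>/\<^sup>2(\<partial>\<Omega>)\<close>: for \<open>f\<close> in
  \<open>H\<^sup>1\<^sup>/\<^sup>2\<close> the conormal derivative is defined by Green's formula, the integral of
  \<open>\<gamma> \<nabla>u\<^sub>f \<bullet> \<nabla>v\<close> over \<open>\<Omega>\<close> with \<open>v\<close> any function in \<open>H\<^sup>1(\<Omega>)\<close> whose trace is \<open>g\<close>.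
\<close>

definition dn_map ::
  "'a::euclidean_space set \<Rightarrow> 'a measure \<Rightarrow> ('a \<Rightarrow> real) \<Rightarrow> ('a \<Rightarrow> real) \<Rightarrow> ('a \<Rightarrow> real) \<Rightarrow> real" where
  "dn_map \<Omega> \<sigma> \<gamma> = (\<lambda>f\<in>H_half \<Omega> \<sigma>. \<lambda>g\<in>H_half \<Omega> \<sigma>.
     THE c. \<exists>u Du v Dv. weak_solution \<Omega> \<sigma> \<gamma> f u Du \<and> has_trace \<Omega> \<sigma> v Dv g \<and>
       c = (LINT x|lebesgue_on \<Omega>. \<gamma> x * (Du x \<bullet> Dv x)))"


section \<open>Random conductivities\<close>

text \<open>A random conductivity with finitely many values is represented by its law.\<close>

definition expected_dn_map ::
  "'a::euclidean_space set \<Rightarrow> 'a measure \<Rightarrow> ('a \<Rightarrow> real) pmf \<Rightarrow> ('a \<Rightarrow> real) \<Rightarrow> ('a \<Rightarrow> real) \<Rightarrow> real" where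
  "expected_dn_map \<Omega> \<sigma> \<Gamma> = (\<lambda>f\<in>H_half \<Omega> \<sigma>. \<lambda>g\<in>H_half \<Omega> \<sigma>.
     measure_pmf.expectation \<Gamma> (\<lambda>\<gamma>. dn_map \<Omega> \<sigma> \<gamma> f g))"

definition mean_conductivity :: "'a::euclidean_space set \<Rightarrow> ('a \<Rightarrow> real) pmf \<Rightarrow> 'a \<Rightarrow> real" where
  "mean_conductivity \<Omega> \<Gamma> = (\<lambda>x\<in>closure \<Omega>. measure_pmf.expectation \<Gamma> (\<lambda>\<gamma>. \<gamma> x))"

end

theory Submission
  imports Defs
begin

text \<open>
  All conductivities are radial, \<open>\<gamma> = g(t)\<^sup>2\<close> with \<open>t = |x|\<^sup>2\<close> and \<open>g(1) = 1\<close>. After the Liouville substitution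
  and \<open>|x| = e\<^sup>-\<^sup>s\<close>, suitable \<open>g\<close> give one-soliton (Bargmann) potentials with parameter
  \<open>\<kappa> = 2, 3, 4\<close>; \<open>\<kappa> = 2\<close> is \<open>\<gamma> = 1\<close>. They are tuned so that one and the same operator solves all three
  equations: if \<open>H\<close> is harmonic with boundary values \<open>f\<close>, and \<open>h\<close> is the harmonic function with
  \<open>h + 2/5 x \<bullet> \<nabla>h = H\<close> (an average of \<open>H\<close> along rays), then \<open>u = h + (H - h) / g\<close> solves
  \<open>\<nabla>\<cdot>(g\<^sup>2 \<nabla>u) = 0\<close>, \<open>u = f\<close> on the sphere, as soon as \<open>\<rho> = 2 g'\<close> satisfies the equation
  \<open>3 \<rho> + 2 t \<rho>' = 5 g \<rho>\<close>. Its conormal derivative is \<open>\<partial>\<^sub>\<nu>H - \<rho>(1) (H - h)\<close>, so averages of these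
  Dirichlet-to-Neumann maps only see the average of \<open>\<rho>(1) = 2/5 (4 - \<kappa>\<^sup>2)\<close>, and
  \<open>7/12 \<cdot> 4 + 5/12 \<cdot> 16 = 9\<close>. The conductivities themselves do not average, as their values at the origin show.
\<close>

text \<open>The equation for g is a total derivative. Integrated once it is the Riccati equation 2 t
  g' = 5/2 (g - a) (g - b) with a = (1 + 2 \<kappa>)/5, b = (1 - 2 \<kappa>)/5, so (g - a)/(g - b)
  is a multiple of t^\<kappa>, fixed by g(1) = 1. Integer \<kappa> makes g rational in |x|^2, hence
  smooth at the origin. The obstacle is regularity: H and h are limits in H^1, and no interior
  smoothness of harmonic functions is derived. The equation for u is therefore never evaluated
  pointwise; it is tested against H^1 functions, and Green's formula for the radial field x takes
  the place of second derivatives. What this asks of h is harmonicity against \<eta>(|x|^2) v with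
  \<eta>(1) = 0. Averages along rays inherit it from H: the dilation in the average can be moved
  onto the test function, which shrinks inside the ball and stays admissible. The average of H(s^2
  x) has weight s^4, where 4 = 2 * 3 - 2 cancels the cost of dilation in dimension 3. A weight s^j
  would put j + 1 in place of 5 and j/2 in place of the base value \<kappa> = 2.\<close>

section \<open>Calculus of smooth functions and their gradients\<close>

lemma Ck_on_SucI:
  assumes "\<And>x. (f has_derivative f' x) (at x)" "\<And>v. Ck_on UNIV k (\<lambda>x. f' x v)"
  shows "Ck_on UNIV (Suc k) f"
proof -
  have "frechet_derivative f (at x) = f' x" for x
    using assms(1) frechet_derivative_at by metis
  with assms show ?thesis by (auto simp: differentiable_def)
qed

lemma Ck_on_SucD:
  assumes "Ck_on UNIV (Suc k) f"
  shows "(f has_derivative frechet_derivative f (at x)) (at x)"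
    "Ck_on UNIV k (\<lambda>x. frechet_derivative f (at x) v)"
  using assms by (auto simp: frechet_derivative_works)

text \<open>The rules for products and inverses leave undifferentiated factors in the derivative;
  these are needed with one order less than assumed.\<close>

lemma Ck_on_Suc_imp: "Ck_on UNIV (Suc k) f \<Longrightarrow> Ck_on UNIV k f"
proof (induction k arbitrary: f)
  case 0
  then show ?case
    by (auto intro!: differentiable_imp_continuous_on simp: differentiable_on_def)
next
  case (Suc k)
  then show ?case by (metis Ck_on.simps(2))
qed

lemma Ck_on_const: "Ck_on UNIV k (\<lambda>x. c)"
proof (induction k arbitrary: c)
  case (Suc k)
  show ?case
    by (rule Ck_on_SucI[where f' = "\<lambda>x v. 0"]) (use Suc in auto)
qed auto

lemma Ck_on_add: "Ck_on UNIV k f \<Longrightarrow> Ck_on UNIV k g \<Longrightarrow> Ck_on UNIV k (\<lambda>x. f x + g x)"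
proof (induction k arbitrary: f g)
  case 0
  then show ?case by (auto intro!: continuous_intros)
next
  case (Suc k)
  show ?case
    by (rule Ck_on_SucI[where f' = "\<lambda>x v. frechet_derivative f (at x) v + frechet_derivative g (at x) v"])
       (intro has_derivative_add Ck_on_SucD(1)[OF Suc.prems(1)] Ck_on_SucD(1)[OF Suc.prems(2)]
         Suc.IH Ck_on_SucD(2)[OF Suc.prems(1)] Ck_on_SucD(2)[OF Suc.prems(2)])+
qed

lemma Ck_on_mult: "Ck_on UNIV k f \<Longrightarrow> Ck_on UNIV k g \<Longrightarrow> Ck_on UNIV k (\<lambda>x. f x * g x)"
proof (induction k arbitrary: f g)
  case 0
  then show ?case by (auto intro!: continuous_intros)
next
  case (Suc k)
  show ?case
    by (rule Ck_on_SucI[where f' = "\<lambda>x v. f x * frechet_derivative g (at x) v + frechet_derivative f (at x) v * g x"])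
       (intro has_derivative_mult Ck_on_SucD(1)[OF Suc.prems(1)] Ck_on_SucD(1)[OF Suc.prems(2)]
         Ck_on_add Suc.IH Ck_on_SucD(2)[OF Suc.prems(1)] Ck_on_SucD(2)[OF Suc.prems(2)]
         Ck_on_Suc_imp[OF Suc.prems(1)] Ck_on_Suc_imp[OF Suc.prems(2)])+
qed

lemma Ck_on_inverse:
  assumes "\<And>x. f x \<noteq> 0"
  shows "Ck_on UNIV k f \<Longrightarrow> Ck_on UNIV k (\<lambda>x. inverse (f x))"
proof (induction k)
  case 0
  then show ?case using assms by (auto intro!: continuous_intros)
next
  case (Suc k)
  have *: "Ck_on UNIV k (\<lambda>x. inverse (f x))" using Suc.IH Ck_on_Suc_imp[OF Suc.prems] .
  have eq: "(\<lambda>x. -(inverse (f x) * frechet_derivative f (at x) v * inverse (f x)))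
        = (\<lambda>x. (-1) * ((inverse (f x) * frechet_derivative f (at x) v) * inverse (f x)))" for v
    by auto
  show ?case
  proof (rule Ck_on_SucI)
    show "((\<lambda>x. inverse (f x)) has_derivative (\<lambda>v. -(inverse (f x) * frechet_derivative f (at x) v * inverse (f x)))) (at x)" for x
      using Deriv.has_derivative_inverse[OF assms Ck_on_SucD(1)[OF Suc.prems]] by auto
    show "Ck_on UNIV k (\<lambda>x. -(inverse (f x) * frechet_derivative f (at x) v * inverse (f x)))" for v
      unfolding eq by (intro Ck_on_mult Ck_on_const * Ck_on_SucD(2)[OF Suc.prems])
  qed
qed

lemma Ck_on_scale: "Ck_on UNIV k f \<Longrightarrow> Ck_on UNIV k (\<lambda>x. f (c *\<^sub>R x))"
proof (induction k arbitrary: f)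
  case 0
  then show ?case
    by (auto intro!: continuous_on_compose2[OF _ continuous_on_scaleR[OF continuous_on_const continuous_on_id]])
next
  case (Suc k)
  have eq: "(\<lambda>x. frechet_derivative f (at (c *\<^sub>R x)) (c *\<^sub>R v)) =
      (\<lambda>x. c * frechet_derivative f (at (c *\<^sub>R x)) v)" for v
    using has_derivative_linear[OF Ck_on_SucD(1)[OF Suc.prems]]
    by (simp add: linear_scale)
  show ?case
  proof (rule Ck_on_SucI)
    show "((\<lambda>x. f (c *\<^sub>R x)) has_derivative (\<lambda>v. frechet_derivative f (at (c *\<^sub>R x)) (c *\<^sub>R v))) (at x)" for x
      by (rule has_derivative_compose[of "\<lambda>x. c *\<^sub>R x" "\<lambda>v. c *\<^sub>R v", OF _ Ck_on_SucD(1)[OF Suc.prems]])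
         (auto intro!: derivative_eq_intros)
    show "Ck_on UNIV k (\<lambda>x. frechet_derivative f (at (c *\<^sub>R x)) (c *\<^sub>R v))" for v
      unfolding eq by (intro Ck_on_mult Ck_on_const Suc.IH Ck_on_SucD(2)[OF Suc.prems])
  qed
qed

lemma Ck_on_inner: "Ck_on UNIV k (\<lambda>x. x \<bullet> a)"
proof (cases k)
  case (Suc j)
  show ?thesis unfolding Suc
    by (rule Ck_on_SucI[where f' = "\<lambda>x v. v \<bullet> a"])
       (auto intro!: derivative_eq_intros Ck_on_const)
qed (auto intro!: continuous_intros)

context
  fixes f g :: "'a::euclidean_space \<Rightarrow> real"
begin

lemma smooth_on_const [simp]: "smooth_on UNIV (\<lambda>x::'a. c)"
  by (simp add: smooth_on_def Ck_on_const)

lemma smooth_on_add: "smooth_on UNIV f \<Longrightarrow> smooth_on UNIV g \<Longrightarrow> smooth_on UNIV (\<lambda>x. f x + g x)"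
  by (simp add: smooth_on_def Ck_on_add)

lemma smooth_on_mult: "smooth_on UNIV f \<Longrightarrow> smooth_on UNIV g \<Longrightarrow> smooth_on UNIV (\<lambda>x. f x * g x)"
  by (simp add: smooth_on_def Ck_on_mult)

lemma smooth_on_inverse: "smooth_on UNIV f \<Longrightarrow> (\<And>x. f x \<noteq> 0) \<Longrightarrow> smooth_on UNIV (\<lambda>x. inverse (f x))"
  by (simp add: smooth_on_def Ck_on_inverse)

lemma smooth_on_scale: "smooth_on UNIV f \<Longrightarrow> smooth_on UNIV (\<lambda>x. f (c *\<^sub>R x))"
  by (simp add: smooth_on_def Ck_on_scale)

lemma smooth_on_inner: "smooth_on UNIV (\<lambda>x::'a. x \<bullet> a)"
  by (simp add: smooth_on_def Ck_on_inner)

end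

lemma smooth_on_uminus: "smooth_on UNIV f \<Longrightarrow> smooth_on UNIV (\<lambda>x. - f x)"
  using smooth_on_mult[OF smooth_on_const[of "-1"]] by simp

lemma smooth_on_diff: "smooth_on UNIV f \<Longrightarrow> smooth_on UNIV g \<Longrightarrow> smooth_on UNIV (\<lambda>x. f x - g x)"
  using smooth_on_add[OF _ smooth_on_uminus] by fastforce

lemma smooth_on_divide:
  "smooth_on UNIV f \<Longrightarrow> smooth_on UNIV g \<Longrightarrow> (\<And>x. g x \<noteq> 0) \<Longrightarrow> smooth_on UNIV (\<lambda>x. f x / g x)"
  unfolding divide_inverse by (intro smooth_on_mult smooth_on_inverse)

lemma smooth_on_power: "smooth_on UNIV f \<Longrightarrow> smooth_on UNIV (\<lambda>x. f x ^ n)"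
  by (induction n) (auto intro: smooth_on_mult)

lemma smooth_on_sum: "(\<And>i. i \<in> I \<Longrightarrow> smooth_on UNIV (f i)) \<Longrightarrow> smooth_on UNIV (\<lambda>x. \<Sum>i\<in>I. f i x)"
  by (induction I rule: infinite_finite_induct) (auto intro: smooth_on_add)

lemma smooth_on_norm_sq: "smooth_on UNIV (\<lambda>x::'a::euclidean_space. x \<bullet> x)"
  unfolding euclidean_inner[of x x for x::'a]
  by (intro smooth_on_sum smooth_on_mult smooth_on_inner)

lemma smooth_on_frechet: "smooth_on UNIV f \<Longrightarrow> smooth_on UNIV (\<lambda>x. frechet_derivative f (at x) v)"
  unfolding smooth_on_def by (metis Ck_on.simps(2))

lemma grad_inner:
  assumes "f differentiable (at x)"
  shows "grad f x \<bullet> v = frechet_derivative f (at x) v"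
proof -
  have l: "linear (frechet_derivative f (at x))"
    using assms by (simp add: linear_frechet_derivative)
  have "frechet_derivative f (at x) v = frechet_derivative f (at x) (\<Sum>b\<in>Basis. (v \<bullet> b) *\<^sub>R b)"
    by (simp add: euclidean_representation)
  also have "\<dots> = grad f x \<bullet> v"
    by (simp add: linear_sum[OF l] linear_scale[OF l] grad_def inner_sum_left)
       (simp add: inner_commute mult.commute)
  finally show ?thesis by simp
qed

lemma smooth_on_has_derivative:
  assumes "smooth_on UNIV f"
  shows "(f has_derivative (\<lambda>v. grad f x \<bullet> v)) (at x)"
proof -
  have "Ck_on UNIV (Suc 0) f" using assms smooth_on_def by blast
  from Ck_on_SucD(1)[OF this] have *: "(f has_derivative frechet_derivative f (at x)) (at x)" .
  then have "(\<lambda>v. grad f x \<bullet> v) = frechet_derivative f (at x)"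
    by (auto simp: grad_inner differentiableI)
  with * show ?thesis by simp
qed

lemma frechet_eq_grad:
  "smooth_on UNIV f \<Longrightarrow> frechet_derivative f (at x) v = grad f x \<bullet> v"
  by (metis frechet_derivative_at smooth_on_has_derivative)

lemma smooth_on_grad: "smooth_on UNIV f \<Longrightarrow> smooth_on UNIV (\<lambda>x. grad f x \<bullet> v)"
  using smooth_on_frechet[of f v] by (simp add: frechet_eq_grad)

lemma smooth_on_continuous: "smooth_on UNIV f \<Longrightarrow> continuous_on S f"
  unfolding smooth_on_def by (metis Ck_on.simps(1) continuous_on_subset subset_UNIV)

lemma continuous_on_grad: "smooth_on UNIV f \<Longrightarrow> continuous_on S (grad f)"
  by (subst continuous_on_componentwise) (auto intro!: smooth_on_continuous smooth_on_grad)

lemma grad_eqI: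
  assumes "(f has_derivative (\<lambda>v. a \<bullet> v)) (at x)"
  shows "grad f x = a"
proof -
  have "frechet_derivative f (at x) = (\<lambda>v. a \<bullet> v)"
    using frechet_derivative_at[OF assms] by simp
  then have "grad f x = (\<Sum>b\<in>Basis. (a \<bullet> b) *\<^sub>R b)" unfolding grad_def by simp
  then show ?thesis by (simp add: euclidean_representation)
qed

lemma grad_add:
  assumes "smooth_on UNIV f" "smooth_on UNIV g"
  shows "grad (\<lambda>x. f x + g x) x = grad f x + grad g x"
  by (rule grad_eqI) (auto intro!: derivative_eq_intros smooth_on_has_derivative assms simp: inner_add_left)

lemma grad_diff:
  assumes "smooth_on UNIV f" "smooth_on UNIV g"
  shows "grad (\<lambda>x. f x - g x) x = grad f x - grad g x"
  by (rule grad_eqI) (auto intro!: derivative_eq_intros smooth_on_has_derivative assms simp: inner_diff_left)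

lemma grad_mult:
  assumes "smooth_on UNIV f" "smooth_on UNIV g"
  shows "grad (\<lambda>x. f x * g x) x = f x *\<^sub>R grad g x + g x *\<^sub>R grad f x"
  by (rule grad_eqI)
     (auto intro!: derivative_eq_intros smooth_on_has_derivative assms simp: inner_add_left mult.commute)

lemma grad_scale:
  assumes "smooth_on UNIV f"
  shows "grad (\<lambda>x. f (c *\<^sub>R x)) x = c *\<^sub>R grad f (c *\<^sub>R x)"
proof (rule grad_eqI)
  have "((\<lambda>x. c *\<^sub>R x) has_derivative (\<lambda>v. c *\<^sub>R v)) (at x)"
    by (auto intro!: derivative_eq_intros)
  from has_derivative_compose[OF this smooth_on_has_derivative[OF assms]]
  show "((\<lambda>x. f (c *\<^sub>R x)) has_derivative (\<lambda>v. (c *\<^sub>R grad f (c *\<^sub>R x)) \<bullet> v)) (at x)"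
    by simp
qed

lemma grad_const [simp]: "grad (\<lambda>x. c) x = 0"
  by (rule grad_eqI) auto

section \<open>Averages along rays\<close>

text \<open>The dilation factor is squared so that only integer exponents occur: in terms of
  \<open>s\<^sup>2\<close> the weight would be a half-integer power for even \<open>j\<close>. The
  multiple \<open>(j + 1) * ray_mean j f\<close> fixes constants and is the solution
  \<open>h\<close> of h + 2/(j + 1) x \<bullet> \<nabla>h = f.\<close>

definition ray_mean :: "nat \<Rightarrow> ('a::euclidean_space \<Rightarrow> real) \<Rightarrow> 'a \<Rightarrow> real" where
  "ray_mean j f x = integral {0..1} (\<lambda>s. s ^ j * f (s\<^sup>2 *\<^sub>R x))"

lemma continuous_on_ray:
  fixes f :: "'a::euclidean_space \<Rightarrow> real"
  assumes "continuous_on UNIV f"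
  shows "continuous_on S (\<lambda>s::real. s ^ j * f (s\<^sup>2 *\<^sub>R x) :: real)"
  by (intro continuous_intros continuous_on_compose2[OF assms]) auto

lemma ray_mean_has_derivative:
  fixes f :: "'a::euclidean_space \<Rightarrow> real"
  assumes der: "\<And>x. (f has_derivative (\<lambda>v. G x \<bullet> v)) (at x)" and G: "continuous_on UNIV G"
  shows "(ray_mean j f has_derivative (\<lambda>v. ray_mean (j + 2) (\<lambda>y. G y \<bullet> v) x)) (at x)"
proof -
  have contf: "continuous_on UNIV f"
    using der has_derivative_continuous_on[of UNIV f "\<lambda>x v. G x \<bullet> v"] by auto
  \<comment> \<open>Leibniz's rule wants the derivative of the integrand as a bounded linear map
    that is jointly continuous in the point and the parameter.\<close>
  define F where "F = (\<lambda>x s. blinfun_inner_left (s ^ (j + 2) *\<^sub>R G (s\<^sup>2 *\<^sub>R x)) :: 'a \<Rightarrow>\<^sub>L real)"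
  have 1: "((\<lambda>x. s ^ j * f (s\<^sup>2 *\<^sub>R x)) has_derivative blinfun_apply (F x s)) (at x within UNIV)" for x s
  proof -
    have "((\<lambda>x. s\<^sup>2 *\<^sub>R x) has_derivative (\<lambda>v. s\<^sup>2 *\<^sub>R v)) (at x)"
      by (auto intro!: derivative_eq_intros)
    from has_derivative_mult_right[OF has_derivative_compose[OF this der], of "s^j"]
    show ?thesis by (simp add: F_def power_add power2_eq_square mult_ac inner_commute)
  qed
  have cF: "continuous_on (UNIV \<times> cbox 0 1) (\<lambda>(x, s). F x s)"
    unfolding F_def split_beta
    by (intro bounded_linear.continuous_on[OF bounded_linear_blinfun_inner_left] continuous_intros
        continuous_on_compose2[OF G]) auto
  have *: "((\<lambda>x. integral (cbox 0 1) (\<lambda>s. s ^ j * f (s\<^sup>2 *\<^sub>R x))) has_derivative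
     blinfun_apply (integral (cbox 0 1) (F x))) (at x within UNIV)"
    by (rule leibniz_rule[OF 1 _ cF])
       (auto intro!: integrable_continuous_real continuous_on_ray contf)
  have "blinfun_apply (integral (cbox 0 1) (F x)) v = ray_mean (j + 2) (\<lambda>y. G y \<bullet> v) x" for v
  proof -
    have "continuous_on (cbox 0 1) (F x)"
      unfolding F_def
      by (intro bounded_linear.continuous_on[OF bounded_linear_blinfun_inner_left] continuous_intros
        continuous_on_compose2[OF G]) auto
    then have "F x integrable_on cbox 0 1" by (rule integrable_continuous)
    from blinfun_apply_integral[OF this, of v] show ?thesis
      by (simp add: ray_mean_def F_def inner_commute)
  qed
  then have "blinfun_apply (integral (cbox 0 1) (F x)) = (\<lambda>v. ray_mean (j + 2) (\<lambda>y. G y \<bullet> v) x)"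
    by (rule ext)
  moreover have "ray_mean j f = (\<lambda>x. integral (cbox 0 1) (\<lambda>s. s ^ j * f (s\<^sup>2 *\<^sub>R x)))"
    by (auto simp: ray_mean_def)
  ultimately show ?thesis using * by simp
qed

text \<open>A directional derivative of an average is again an average, of the directional
  derivative and with exponent raised by 2. Hence the induction is over all \<open>f\<close> and
  \<open>j\<close> at once.\<close>

lemma Ck_on_ray_mean: "smooth_on UNIV f \<Longrightarrow> Ck_on UNIV k (ray_mean j f)"
proof (induction k arbitrary: f j)
  case 0
  have "(ray_mean j f has_derivative (\<lambda>v. ray_mean (j + 2) (\<lambda>y. grad f y \<bullet> v) x)) (at x)" for x
    by (intro ray_mean_has_derivative smooth_on_has_derivative continuous_on_grad 0)
  then show ?case
    using has_derivative_continuous_on[of UNIV "ray_mean j f" "\<lambda>x v. ray_mean (j + 2) (\<lambda>y. grad f y \<bullet> v) x"] by auto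
next
  case (Suc k)
  show ?case
    by (rule Ck_on_SucI[where f' = "\<lambda>x v. ray_mean (j + 2) (\<lambda>y. grad f y \<bullet> v) x"])
       (intro ray_mean_has_derivative smooth_on_has_derivative continuous_on_grad Suc smooth_on_grad)+
qed

lemma smooth_on_ray_mean: "smooth_on UNIV f \<Longrightarrow> smooth_on UNIV (ray_mean j f)"
  by (simp add: smooth_on_def Ck_on_ray_mean)

lemma grad_ray_mean:
  assumes "smooth_on UNIV f"
  shows "grad (ray_mean j f) x \<bullet> v = ray_mean (j + 2) (\<lambda>y. grad f y \<bullet> v) x"
proof -
  have "(ray_mean j f has_derivative (\<lambda>v. ray_mean (j + 2) (\<lambda>y. grad f y \<bullet> v) x)) (at x)"
    by (intro ray_mean_has_derivative smooth_on_has_derivative continuous_on_grad assms)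
  moreover have "(ray_mean j f has_derivative (\<lambda>v. grad (ray_mean j f) x \<bullet> v)) (at x)"
    by (intro smooth_on_has_derivative smooth_on_ray_mean assms)
  ultimately show ?thesis using has_derivative_unique by metis
qed

lemma ray_mean_diff:
  assumes "continuous_on UNIV f" "continuous_on UNIV g"
  shows "ray_mean j (\<lambda>x. f x - g x) x = ray_mean j f x - ray_mean j g x"
  unfolding ray_mean_def right_diff_distrib
  by (intro integral_diff integrable_continuous_real continuous_on_ray assms)

text \<open>Integrate the \<open>s\<close> derivative of
  \<open>s ^ (j+1) * f (s\<^sup>2 *\<^sub>R x)\<close> over the unit interval; the boundary term at
  0 vanishes and the one at 1 is \<open>f x\<close>.\<close>

lemma radial_derivative_ray_mean:
  assumes "smooth_on UNIV f"
  shows "2 * (grad (ray_mean j f) x \<bullet> x) = f x - (real j + 1) * ray_mean j f x"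
proof -
  have "((\<lambda>s. s ^ (j+1) * f (s\<^sup>2 *\<^sub>R x)) has_vector_derivative
      (real j + 1) * (s ^ j * f (s\<^sup>2 *\<^sub>R x)) + 2 * (s ^ (j + 2) * (grad f (s\<^sup>2 *\<^sub>R x) \<bullet> x))) (at s within {0..1})" for s :: real
  proof -
    have "((\<lambda>s. s\<^sup>2 *\<^sub>R x) has_derivative (\<lambda>t. (2 * s * t) *\<^sub>R x)) (at s within {0..1})"
      by (auto intro!: derivative_eq_intros)
    from has_derivative_compose[OF this smooth_on_has_derivative[OF assms]]
    have "((\<lambda>s. f (s\<^sup>2 *\<^sub>R x)) has_real_derivative 2 * s * (grad f (s\<^sup>2 *\<^sub>R x) \<bullet> x)) (at s within {0..1})"
      unfolding has_field_derivative_def by (rule has_derivative_eq_rhs) (auto simp: mult_ac)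
    from DERIV_mult[OF DERIV_pow[of "j+1"] this]
    show ?thesis
      unfolding has_real_derivative_iff_has_vector_derivative
      by (simp add: power_add algebra_simps power2_eq_square)
  qed
  then have "((\<lambda>s. (real j + 1) * (s ^ j * f (s\<^sup>2 *\<^sub>R x)) + 2 * (s ^ (j + 2) * (grad f (s\<^sup>2 *\<^sub>R x) \<bullet> x)))
      has_integral (1 ^ (j+1) * f (1\<^sup>2 *\<^sub>R x) - 0 ^ (j+1) * f (0\<^sup>2 *\<^sub>R x))) {0..1}"
    by (intro fundamental_theorem_of_calculus) auto
  then have "f x = integral {0..1} (\<lambda>s. (real j + 1) * (s ^ j * f (s\<^sup>2 *\<^sub>R x)) + 2 * (s ^ (j + 2) * (grad f (s\<^sup>2 *\<^sub>R x) \<bullet> x)))"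
    by (simp add: integral_unique)
  also have "\<dots> = (real j + 1) * ray_mean j f x + 2 * ray_mean (j + 2) (\<lambda>y. grad f y \<bullet> x) x"
    unfolding ray_mean_def
    by (subst integral_add)
       (auto intro!: integrable_continuous_real continuous_intros continuous_on_compose2[OF smooth_on_continuous[OF assms]]
         continuous_on_compose2[OF continuous_on_grad[OF assms]] simp del: power_Suc)
  finally show ?thesis by (simp add: grad_ray_mean[OF assms])
qed

section \<open>Square integrable functions\<close>

definition l2 :: "'a measure \<Rightarrow> ('a \<Rightarrow> 'b::euclidean_space) \<Rightarrow> real" where
  "l2 M f = sqrt (LINT x|M. (norm (f x))\<^sup>2)"

lemma l2_nonneg [simp]: "0 \<le> l2 M f"
  by (simp add: l2_def)

lemma l2_sq: "(l2 M f)\<^sup>2 = (LINT x|M. (norm (f x))\<^sup>2)"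
  by (simp add: l2_def)

lemma l2_cong: "(\<And>x. x \<in> space M \<Longrightarrow> norm (f x) = norm (g x)) \<Longrightarrow> l2 M f = l2 M g"
  unfolding l2_def by (intro arg_cong[where f = sqrt] Bochner_Integration.integral_cong) auto

lemma square_integrable_meas [dest]: "square_integrable M f \<Longrightarrow> f \<in> borel_measurable M"
  by (simp add: square_integrable_def)

lemma square_integrable_inner:
  assumes "square_integrable M f" "square_integrable M g"
  shows "integrable M (\<lambda>x. f x \<bullet> g x)"
proof (rule Bochner_Integration.integrable_bound)
  show "integrable M (\<lambda>x. (norm (f x))\<^sup>2 + (norm (g x))\<^sup>2)"
    using assms by (auto simp: square_integrable_def)
  show "(\<lambda>x. f x \<bullet> g x) \<in> borel_measurable M"
    using assms by (auto simp: square_integrable_def)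
  have "norm (f x \<bullet> g x) \<le> (norm (f x))\<^sup>2 + (norm (g x))\<^sup>2" for x
  proof -
      have "norm (f x \<bullet> g x) \<le> norm (f x) * norm (g x)" by (simp add: Cauchy_Schwarz_ineq2)
    also have "\<dots> \<le> (norm (f x))\<^sup>2 + (norm (g x))\<^sup>2"
      using sum_squares_bound[of "norm (f x)" "norm (g x)"]
        mult_nonneg_nonneg[OF norm_ge_zero[of "f x"] norm_ge_zero[of "g x"]]
      unfolding mult.assoc by linarith
    finally show ?thesis .
  qed
  then show "AE x in M. norm (f x \<bullet> g x) \<le> norm ((norm (f x))\<^sup>2 + (norm (g x))\<^sup>2)" by simp
qed

lemma square_integrable_mult:
  fixes f g :: "'a \<Rightarrow> real"
  assumes "square_integrable M f" "square_integrable M g"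
  shows "integrable M (\<lambda>x. f x * g x)"
  using square_integrable_inner[OF assms] by simp

lemma square_integrable_norm_sq:
  "square_integrable M f \<Longrightarrow> integrable M (\<lambda>x. (norm (f x))\<^sup>2)"
  by (simp add: square_integrable_def)

lemma square_integrable_add:
  assumes "square_integrable M f" "square_integrable M g"
  shows "square_integrable M (\<lambda>x. f x + g x)"
proof -
  have "integrable M (\<lambda>x. f x \<bullet> f x + 2 * (f x \<bullet> g x) + g x \<bullet> g x)"
    using assms by (intro Bochner_Integration.integrable_add integrable_mult_right square_integrable_inner)
  moreover have "f x \<bullet> f x + 2 * (f x \<bullet> g x) + g x \<bullet> g x = (norm (f x + g x))\<^sup>2" for x
    by (simp add: power2_norm_eq_inner algebra_simps inner_commute)
  ultimately show ?thesis using assms by (auto simp: square_integrable_def)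
qed

lemma square_integrable_bounded_scaleR:
  fixes b :: "'a \<Rightarrow> real"
  assumes f: "square_integrable M f" and b: "b \<in> borel_measurable M" "\<And>x. x \<in> space M \<Longrightarrow> \<bar>b x\<bar> \<le> C"
  shows "square_integrable M (\<lambda>x. b x *\<^sub>R f x)"
proof -
  have "integrable M (\<lambda>x. (norm (b x *\<^sub>R f x))\<^sup>2)"
  proof (rule Bochner_Integration.integrable_bound)
    show "integrable M (\<lambda>x. C\<^sup>2 * (norm (f x))\<^sup>2)"
      using f by (auto simp: square_integrable_def)
    show "(\<lambda>x. (norm (b x *\<^sub>R f x))\<^sup>2) \<in> borel_measurable M"
      using f b by (auto simp: square_integrable_def)
    have "(norm (b x *\<^sub>R f x))\<^sup>2 \<le> C\<^sup>2 * (norm (f x))\<^sup>2" if "x \<in> space M" for x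
      using power_mono[OF b(2)[OF that], of 2] by (simp add: power_mult_distrib mult_right_mono)
    then show "AE x in M. norm ((norm (b x *\<^sub>R f x))\<^sup>2) \<le> norm (C\<^sup>2 * (norm (f x))\<^sup>2)"
      by (intro AE_I2) auto
  qed
  then show ?thesis using f b by (auto simp: square_integrable_def)
qed

lemma square_integrable_scaleR:
  "square_integrable M f \<Longrightarrow> square_integrable M (\<lambda>x. c *\<^sub>R f x)"
  by (rule square_integrable_bounded_scaleR[where C = "\<bar>c\<bar>"]) auto

lemma square_integrable_diff:
  assumes "square_integrable M f" "square_integrable M g"
  shows "square_integrable M (\<lambda>x. f x - g x)"
  using square_integrable_add[OF assms(1) square_integrable_scaleR[OF assms(2), of "-1"]] by simp

lemma square_integrable_zero [simp]: "square_integrable M (\<lambda>x. 0)"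
  by (simp add: square_integrable_def)

lemma square_integrable_inner_right:
  assumes "square_integrable M f" and b: "b \<in> borel_measurable M" "\<And>x. x \<in> space M \<Longrightarrow> norm (b x) \<le> C"
  shows "square_integrable M (\<lambda>x. f x \<bullet> b x)"
proof -
  have "integrable M (\<lambda>x. (norm (f x \<bullet> b x))\<^sup>2)"
  proof (rule Bochner_Integration.integrable_bound)
    show "integrable M (\<lambda>x. C\<^sup>2 * (norm (f x))\<^sup>2)"
      using assms by (auto simp: square_integrable_def)
    show "(\<lambda>x. (norm (f x \<bullet> b x))\<^sup>2) \<in> borel_measurable M"
      using assms by (auto simp: square_integrable_def)
    have "(norm (f x \<bullet> b x))\<^sup>2 \<le> C\<^sup>2 * (norm (f x))\<^sup>2" if "x \<in> space M" for x
    proof -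
      have "norm (f x \<bullet> b x) \<le> norm (f x) * norm (b x)" by (simp add: Cauchy_Schwarz_ineq2)
      also have "\<dots> \<le> norm (f x) * C" using b(2)[OF that] by (intro mult_left_mono) auto
      finally have "(norm (f x \<bullet> b x))\<^sup>2 \<le> (norm (f x) * C)\<^sup>2" by (intro power_mono) auto
      then show ?thesis by (simp add: power_mult_distrib mult.commute)
    qed
    then show "AE x in M. norm ((norm (f x \<bullet> b x))\<^sup>2) \<le> norm (C\<^sup>2 * (norm (f x))\<^sup>2)"
      by (intro AE_I2) auto
  qed
  then show ?thesis using assms by (auto simp: square_integrable_def)
qed

lemma l2_Cauchy_Schwarz:
  assumes f: "square_integrable M f" and g: "square_integrable M g"
  shows "\<bar>LINT x|M. f x \<bullet> g x\<bar> \<le> l2 M f * l2 M g"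
proof -
  define A B C where "A = (LINT x|M. f x \<bullet> f x)" and "B = (LINT x|M. g x \<bullet> g x)" and "C = (LINT x|M. f x \<bullet> g x)"
  have q: "0 \<le> A - 2 * t * C + t\<^sup>2 * B" for t
  proof -
    have "0 \<le> (LINT x|M. (f x - t *\<^sub>R g x) \<bullet> (f x - t *\<^sub>R g x))"
      by (intro Bochner_Integration.integral_nonneg) auto
    also have "\<dots> = (LINT x|M. f x \<bullet> f x - (2 * t) * (f x \<bullet> g x) + t\<^sup>2 * (g x \<bullet> g x))"
      by (intro Bochner_Integration.integral_cong) (auto simp: algebra_simps inner_commute power2_eq_square)
    also have "\<dots> = A - 2 * t * C + t\<^sup>2 * B"
      unfolding A_def B_def C_def using f g
      by (simp add: square_integrable_inner)
    finally show ?thesis .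
  qed
  have A: "A \<ge> 0" and B: "B \<ge> 0" unfolding A_def B_def by (auto intro!: Bochner_Integration.integral_nonneg)
  have "C\<^sup>2 \<le> A * B"
  proof (cases "B = 0")
    case True
    have "C = 0"
    proof (rule ccontr)
      assume "C \<noteq> 0"
      \<comment> \<open>For \<open>B = 0\<close> the quadratic is affine in \<open>t\<close>, and
        this \<open>t\<close> gives it the value -1.\<close>
      with q[of "(A + 1) / (2 * C)"] True show False by (simp add: field_simps)
    qed
    then show ?thesis using A B by simp
  next
    case False
    have "0 \<le> A - 2 * (C / B) * C + (C/B)\<^sup>2 * B" by (rule q)
    also have "\<dots> = A - C\<^sup>2 / B" using False by (simp add: field_simps power2_eq_square)
    finally show ?thesis using False B by (simp add: field_simps)
  qed
  then have "sqrt (C\<^sup>2) \<le> sqrt (A * B)" by (rule real_sqrt_le_mono)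
  then show ?thesis
    by (simp add: l2_def A_def B_def C_def real_sqrt_mult power2_norm_eq_inner)
qed

lemma l2_triangle:
  assumes f: "square_integrable M f" and g: "square_integrable M g"
  shows "l2 M (\<lambda>x. f x + g x) \<le> l2 M f + l2 M g"
proof (rule power2_le_imp_le)
  have "(l2 M (\<lambda>x. f x + g x))\<^sup>2 = (LINT x|M. f x \<bullet> f x + 2 * (f x \<bullet> g x) + g x \<bullet> g x)"
    unfolding l2_sq by (intro Bochner_Integration.integral_cong)
      (auto simp: power2_norm_eq_inner algebra_simps inner_commute)
  also have "\<dots> = (l2 M f)\<^sup>2 + 2 * (LINT x|M. f x \<bullet> g x) + (l2 M g)\<^sup>2"
    unfolding l2_sq power2_norm_eq_inner using f g by (simp add: square_integrable_inner)
  also have "\<dots> \<le> (l2 M f)\<^sup>2 + 2 * (l2 M f * l2 M g) + (l2 M g)\<^sup>2"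
    using l2_Cauchy_Schwarz[OF f g] by (intro add_mono mult_left_mono) auto
  finally show "(l2 M (\<lambda>x. f x + g x))\<^sup>2 \<le> (l2 M f + l2 M g)\<^sup>2"
    by (simp add: power2_sum)
qed auto

lemma l2_scaleR: "l2 M (\<lambda>x. c *\<^sub>R f x) = \<bar>c\<bar> * l2 M f"
  by (simp add: l2_def power_mult_distrib real_sqrt_mult)

lemma l2_minus_commute: "l2 M (\<lambda>x. f x - g x) = l2 M (\<lambda>x. g x - f x)"
  by (intro l2_cong) (simp add: norm_minus_commute)

lemma l2_triangle_diff:
  assumes "square_integrable M f" "square_integrable M g" "square_integrable M h"
  shows "l2 M (\<lambda>x. f x - h x) \<le> l2 M (\<lambda>x. f x - g x) + l2 M (\<lambda>x. g x - h x)"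
  using l2_triangle[OF square_integrable_diff[OF assms(1,2)] square_integrable_diff[OF assms(2,3)]] by simp

lemma l2_mono:
  assumes "square_integrable M g" "f \<in> borel_measurable M" "0 \<le> C"
    and "\<And>x. x \<in> space M \<Longrightarrow> norm (f x) \<le> C * norm (g x)"
  shows "square_integrable M f" "l2 M f \<le> C * l2 M g"
proof -
  have le: "(norm (f x))\<^sup>2 \<le> C\<^sup>2 * (norm (g x))\<^sup>2" if "x \<in> space M" for x
    using power_mono[OF assms(4)[OF that], of 2] by (simp add: power_mult_distrib)
  have gi: "integrable M (\<lambda>x. C\<^sup>2 * (norm (g x))\<^sup>2)"
    using assms(1) by (simp add: square_integrable_def)
  have fi: "integrable M (\<lambda>x. (norm (f x))\<^sup>2)"
    by (rule Bochner_Integration.integrable_bound[OF gi]) (use assms(2) le in \<open>auto intro!: AE_I2\<close>)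
  then show "square_integrable M f" using assms(2) by (simp add: square_integrable_def)
  have "(LINT x|M. (norm (f x))\<^sup>2) \<le> (LINT x|M. C\<^sup>2 * (norm (g x))\<^sup>2)"
    by (intro integral_mono fi gi le)
  then have "(l2 M f)\<^sup>2 \<le> (C * l2 M g)\<^sup>2" by (simp add: l2_sq power_mult_distrib)
  then show "l2 M f \<le> C * l2 M g" by (rule power2_le_imp_le) (use assms in simp)
qed

text \<open>Square integrability is part of the notion because the integral of a non-integrable
  function is 0 by convention, so that convergence of \<open>l2\<close> alone could hold
  vacuously.\<close>

definition l2_lim :: "'a measure \<Rightarrow> (nat \<Rightarrow> 'a \<Rightarrow> 'b::euclidean_space) \<Rightarrow> ('a \<Rightarrow> 'b) \<Rightarrow> bool" where
  "l2_lim M F f \<longleftrightarrow> (\<forall>n. square_integrable M (F n)) \<and> square_integrable M f \<and>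
     (\<lambda>n. l2 M (\<lambda>x. F n x - f x)) \<longlonglongrightarrow> 0"

lemma l2_tendsto_iff:
  "(\<lambda>n. l2 M (\<lambda>x. F n x - f x)) \<longlonglongrightarrow> 0 \<longleftrightarrow> (\<lambda>n. LINT x|M. (norm (F n x - f x))\<^sup>2) \<longlonglongrightarrow> 0"
proof
  assume "(\<lambda>n. l2 M (\<lambda>x. F n x - f x)) \<longlonglongrightarrow> 0"
  from tendsto_power[OF this, of 2] show "(\<lambda>n. LINT x|M. (norm (F n x - f x))\<^sup>2) \<longlonglongrightarrow> 0"
    by (simp add: l2_sq)
next
  assume "(\<lambda>n. LINT x|M. (norm (F n x - f x))\<^sup>2) \<longlonglongrightarrow> 0"
  from tendsto_real_sqrt[OF this] show "(\<lambda>n. l2 M (\<lambda>x. F n x - f x)) \<longlonglongrightarrow> 0"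
    by (simp add: l2_def)
qed

lemma l2_limD:
  assumes "l2_lim M F f"
  shows "square_integrable M (F n)" "square_integrable M f" "(\<lambda>n. l2 M (\<lambda>x. F n x - f x)) \<longlonglongrightarrow> 0"
  using assms by (auto simp: l2_lim_def)

lemma l2_lim_const: "square_integrable M f \<Longrightarrow> l2_lim M (\<lambda>n. f) f"
  by (auto simp: l2_lim_def l2_def)

lemma l2_lim_add:
  assumes F: "l2_lim M F f" and G: "l2_lim M G g"
  shows "l2_lim M (\<lambda>n x. F n x + G n x) (\<lambda>x. f x + g x)"
  unfolding l2_lim_def
proof (intro conjI allI)
  show "(\<lambda>n. l2 M (\<lambda>x. F n x + G n x - (f x + g x))) \<longlonglongrightarrow> 0"
  proof (rule tendsto_sandwich[OF _ _ tendsto_const])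
    show "(\<lambda>n. l2 M (\<lambda>x. F n x - f x) + l2 M (\<lambda>x. G n x - g x)) \<longlonglongrightarrow> 0"
      using tendsto_add[OF l2_limD(3)[OF F] l2_limD(3)[OF G]] by simp
    show "\<forall>\<^sub>F n in sequentially. l2 M (\<lambda>x. F n x + G n x - (f x + g x))
        \<le> l2 M (\<lambda>x. F n x - f x) + l2 M (\<lambda>x. G n x - g x)"
    proof (intro always_eventually allI)
      fix n
      have "l2 M (\<lambda>x. F n x + G n x - (f x + g x)) = l2 M (\<lambda>x. (F n x - f x) + (G n x - g x))"
        by (intro l2_cong) (simp add: algebra_simps)
      also have "\<dots> \<le> l2 M (\<lambda>x. F n x - f x) + l2 M (\<lambda>x. G n x - g x)"
        by (intro l2_triangle square_integrable_diff l2_limD[OF F] l2_limD[OF G])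
      finally show "l2 M (\<lambda>x. F n x + G n x - (f x + g x)) \<le> l2 M (\<lambda>x. F n x - f x) + l2 M (\<lambda>x. G n x - g x)" .
    qed
  qed auto
qed (intro square_integrable_add l2_limD[OF F] l2_limD[OF G])+

lemma l2_lim_bound:
  assumes F: "l2_lim M F f"
    and sq: "\<And>n. square_integrable M (G n)" "square_integrable M g"
    and le: "\<And>n. l2 M (\<lambda>x. G n x - g x) \<le> C * l2 M (\<lambda>x. F n x - f x)"
  shows "l2_lim M G g"
  unfolding l2_lim_def
proof (intro conjI allI sq)
  have "(\<lambda>n. C * l2 M (\<lambda>x. F n x - f x)) \<longlonglongrightarrow> 0"
    using tendsto_mult_left[OF l2_limD(3)[OF F], of C] by simp
  then show "(\<lambda>n. l2 M (\<lambda>x. G n x - g x)) \<longlonglongrightarrow> 0"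
    by (rule tendsto_sandwich[OF _ _ tendsto_const, rotated 2]) (auto intro!: le always_eventually)
qed

lemma l2_lim_bounded_scaleR:
  fixes b :: "'a \<Rightarrow> real"
  assumes F: "l2_lim M F f" and b: "b \<in> borel_measurable M" "\<And>x. x \<in> space M \<Longrightarrow> \<bar>b x\<bar> \<le> C"
  shows "l2_lim M (\<lambda>n x. b x *\<^sub>R F n x) (\<lambda>x. b x *\<^sub>R f x)"
proof (rule l2_lim_bound[OF F, where C = "\<bar>C\<bar>"])
  fix n
  show "l2 M (\<lambda>x. b x *\<^sub>R F n x - b x *\<^sub>R f x) \<le> \<bar>C\<bar> * l2 M (\<lambda>x. F n x - f x)"
    unfolding scaleR_diff_right[symmetric]
  proof (rule l2_mono(2))
    show "(\<lambda>x. b x *\<^sub>R (F n x - f x)) \<in> borel_measurable M"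
      by (intro borel_measurable_scaleR b square_integrable_meas[OF square_integrable_diff[OF l2_limD(1,2)[OF F]]])
    show "norm (b x *\<^sub>R (F n x - f x)) \<le> \<bar>C\<bar> * norm (F n x - f x)" if "x \<in> space M" for x
      using b(2)[OF that] by (auto intro!: mult_right_mono)
  qed (auto intro!: square_integrable_diff l2_limD[OF F])
next
  show "square_integrable M (\<lambda>x. b x *\<^sub>R F n x)" for n
    by (rule square_integrable_bounded_scaleR[OF l2_limD(1)[OF F] b])
  show "square_integrable M (\<lambda>x. b x *\<^sub>R f x)"
    by (rule square_integrable_bounded_scaleR[OF l2_limD(2)[OF F] b])
qed

lemma l2_lim_scaleR: "l2_lim M F f \<Longrightarrow> l2_lim M (\<lambda>n x. c *\<^sub>R F n x) (\<lambda>x. c *\<^sub>R f x)"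
  by (rule l2_lim_bounded_scaleR[where C = "\<bar>c\<bar>"]) auto

lemma l2_lim_cmult: "l2_lim M F f \<Longrightarrow> l2_lim M (\<lambda>n x. c * F n x) (\<lambda>x. c * f x :: real)"
  using l2_lim_scaleR[of M F f c] by simp

lemma l2_lim_diff:
  "l2_lim M F f \<Longrightarrow> l2_lim M G g \<Longrightarrow> l2_lim M (\<lambda>n x. F n x - G n x) (\<lambda>x. f x - g x)"
  using l2_lim_add[OF _ l2_lim_scaleR[of M G g "-1"]] by simp

lemma l2_lim_inner_right:
  assumes F: "l2_lim M F f" and b: "b \<in> borel_measurable M" "\<And>x. x \<in> space M \<Longrightarrow> norm (b x) \<le> C"
  shows "l2_lim M (\<lambda>n x. F n x \<bullet> b x) (\<lambda>x. f x \<bullet> b x)"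
proof (rule l2_lim_bound[OF F, where C = "\<bar>C\<bar>"])
  fix n
  show "l2 M (\<lambda>x. F n x \<bullet> b x - f x \<bullet> b x) \<le> \<bar>C\<bar> * l2 M (\<lambda>x. F n x - f x)"
    unfolding inner_diff_left[symmetric]
  proof (rule l2_mono(2))
    fix x assume "x \<in> space M"
    then have "norm ((F n x - f x) \<bullet> b x) \<le> norm (F n x - f x) * \<bar>C\<bar>"
      using b(2)[of x] by (intro order.trans[OF Cauchy_Schwarz_ineq2[THEN order.trans[OF eq_refl[OF real_norm_def]]]] mult_left_mono) auto
    then show "norm ((F n x - f x) \<bullet> b x) \<le> \<bar>C\<bar> * norm (F n x - f x)" by (simp add: mult.commute)
  next
    show "(\<lambda>x. (F n x - f x) \<bullet> b x) \<in> borel_measurable M"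
      by (intro borel_measurable_inner b square_integrable_meas[OF square_integrable_diff[OF l2_limD(1,2)[OF F]]])
  qed (auto intro!: square_integrable_diff l2_limD[OF F])
next
  show "square_integrable M (\<lambda>x. F n x \<bullet> b x)" for n
    by (rule square_integrable_inner_right[OF l2_limD(1)[OF F] b])
  show "square_integrable M (\<lambda>x. f x \<bullet> b x)"
    by (rule square_integrable_inner_right[OF l2_limD(2)[OF F] b])
qed

lemma l2_lim_norm:
  assumes F: "l2_lim M F f"
  shows "(\<lambda>n. l2 M (F n)) \<longlonglongrightarrow> l2 M f"
proof (rule LIM_zero_cancel, rule tendsto_rabs_zero_cancel)
  note sq = l2_limD(1,2)[OF F]
  have "\<bar>l2 M (F n) - l2 M f\<bar> \<le> l2 M (\<lambda>x. F n x - f x)" for n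
    using l2_triangle_diff[OF sq square_integrable_zero, of n]
      l2_triangle_diff[OF sq(2,1) square_integrable_zero, of n]
    by (simp add: l2_minus_commute[of M f])
  then show "(\<lambda>n. \<bar>l2 M (F n) - l2 M f\<bar>) \<longlonglongrightarrow> 0"
    by (intro tendsto_sandwich[OF _ _ tendsto_const l2_limD(3)[OF F]]) auto
qed

lemma l2_lim_inner:
  assumes F: "l2_lim M F f" and G: "l2_lim M G g"
  shows "(\<lambda>n. LINT x|M. F n x \<bullet> G n x) \<longlonglongrightarrow> (LINT x|M. f x \<bullet> g x)"
proof (rule LIM_zero_cancel)
  note sf = l2_limD(1,2)[OF F] and sg = l2_limD(1,2)[OF G]
  have "\<bar>(LINT x|M. F n x \<bullet> G n x) - (LINT x|M. f x \<bullet> g x)\<bar>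
      \<le> l2 M (\<lambda>x. F n x - f x) * l2 M (G n) + l2 M f * l2 M (\<lambda>x. G n x - g x)" for n
  proof -
    have "(LINT x|M. F n x \<bullet> G n x) - (LINT x|M. f x \<bullet> g x)
       = (LINT x|M. (F n x - f x) \<bullet> G n x) + (LINT x|M. f x \<bullet> (G n x - g x))"
    proof -
      have i: "integrable M (\<lambda>x. F n x \<bullet> G n x)" "integrable M (\<lambda>x. f x \<bullet> G n x)" "integrable M (\<lambda>x. f x \<bullet> g x)"
        by (intro square_integrable_inner sf sg)+
      show ?thesis
        unfolding inner_diff_left inner_diff_right
          Bochner_Integration.integral_diff[OF i(1,2)] Bochner_Integration.integral_diff[OF i(2,3)] by simp
    qed
    then have "\<bar>(LINT x|M. F n x \<bullet> G n x) - (LINT x|M. f x \<bullet> g x)\<bar> \<le> \<bar>LINT x|M. (F n x - f x) \<bullet> G n x\<bar> + \<bar>LINT x|M. f x \<bullet> (G n x - g x)\<bar>"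
      by (simp only: abs_triangle_ineq)
    also have "\<dots> \<le> l2 M (\<lambda>x. F n x - f x) * l2 M (G n) + l2 M f * l2 M (\<lambda>x. G n x - g x)"
      by (intro add_mono l2_Cauchy_Schwarz square_integrable_diff sf sg)
    finally show ?thesis .
  qed
  then have le: "\<forall>n. norm ((LINT x|M. F n x \<bullet> G n x) - (LINT x|M. f x \<bullet> g x))
      \<le> l2 M (\<lambda>x. F n x - f x) * l2 M (G n) + l2 M f * l2 M (\<lambda>x. G n x - g x)"
    by simp
  have "(\<lambda>n. l2 M (\<lambda>x. F n x - f x) * l2 M (G n) + l2 M f * l2 M (\<lambda>x. G n x - g x)) \<longlonglongrightarrow> 0"
    by (rule tendsto_eq_rhs[OF tendsto_add[OF tendsto_mult[OF l2_limD(3)[OF F] l2_lim_norm[OF G]]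
        tendsto_mult_left[OF l2_limD(3)[OF G], of "l2 M f"]]]) simp
  then show "(\<lambda>n. (LINT x|M. F n x \<bullet> G n x) - (LINT x|M. f x \<bullet> g x)) \<longlonglongrightarrow> 0"
    by (rule Lim_null_comparison[OF always_eventually[OF le]])
qed

lemma l2_lim_mult:
  fixes f g :: "'a \<Rightarrow> real"
  assumes "l2_lim M F f" "l2_lim M G g"
  shows "(\<lambda>n. LINT x|M. F n x * G n x) \<longlonglongrightarrow> (LINT x|M. f x * g x)"
  using l2_lim_inner[OF assms] by simp

section \<open>Completeness of L^2\<close>

definition l2_Cauchy :: "'a measure \<Rightarrow> (nat \<Rightarrow> 'a \<Rightarrow> 'b::euclidean_space) \<Rightarrow> bool" where
  "l2_Cauchy M F \<longleftrightarrow> (\<forall>e>0. \<exists>N. \<forall>m\<ge>N. \<forall>n\<ge>N. l2 M (\<lambda>x. F m x - F n x) < e)"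

lemma l2_lim_Cauchy:
  assumes F: "l2_lim M F f"
  shows "l2_Cauchy M F"
  unfolding l2_Cauchy_def
proof (intro allI impI)
  fix e :: real assume "e > 0"
  then have "\<forall>\<^sub>F n in sequentially. l2 M (\<lambda>x. F n x - f x) < e / 2"
    using l2_limD(3)[OF F] by (intro order_tendstoD) auto
  then obtain N where N: "\<And>n. n \<ge> N \<Longrightarrow> l2 M (\<lambda>x. F n x - f x) < e / 2"
    by (auto simp: eventually_sequentially)
  have "l2 M (\<lambda>x. F m x - F n x) < e" if "m \<ge> N" "n \<ge> N" for m n
    using l2_triangle_diff[OF l2_limD(1)[OF F, of m] l2_limD(2)[OF F] l2_limD(1)[OF F, of n]]
      N[OF that(1)] N[OF that(2)] by (simp add: l2_minus_commute[of M f])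
  then show "\<exists>N. \<forall>m\<ge>N. \<forall>n\<ge>N. l2 M (\<lambda>x. F m x - F n x) < e" by blast
qed

lemma l2_Cauchy_bound:
  assumes "l2_Cauchy M F"
    and "\<And>m n. l2 K (\<lambda>x. G m x - G n x) \<le> C * l2 M (\<lambda>x. F m x - F n x)"
  shows "l2_Cauchy K G"
  unfolding l2_Cauchy_def
proof (intro allI impI)
  fix e :: real assume "e > 0"
  then have "e / (\<bar>C\<bar> + 1) > 0" by (simp add: add_nonneg_pos)
  then obtain N where N: "\<And>m n. m \<ge> N \<Longrightarrow> n \<ge> N \<Longrightarrow> l2 M (\<lambda>x. F m x - F n x) < e / (\<bar>C\<bar> + 1)"
    using assms(1) unfolding l2_Cauchy_def by blast
  have "l2 K (\<lambda>x. G m x - G n x) < e" if "m \<ge> N" "n \<ge> N" for m n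
  proof -
    have "l2 K (\<lambda>x. G m x - G n x) \<le> (\<bar>C\<bar> + 1) * l2 M (\<lambda>x. F m x - F n x)"
      by (rule order.trans[OF assms(2)]) (intro mult_right_mono, auto)
    also have "\<dots> < (\<bar>C\<bar> + 1) * (e / (\<bar>C\<bar> + 1))"
      using N[OF that] by (intro mult_strict_left_mono) auto
    also have "\<dots> = e" by (simp add: add_nonneg_eq_0_iff)
    finally show ?thesis .
  qed
  then show "\<exists>N. \<forall>m\<ge>N. \<forall>n\<ge>N. l2 K (\<lambda>x. G m x - G n x) < e" by blast
qed

text \<open>The weights \<open>4 ^ k\<close> leave the integrals of the squares summable, so the
  weighted sum of squares is finite almost everywhere. A finite value \<open>C\<close> bounds
  \<open>norm (d k x)\<close> by \<open>sqrt C * (1/2)^k\<close>. The argument is valid for infinite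
  measures too.\<close>

lemma AE_summable_norm_of_l2:
  assumes sq: "\<And>k. square_integrable M (d k)" and le: "\<And>k. l2 M (d k) \<le> (1/4) ^ k"
  shows "AE x in M. summable (\<lambda>k. norm (d k x))"
proof -
  have m[measurable]: "d k \<in> borel_measurable M" for k using sq by (auto simp: square_integrable_def)
  define u where "u k x = ennreal (4 ^ k * (norm (d k x))\<^sup>2)" for k x
  have um[measurable]: "u k \<in> borel_measurable M" for k unfolding u_def by measurable
  have "(\<integral>\<^sup>+x. (\<Sum>k. u k x) \<partial>M) = (\<Sum>k. \<integral>\<^sup>+x. u k x \<partial>M)"
    by (rule nn_integral_suminf) simp
  also have "\<dots> \<le> (\<Sum>k. ennreal ((1/4)^k))"
  proof (intro suminf_le)
    fix k
    have "(\<integral>\<^sup>+x. u k x \<partial>M) = ennreal (4 ^ k * (LINT x|M. (norm (d k x))\<^sup>2))"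
      unfolding u_def using square_integrable_norm_sq[OF sq]
      by (subst nn_integral_eq_integral) auto
    also have "4 ^ k * (LINT x|M. (norm (d k x))\<^sup>2) = 4 ^ k * (l2 M (d k))\<^sup>2"
      by (simp add: l2_sq)
    also have "ennreal \<dots> \<le> ennreal (4 ^ k * ((1/4) ^ k)\<^sup>2)"
      by (intro ennreal_leI mult_left_mono power_mono le) auto
    also have "4 ^ k * ((1/4) ^ k)\<^sup>2 = ((1/4)::real)^k"
      by (simp add: power2_eq_square power_divide)
    finally show "(\<integral>\<^sup>+x. u k x \<partial>M) \<le> ennreal ((1/4)^k)" .
  qed auto
  also have "\<dots> = ennreal (\<Sum>k. (1/4)^k)"
    by (intro suminf_ennreal2) (auto intro!: summable_geometric)
  finally have fin: "(\<integral>\<^sup>+x. (\<Sum>k. u k x) \<partial>M) \<noteq> \<infinity>" by (auto simp: top_unique)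
  have "AE x in M. (\<Sum>k. u k x) \<noteq> \<infinity>"
    by (intro nn_integral_noteq_infinite fin) simp
  then show ?thesis
  proof (rule AE_mp, intro AE_I2 impI)
    fix x assume "(\<Sum>k. u k x) \<noteq> \<infinity>"
    then obtain C where C: "(\<Sum>k. u k x) = ennreal C" "C \<ge> 0" by (cases "\<Sum>k. u k x") auto
    have le: "norm (d k x) \<le> sqrt C * (1/2)^k" for k
    proof -
      have "u k x \<le> (\<Sum>k. u k x)"
        using sum_le_suminf[of "\<lambda>k. u k x" "{k}"] by auto
      then have "4 ^ k * (norm (d k x))\<^sup>2 \<le> C"
        unfolding C(1) unfolding u_def using C(2) by (simp add: ennreal_le_iff)
      then have "(2 ^ k * norm (d k x))\<^sup>2 \<le> C"
        by (simp add: power_mult_distrib power_mult[symmetric] mult.commute[of _ 2]) (simp add: power_mult)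
      from real_le_rsqrt[OF this] show ?thesis by (simp add: field_simps power_divide)
    qed
    show "summable (\<lambda>k. norm (d k x))"
      by (rule summable_comparison_test'[where g = "\<lambda>k. sqrt C * (1/2)^k"])
         (auto intro!: summable_mult summable_geometric le)
  qed
qed

theorem Riesz_Fischer:
  fixes F :: "nat \<Rightarrow> 'a \<Rightarrow> 'b::euclidean_space"
  assumes sq: "\<And>n. square_integrable M (F n)" and C: "l2_Cauchy M F"
  obtains f where "l2_lim M F f"
proof -
  have m[measurable]: "F k \<in> borel_measurable M" for k using sq by (auto simp: square_integrable_def)
  have "\<exists>N. \<forall>m\<ge>N. \<forall>n\<ge>N. l2 M (\<lambda>x. F m x - F n x) < (1/4)^k" for k :: nat
    using C[unfolded l2_Cauchy_def, rule_format, of "(1/4)^k"] by simp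
  then have "\<exists>N. \<forall>k. \<forall>m\<ge>N k. \<forall>n\<ge>N k. l2 M (\<lambda>x. F m x - F n x) < (1/4)^k"
    by (intro choice allI)
  then obtain N where N: "\<And>k m n. m \<ge> N k \<Longrightarrow> n \<ge> N k \<Longrightarrow> l2 M (\<lambda>x. F m x - F n x) < (1/4)^k"
    by metis
  \<comment> \<open>The sum puts \<open>r j\<close> above \<open>N k\<close> for every
    \<open>k \<le> j\<close> at once, without assuming \<open>N\<close> monotone.\<close>
  define r where "r k = (\<Sum>i\<le>k. N i) + k" for k
  have rN: "r j \<ge> N k" if "j \<ge> k" for j k
    unfolding r_def using member_le_sum[of k "{..j}" N] that by auto
  \<comment> \<open>Where the subsequence diverges, \<open>lim\<close> is some fixed default; this
    concerns only a null set.\<close>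
  define f where "f x = lim (\<lambda>k. F (r k) x)" for x
  have fm[measurable]: "f \<in> borel_measurable M" unfolding f_def by measurable
  have "AE x in M. summable (\<lambda>k. norm (F (r (Suc k)) x - F (r k) x))"
    using N[OF rN rN] by (intro AE_summable_norm_of_l2 square_integrable_diff sq less_imp_le) auto
  then have conv: "AE x in M. (\<lambda>k. F (r k) x) \<longlonglongrightarrow> f x"
  proof (rule AE_mp, intro AE_I2 impI)
    fix x assume "summable (\<lambda>k. norm (F (r (Suc k)) x - F (r k) x))"
    from summable_LIMSEQ[OF summable_norm_cancel[OF this]]
    have "(\<lambda>n. F (r n) x - F (r 0) x) \<longlonglongrightarrow> (\<Sum>k. F (r (Suc k)) x - F (r k) x)"
      by (simp only: sum_lessThan_telescope[of "\<lambda>k. F (r k) x"])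
    from tendsto_add[OF this tendsto_const[of "F (r 0) x"]]
    show "(\<lambda>k. F (r k) x) \<longlonglongrightarrow> f x"
      unfolding f_def by (simp add: limI)
  qed
  \<comment> \<open>Fatou's lemma carries the Cauchy estimate between \<open>F n\<close> and the
    subsequence over to the pointwise limit, where no dominating function is at hand. It also yields
    that the limit is square integrable.\<close>
  have fatou: "(\<integral>\<^sup>+x. ennreal ((norm (F n x - f x))\<^sup>2) \<partial>M) \<le> ennreal (((1/4)^k)\<^sup>2)" if "n \<ge> N k" for n k
  proof -
    have "(\<integral>\<^sup>+x. ennreal ((norm (F n x - f x))\<^sup>2) \<partial>M)
       = (\<integral>\<^sup>+x. liminf (\<lambda>j. ennreal ((norm (F n x - F (r j) x))\<^sup>2)) \<partial>M)"
      using conv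
    proof (intro nn_integral_cong_AE, elim AE_mp, intro AE_I2 impI)
      fix x assume "(\<lambda>k. F (r k) x) \<longlonglongrightarrow> f x"
      then have "(\<lambda>j. ennreal ((norm (F n x - F (r j) x))\<^sup>2)) \<longlonglongrightarrow> ennreal ((norm (F n x - f x))\<^sup>2)"
        by (intro tendsto_ennrealI tendsto_intros)
      from lim_imp_Liminf[OF _ this]
      show "ennreal ((norm (F n x - f x))\<^sup>2) = liminf (\<lambda>j. ennreal ((norm (F n x - F (r j) x))\<^sup>2))" by simp
    qed
    also have "\<dots> \<le> liminf (\<lambda>j. \<integral>\<^sup>+x. ennreal ((norm (F n x - F (r j) x))\<^sup>2) \<partial>M)"
      by (intro nn_integral_liminf) measurable
    also have "\<dots> \<le> limsup (\<lambda>j. \<integral>\<^sup>+x. ennreal ((norm (F n x - F (r j) x))\<^sup>2) \<partial>M)"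
      by (intro Liminf_le_Limsup) simp
    also have "\<dots> \<le> ennreal (((1/4)^k)\<^sup>2)"
    proof (intro Limsup_bounded)
      show "\<forall>\<^sub>F j in sequentially. (\<integral>\<^sup>+x. ennreal ((norm (F n x - F (r j) x))\<^sup>2) \<partial>M) \<le> ennreal (((1/4)^k)\<^sup>2)"
        using eventually_ge_at_top[of k]
      proof eventually_elim
        case (elim j)
        have "(\<integral>\<^sup>+x. ennreal ((norm (F n x - F (r j) x))\<^sup>2) \<partial>M) = ennreal ((l2 M (\<lambda>x. F n x - F (r j) x))\<^sup>2)"
          unfolding l2_sq
          by (intro nn_integral_eq_integral square_integrable_norm_sq square_integrable_diff sq) auto
        also have "\<dots> \<le> ennreal (((1/4)^k)\<^sup>2)"
          using N[OF that rN[OF elim]] by (intro ennreal_leI power_mono) auto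
        finally show ?case .
      qed
    qed
    finally show ?thesis .
  qed
  have sqd: "square_integrable M (\<lambda>x. F (N k) x - f x)" for k
  proof -
    have "(\<integral>\<^sup>+x. ennreal (norm ((norm (F (N k) x - f x))\<^sup>2)) \<partial>M) < \<infinity>"
      using le_less_trans[OF fatou[of k "N k"] ennreal_less_top] by simp
    then show ?thesis
      unfolding square_integrable_def by (intro conjI integrableI_bounded) auto
  qed
  have sqf: "square_integrable M f"
    using square_integrable_diff[OF sq[of "N 0"] sqd[of 0]] by simp
  have "(\<lambda>n. l2 M (\<lambda>x. F n x - f x)) \<longlonglongrightarrow> 0"
  proof (rule LIMSEQ_I)
    fix e :: real assume "e > 0"
    then obtain k where k: "(1/4)^k < e" using real_arch_pow_inv[of e "1/4"] by (auto simp del: power_divide)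
    have "norm (l2 M (\<lambda>x. F n x - f x) - 0) < e" if n: "n \<ge> N k" for n
    proof -
      have "ennreal ((l2 M (\<lambda>x. F n x - f x))\<^sup>2) = (\<integral>\<^sup>+x. ennreal ((norm (F n x - f x))\<^sup>2) \<partial>M)"
        unfolding l2_sq
        by (rule nn_integral_eq_integral[symmetric])
          (auto intro!: square_integrable_norm_sq square_integrable_diff sq sqf)
      also note fatou[OF n]
      finally have "(l2 M (\<lambda>x. F n x - f x))\<^sup>2 \<le> ((1/4)^k)\<^sup>2"
        by (subst (asm) ennreal_le_iff) simp_all
      then have "l2 M (\<lambda>x. F n x - f x) \<le> (1/4)^k"
        by (rule power2_le_imp_le) simp
      with k show ?thesis by simp
    qed
    then show "\<exists>no. \<forall>n\<ge>no. norm (l2 M (\<lambda>x. F n x - f x) - 0) < e" by blast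
  qed
  then show thesis using that sq sqf by (auto simp: l2_lim_def)
qed

section \<open>Integration over the ball and the sphere\<close>

abbreviation ball_measure :: "'a::euclidean_space measure" where
  "ball_measure \<equiv> lebesgue_on (ball 0 1)"

lemma finite_ball_measure: "finite_measure (ball_measure :: 'a::euclidean_space measure)"
  by (intro finite_measure_lebesgue_on) simp

lemma borel_imp_lebesgue_on:
  "f \<in> borel_measurable borel \<Longrightarrow> f \<in> borel_measurable (lebesgue_on S)"
  by (intro measurable_restrict_space1 measurable_completion) simp

lemma continuous_bounded_on_cball:
  fixes f :: "'a::euclidean_space \<Rightarrow> 'b::real_normed_vector"
  assumes "continuous_on (cball 0 r) f"
  obtains C where "0 \<le> C" "\<And>x. norm x \<le> r \<Longrightarrow> norm (f x) \<le> C"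
proof -
  have "bounded (f ` cball 0 r)"
    by (intro compact_imp_bounded compact_continuous_image assms compact_cball)
  then obtain C where "\<And>x. x \<in> cball 0 r \<Longrightarrow> norm (f x) \<le> C" unfolding bounded_iff by blast
  then show thesis by (intro that[of "max C 0"]) (auto simp: le_max_iff_disj)
qed

lemma integrable_continuous_ball:
  fixes f :: "'a::euclidean_space \<Rightarrow> 'b::euclidean_space"
  assumes "continuous_on UNIV f"
  shows "integrable ball_measure f"
proof -
  interpret finite_measure "ball_measure :: 'a measure" by (rule finite_ball_measure)
  obtain C where "\<And>x. norm x \<le> 1 \<Longrightarrow> norm (f x) \<le> C"
    using continuous_bounded_on_cball[of 1 f] continuous_on_subset[OF assms] by blast
  then show ?thesis
    by (intro integrable_const_bound[where B = C] borel_imp_lebesgue_on borel_measurable_continuous_onI assms)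
       (auto intro!: AE_I2 simp: space_restrict_space)
qed

lemma square_integrable_continuous_ball:
  fixes f :: "'a::euclidean_space \<Rightarrow> 'b::euclidean_space"
  assumes "continuous_on UNIV f"
  shows "square_integrable ball_measure f"
  unfolding square_integrable_def
  by (intro conjI integrable_continuous_ball borel_imp_lebesgue_on borel_measurable_continuous_onI assms
      continuous_intros)

text \<open>Dilations, translations and Fubini are carried out over \<open>lborel\<close>; this
  translates integrals over subdomains into that setting.\<close>

lemma integral_ball_lborel:
  fixes f :: "'a::euclidean_space \<Rightarrow> real"
  assumes f: "f \<in> borel_measurable borel" and S: "S \<in> sets borel"
  shows "(LINT x|lebesgue_on S. f x) = (LINT x|lborel. indicator S x * f x)"
proof -
  have "(LINT x|lebesgue_on S. f x) = (LINT x|lebesgue. indicator S x *\<^sub>R f x)"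
    using S by (intro integral_restrict_space) auto
  also have "\<dots> = (LINT x|lborel. indicator S x *\<^sub>R f x)"
    using assms by (intro integral_completion) simp
  finally show ?thesis by simp
qed

lemma integrable_indicator_ball:
  fixes f :: "'a::euclidean_space \<Rightarrow> real"
  assumes "continuous_on UNIV f"
  shows "integrable lborel (\<lambda>x. indicator (ball 0 1) x * f x)"
proof -
  have "integrable lborel (\<lambda>x. indicator (cball 0 1) x *\<^sub>R f x)"
    by (intro borel_integrable_compact compact_cball continuous_on_subset[OF assms]) auto
  from integrable_mult_indicator[OF _ this, of "ball 0 1"]
  show ?thesis
    by (rule Bochner_Integration.integrable_cong[OF refl, THEN iffD1, rotated])
       (auto simp: indicator_def)
qed

lemma integral_lborel_scale:
  fixes F :: "'a::euclidean_space \<Rightarrow> real"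
  assumes F[measurable]: "F \<in> borel_measurable borel" and c: "c \<noteq> 0"
  shows "(LINT x|lborel. F x) = \<bar>c\<bar> ^ DIM('a) * (LINT x|lborel. F (c *\<^sub>R x))"
proof -
  have "(LINT x|lborel. F x)
      = (LINT x|density (distr lborel borel (\<lambda>x. 0 + c *\<^sub>R x)) (\<lambda>_. ennreal (\<bar>c\<bar>^DIM('a))). F x)"
    by (subst lborel_affine[OF c, of 0]) (simp add: ennreal_power)
  also have "\<dots> = \<bar>c\<bar> ^ DIM('a) * (LINT x|lborel. F (c *\<^sub>R x))"
    by (simp add: integral_density integral_distr)
  finally show ?thesis .
qed

lemma integrable_lborel_scale:
  fixes F :: "'a::euclidean_space \<Rightarrow> real"
  assumes "integrable lborel F" and c: "c \<noteq> 0"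
  shows "integrable lborel (\<lambda>x. F (c *\<^sub>R x))"
proof -
  have [measurable]: "F \<in> borel_measurable borel" using borel_measurable_integrable[OF assms(1)] by simp
  have "integrable (density (distr lborel borel (\<lambda>x. 0 + c *\<^sub>R x)) (\<lambda>_. ennreal (\<bar>c\<bar>^DIM('a)))) F"
    using assms(1) by (subst (asm) lborel_affine[OF c, of 0]) (simp add: ennreal_power)
  then show ?thesis using c
    by (simp add: integrable_density integrable_distr_eq)
qed

section \<open>Surface measure on the unit sphere\<close>

lemma scale_measure_eq_density:
  "scale_measure c M = density M (\<lambda>_. c)"
  by (intro measure_eqI) (auto simp: emeasure_density_const)

lemma space_sphere_measure [simp]: "space sphere_measure = sphere 0 1"
  by (simp add: sphere_measure_def space_scale_measure space_restrict_space)

lemma sets_sphere_measure [measurable_cong]: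
  "sets sphere_measure = sets (restrict_space borel (sphere 0 1))"
  by (simp add: sphere_measure_def)

lemma borel_measurable_sgn_vector [measurable]:
  "(sgn :: 'a::euclidean_space \<Rightarrow> 'a) \<in> borel_measurable borel"
  unfolding sgn_div_norm[abs_def] by measurable

lemma measurable_sgn_sphere:
  "(sgn :: 'a::euclidean_space \<Rightarrow> 'a) \<in> lebesgue_on (ball 0 1 - {0}) \<rightarrow>\<^sub>M restrict_space borel (sphere 0 1)"
  by (intro measurable_restrict_space2 borel_imp_lebesgue_on borel_measurable_sgn_vector)
     (auto simp: space_restrict_space norm_sgn)

lemma borel_measurable_sphereI:
  "f \<in> borel_measurable borel \<Longrightarrow> f \<in> borel_measurable sphere_measure"
  unfolding measurable_cong_sets[OF sets_sphere_measure refl] by (rule measurable_restrict_space1)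

lemma finite_sphere_measure: "finite_measure (sphere_measure :: 'a::euclidean_space measure)"
proof
  have "emeasure (distr (lebesgue_on (ball 0 1 - {0})) (restrict_space borel (sphere 0 1)) sgn) (sphere 0 1 :: 'a set)
      = emeasure (lebesgue_on (ball 0 1 - {0})) (sgn -` sphere 0 1 \<inter> space (lebesgue_on (ball 0 1 - {0})) :: 'a set)"
    by (intro emeasure_distr measurable_sgn_sphere) (auto simp: sets_restrict_space)
  also have "\<dots> < \<infinity>"
  proof -
    have "ball 0 1 - {0::'a} \<in> lmeasurable" by (rule fmeasurable.Diff) (auto intro: negligible_imp_measurable)
    then interpret finite_measure "lebesgue_on (ball 0 1 - {0::'a})" by (rule finite_measure_lebesgue_on)
    show ?thesis by (simp add: less_top[symmetric] emeasure_finite)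
  qed
  finally show "emeasure (sphere_measure :: 'a measure) (space sphere_measure) \<noteq> \<infinity>"
    by (simp add: sphere_measure_def space_scale_measure space_restrict_space ennreal_mult_eq_top_iff)
qed

text \<open>A surface integral becomes the volume integral of the function extended constantly along
  rays. The divergence theorem below uses the surface measure only through this formula.\<close>

lemma integral_sphere_measure:
  fixes f :: "'a::euclidean_space \<Rightarrow> real"
  assumes [measurable]: "f \<in> borel_measurable borel"
  shows "(LINT x|sphere_measure. f x) = DIM('a) * (LINT x|lborel. indicator (ball 0 1 - {0}) x * f (sgn x))"
proof -
  have "(LINT x|sphere_measure. f x)
     = (LINT x|density (distr (lebesgue_on (ball 0 1 - {0})) (restrict_space borel (sphere 0 1)) sgn)
         (\<lambda>_. ennreal (real DIM('a))). f x)"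
    by (simp add: sphere_measure_def scale_measure_eq_density ennreal_of_nat_eq_real_of_nat)
  also have "\<dots> = real DIM('a) * (LINT x|lebesgue_on (ball 0 1 - {0}). f (sgn x))"
    by (subst integral_density)
       (auto intro!: measurable_restrict_space1 integral_distr measurable_sgn_sphere)
  also have "(LINT x|lebesgue_on (ball 0 1 - {0}). f (sgn x))
      = (LINT x|lborel. indicator (ball 0 1 - {0}) x * f (sgn x))"
    by (intro integral_ball_lborel) auto
  finally show ?thesis .
qed

lemma square_integrable_continuous_sphere:
  fixes f :: "'a::euclidean_space \<Rightarrow> 'b::euclidean_space"
  assumes "continuous_on UNIV f"
  shows "square_integrable sphere_measure f"
proof -
  interpret finite_measure "sphere_measure :: 'a measure" by (rule finite_sphere_measure)
  have c: "continuous_on UNIV (\<lambda>x. (norm (f x))\<^sup>2)" by (intro continuous_intros assms)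
  obtain C where C: "\<And>x. norm x \<le> 1 \<Longrightarrow> norm ((norm (f x))\<^sup>2) \<le> C"
    using continuous_bounded_on_cball[of 1 "\<lambda>x. (norm (f x))\<^sup>2"] continuous_on_subset[OF c] by blast
  have "integrable sphere_measure (\<lambda>x. (norm (f x))\<^sup>2)"
    by (rule integrable_const_bound[where B = C])
       (use C in \<open>auto intro!: AE_I2 borel_measurable_sphereI borel_measurable_continuous_onI c\<close>)
  then show ?thesis
    unfolding square_integrable_def
    by (intro conjI borel_measurable_sphereI borel_measurable_continuous_onI assms)
qed

section \<open>The divergence theorem for radial fields\<close>

text \<open>As \<open>t\<close> decreases from 1 to \<open>norm x\<close>, the point
  \<open>x /\<^sub>R t\<close> runs along the ray from \<open>x\<close> to the sphere, and the
  integrand is the \<open>t\<close> derivative of \<open>- \<psi> (x /\<^sub>R t)\<close>. With the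
  dilation factor as parameter, Fubini meets nothing but dilations of the ball.\<close>

lemma radial_integral:
  fixes \<psi> :: "'a::euclidean_space \<Rightarrow> real"
  assumes s: "smooth_on UNIV \<psi>" and x: "0 < norm x" "norm x < 1"
  shows "(LINT t|lborel. indicator {norm x<..1} t * ((grad \<psi> (x /\<^sub>R t) \<bullet> (x /\<^sub>R t)) / t)) = \<psi> (sgn x) - \<psi> x"
proof -
  have d: "((\<lambda>t. - \<psi> (x /\<^sub>R t)) has_vector_derivative (grad \<psi> (x /\<^sub>R t) \<bullet> (x /\<^sub>R t)) / t) (at t within {norm x..1})"
    if t: "norm x \<le> t" for t
  proof -
    have t0: "t > 0" using x t by linarith
    have "((\<lambda>t. x /\<^sub>R t) has_derivative (\<lambda>h. (- (h / t\<^sup>2)) *\<^sub>R x)) (at t within {norm x..1})"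
      using t0 by (auto intro!: derivative_eq_intros simp: power2_eq_square divide_inverse mult_ac)
    from has_derivative_compose[OF this smooth_on_has_derivative[OF s]]
    have "((\<lambda>t. \<psi> (x /\<^sub>R t)) has_derivative (\<lambda>h. grad \<psi> (x /\<^sub>R t) \<bullet> ((- (h / t\<^sup>2)) *\<^sub>R x))) (at t within {norm x..1})" .
    from has_derivative_minus[OF this] show ?thesis
      unfolding has_vector_derivative_def
      by (rule has_derivative_eq_rhs) (auto simp: power2_eq_square field_simps)
  qed
  have c: "continuous_on {norm x..1} (\<lambda>t. (grad \<psi> (x /\<^sub>R t) \<bullet> (x /\<^sub>R t)) / t)"
    using x by (intro continuous_intros continuous_on_compose2[OF continuous_on_grad[OF s]]) auto
  have "(LINT t|lborel. indicator {norm x..1} t *\<^sub>R ((grad \<psi> (x /\<^sub>R t) \<bullet> (x /\<^sub>R t)) / t))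
      = - \<psi> (x /\<^sub>R 1) - - \<psi> (x /\<^sub>R norm x)"
    using x by (intro integral_FTC_atLeastAtMost[OF _ _ c] d) auto
  also have "\<dots> = \<psi> (sgn x) - \<psi> x" by (simp add: sgn_div_norm)
  finally have 1: "(LINT t|lborel. indicator {norm x..1} t *\<^sub>R ((grad \<psi> (x /\<^sub>R t) \<bullet> (x /\<^sub>R t)) / t)) = \<psi> (sgn x) - \<psi> x" .
  have gm[measurable]: "grad \<psi> \<in> borel_measurable borel"
    by (intro borel_measurable_continuous_onI continuous_on_grad s)
  have "(LINT t|lborel. indicator {norm x<..1} t * ((grad \<psi> (x /\<^sub>R t) \<bullet> (x /\<^sub>R t)) / t))
      = (LINT t|lborel. indicator {norm x..1} t *\<^sub>R ((grad \<psi> (x /\<^sub>R t) \<bullet> (x /\<^sub>R t)) / t))"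
  proof (rule integral_cong_AE)
    show "AE t in lborel. indicator {norm x<..1} t * ((grad \<psi> (x /\<^sub>R t) \<bullet> (x /\<^sub>R t)) / t)
       = indicator {norm x..1} t *\<^sub>R ((grad \<psi> (x /\<^sub>R t) \<bullet> (x /\<^sub>R t)) / t)"
      using AE_lborel_singleton[of "norm x"] by eventually_elim (auto simp: indicator_def)
  qed measurable
  with 1 show ?thesis by simp
qed

text \<open>The divergence theorem for the field \<psi>(x) x, from one double integral over
  \<open>t\<close> and \<open>x\<close>. Integrating over \<open>x\<close> first, each dilation
  contributes \<open>t ^ (N - 1)\<close>, which gives the integral of
  \<open>grad \<psi> x \<bullet> x\<close> divided by \<open>N\<close>. Integrating over
  \<open>t\<close> first gives \<open>\<psi> (sgn x) - \<psi> x\<close>, whose first term is the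
  surface integral.\<close>

theorem radial_divergence:
  fixes \<psi> :: "'a::euclidean_space \<Rightarrow> real"
  assumes s: "smooth_on UNIV \<psi>"
  shows "(LINT x|ball_measure. DIM('a) * \<psi> x + grad \<psi> x \<bullet> x) = (LINT x|sphere_measure. \<psi> x)"
proof -
  define N where "N = DIM('a)"
  have N: "N > 0" by (simp add: N_def)
  define D where "D x = grad \<psi> x \<bullet> x" for x
  have cont: "continuous_on UNIV \<psi>" "continuous_on UNIV (grad \<psi>)"
    using s by (auto intro: smooth_on_continuous continuous_on_grad)
  have cD: "continuous_on UNIV D" unfolding D_def by (intro continuous_intros cont)
  have meas[measurable]: "\<psi> \<in> borel_measurable borel" "D \<in> borel_measurable borel"
    by (intro borel_measurable_continuous_onI cont cD)+
  define \<Phi> where "\<Phi> x = indicator (ball 0 1) x * D x" for x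
  have [measurable]: "\<Phi> \<in> borel_measurable borel"
    unfolding \<Phi>_def by (intro borel_measurable_times borel_measurable_indicator meas) auto
  have \<Phi>i: "integrable lborel \<Phi>" unfolding \<Phi>_def by (rule integrable_indicator_ball[OF cD])
  \<comment> \<open>The indicator inside \<open>\<Phi>\<close> confines \<open>x /\<^sub>R t\<close>
    to the ball, which amounts to \<open>norm x < t\<close>.\<close>
  define f where "f t x = indicator {0<..1} t * (\<Phi> (x /\<^sub>R t) / t)" for t :: real and x :: 'a
  have scal: "(LINT x|lborel. g (x /\<^sub>R t)) = t ^ N * (LINT x|lborel. g x)" if "t > 0" "g \<in> borel_measurable borel"
    for t and g :: "'a \<Rightarrow> real"
    using integral_lborel_scale[OF that(2), of "inverse t"] that
    by (simp add: N_def field_simps power_inverse)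
  have tN: "t ^ N / t = t ^ (N - 1)" if "t > 0" for t :: real
    using N that by (cases N) auto
  have fi: "integrable (lborel \<Otimes>\<^sub>M lborel) (case_prod f)"
  proof (rule lborel_pair.Fubini_integrable)
    show "case_prod f \<in> borel_measurable (lborel \<Otimes>\<^sub>M lborel)"
      unfolding f_def by measurable
    \<comment> \<open>The endpoint 0 is subtracted because \<open>t ^ (N - 1)\<close> is 1 there in
      dimension 1, while the left side is 0.\<close>
    have "(LINT x|lborel. norm (case_prod f (t, x))) = indicator {0..1} t *\<^sub>R (t ^ (N - 1) * (LINT x|lborel. \<bar>\<Phi> x\<bar>)) - indicator {0} t *\<^sub>R (t ^ (N - 1) * (LINT x|lborel. \<bar>\<Phi> x\<bar>))" for t
    proof (cases "t \<in> {0<..1}")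
      case True
      then have "(LINT x|lborel. norm (case_prod f (t, x))) = (LINT x|lborel. \<bar>\<Phi> (x /\<^sub>R t)\<bar>) / t"
        by (simp add: f_def)
      also have "\<dots> = t ^ N / t * (LINT x|lborel. \<bar>\<Phi> x\<bar>)"
        using True by (subst scal[of t "\<lambda>x. \<bar>\<Phi> x\<bar>"]) auto
      also have "t ^ N / t = t ^ (N - 1)" using True by (intro tN) simp
      finally show ?thesis using True by (simp add: indicator_def)
    qed (auto simp: f_def indicator_def)
    moreover have "integrable lborel (\<lambda>t. indicator {0..1} t *\<^sub>R (t ^ (N - 1) * (LINT x|lborel. \<bar>\<Phi> x\<bar>)) - indicator {0} t *\<^sub>R (t ^ (N - 1) * (LINT x|lborel. \<bar>\<Phi> x\<bar>)))"
      by (intro Bochner_Integration.integrable_diff borel_integrable_compact continuous_intros) auto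
    ultimately show "integrable lborel (\<lambda>t. LINT x|lborel. norm (case_prod f (t, x)))" by simp
    have "integrable lborel (\<lambda>x. case_prod f (t, x))" for t
    proof (cases "t \<in> {0<..1}")
      case True
      then show ?thesis
        using integrable_lborel_scale[OF \<Phi>i, of "inverse t"] by (simp add: f_def)
    qed (auto simp: f_def)
    then show "AE t in lborel. integrable lborel (\<lambda>x. case_prod f (t, x))" by simp
  qed
  have L: "(LINT t|lborel. (LINT x|lborel. f t x)) = (LINT x|lborel. \<Phi> x) / N"
  proof -
    have "(LINT x|lborel. f t x) = indicator {0<..1} t * (t ^ (N - 1) * (LINT x|lborel. \<Phi> x))" for t
    proof (cases "t \<in> {0<..1}")
      case True
      then have "(LINT x|lborel. f t x) = (LINT x|lborel. \<Phi> (x /\<^sub>R t)) / t"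
        by (simp add: f_def)
      also have "\<dots> = t ^ N / t * (LINT x|lborel. \<Phi> x)"
        using True by (subst scal[of t "\<Phi>"]) auto
      also have "t ^ N / t = t ^ (N - 1)" using True by (intro tN) simp
      finally show ?thesis using True by (simp add: indicator_def)
    qed (auto simp: f_def)
    then have "(LINT t|lborel. (LINT x|lborel. f t x)) = (LINT t|lborel. indicator {0<..1} t * (t ^ (N - 1) * (LINT x|lborel. \<Phi> x)))"
      by simp
    also have "\<dots> = (LINT t|lborel. indicator {0..1} t *\<^sub>R (t ^ (N - 1) * (LINT x|lborel. \<Phi> x)))"
    proof (rule integral_cong_AE)
      show "AE t in lborel. indicator {0<..1} t * (t ^ (N - 1) * (LINT x|lborel. \<Phi> x)) = indicator {0..1} t *\<^sub>R (t ^ (N - 1) * (LINT x|lborel. \<Phi> x))"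
        using AE_lborel_singleton[of 0] by eventually_elim (auto simp: indicator_def)
    qed measurable
    also have "\<dots> = 1 ^ N / N * (LINT x|lborel. \<Phi> x) - 0 ^ N / N * (LINT x|lborel. \<Phi> x)"
      using N
      by (intro integral_FTC_atLeastAtMost[where F = "\<lambda>t. t ^ N / N * (LINT x|lborel. \<Phi> x)"])
         (auto intro!: continuous_intros derivative_eq_intros simp: has_real_derivative_iff_has_vector_derivative[symmetric])
    finally show ?thesis using N by simp
  qed
  have i1: "integrable lborel (\<lambda>x. indicator (ball 0 1) x * \<psi> x)"
    by (rule integrable_indicator_ball[OF cont(1)])
  have R: "(LINT x|lborel. (LINT t|lborel. f t x)) =
      (LINT x|lborel. indicator (ball 0 1 - {0}) x * \<psi> (sgn x)) - (LINT x|lborel. indicator (ball 0 1) x * \<psi> x)"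
  proof -
    have inner: "(LINT t|lborel. f t x) = indicator (ball 0 1 - {0}) x * (\<psi> (sgn x) - \<psi> x)" for x
    proof (cases "x \<in> ball 0 1 - {0}")
      case True
      have "f t x = indicator {norm x<..1} t * ((grad \<psi> (x /\<^sub>R t) \<bullet> (x /\<^sub>R t)) / t)" for t
      proof -
        have "x /\<^sub>R t \<in> ball 0 1 \<longleftrightarrow> norm x < t" if "t > 0"
          using that by (simp add: field_simps)
        moreover have "t > 0" if "norm x < t" using that norm_ge_zero[of x] by linarith
        ultimately have "indicator {norm x<..1} t = indicator {0<..1} t * (indicator (ball 0 1) (x /\<^sub>R t) :: real)"
          unfolding indicator_def by (cases "t > 0") auto
        then show ?thesis by (simp add: f_def \<Phi>_def D_def mult.assoc)
      qed
      then show ?thesis using radial_integral[OF s, of x] True by simp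
    next
      case False
      have "f t x = 0" for t
      proof (cases "x = 0")
        case True then show ?thesis by (simp add: f_def \<Phi>_def D_def)
      next
        case False
        with \<open>x \<notin> ball 0 1 - {0}\<close> have "norm x \<ge> 1" by auto
        then show ?thesis by (auto simp: f_def \<Phi>_def indicator_def field_simps)
      qed
      with False show ?thesis by simp
    qed
    have i2: "integrable lborel (\<lambda>x. indicator (ball 0 1 - {0}) x * \<psi> (sgn x))"
    proof -
      obtain C where C: "\<And>x. norm x \<le> 1 \<Longrightarrow> norm (\<psi> x) \<le> C"
        using continuous_bounded_on_cball[of 1 \<psi>] continuous_on_subset[OF cont(1)] by blast
      show ?thesis
      proof (rule Bochner_Integration.integrable_bound[OF integrable_indicator_ball[of "\<lambda>_. C"]])
        show "AE x in lborel. norm (indicator (ball 0 1 - {0}) x * \<psi> (sgn x)) \<le> norm (indicator (ball 0 1) x * C)"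
        proof (intro AE_I2)
          fix x :: 'a
          have "norm (\<psi> (sgn x)) \<le> C" by (intro C) (simp add: norm_sgn)
          then show "norm (indicator (ball 0 1 - {0}) x * \<psi> (sgn x)) \<le> norm (indicator (ball 0 1) x * C)"
            by (auto simp: indicator_def)
        qed
      qed (auto intro!: borel_measurable_times borel_measurable_indicator
        measurable_compose[OF borel_measurable_sgn_vector] meas)
    qed
    have "(LINT x|lborel. (LINT t|lborel. f t x)) =
      (LINT x|lborel. indicator (ball 0 1 - {0}) x * \<psi> (sgn x) - indicator (ball 0 1) x * \<psi> x)"
    proof (rule integral_cong_AE)
      show "AE x in lborel. (LINT t|lborel. f t x) = indicator (ball 0 1 - {0}) x * \<psi> (sgn x) - indicator (ball 0 1) x * \<psi> x"
        using AE_lborel_singleton[of "0::'a"] by eventually_elim (auto simp: inner indicator_def)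
    qed (auto simp: inner intro!: borel_measurable_diff borel_measurable_times borel_measurable_indicator
        measurable_compose[OF borel_measurable_sgn_vector] meas)
    also have "\<dots> = (LINT x|lborel. indicator (ball 0 1 - {0}) x * \<psi> (sgn x)) - (LINT x|lborel. indicator (ball 0 1) x * \<psi> x)"
      by (rule Bochner_Integration.integral_diff[OF i2 i1])
    finally show ?thesis .
  qed
  from lborel_pair.Fubini_integral[OF fi]
  have eq: "(LINT x|lborel. \<Phi> x) / N = (LINT x|lborel. indicator (ball 0 1 - {0}) x * \<psi> (sgn x)) - (LINT x|lborel. indicator (ball 0 1) x * \<psi> x)"
    unfolding L R by simp
  have "(LINT x|ball_measure. DIM('a) * \<psi> x + grad \<psi> x \<bullet> x) = (LINT x|lborel. indicator (ball 0 1) x * (N * \<psi> x + D x))"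
    unfolding N_def D_def[symmetric] by (intro integral_ball_lborel) auto
  also have "\<dots> = (LINT x|lborel. N * (indicator (ball 0 1) x * \<psi> x) + \<Phi> x)"
    by (intro Bochner_Integration.integral_cong) (auto simp: \<Phi>_def algebra_simps)
  also have "\<dots> = N * (LINT x|lborel. indicator (ball 0 1) x * \<psi> x) + (LINT x|lborel. \<Phi> x)"
    using i1 \<Phi>i by simp
  also have "\<dots> = N * (LINT x|lborel. indicator (ball 0 1 - {0}) x * \<psi> (sgn x))"
    using eq N by (simp add: field_simps)
  also have "\<dots> = (LINT x|sphere_measure. \<psi> x)"
    by (simp add: integral_sphere_measure N_def)
  finally show ?thesis .
qed

section \<open>Limits of smooth functions in the Sobolev norm\<close>

text \<open>\<open>F\<close> vanishes off the ball, so the integral may be taken over the whole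
  space. There translation invariance makes every difference quotient integrate to 0, and dominated
  convergence passes to the derivative.\<close>

lemma integral_grad_zero_boundary:
  fixes F :: "'a::euclidean_space \<Rightarrow> real"
  assumes s: "smooth_on UNIV F" and z: "\<And>x. 1 \<le> norm x \<Longrightarrow> F x = 0"
  shows "(LINT x|ball_measure. grad F x \<bullet> v) = 0"
proof -
  have cont: "continuous_on UNIV F" "continuous_on UNIV (grad F)"
    using s by (auto intro: smooth_on_continuous continuous_on_grad)
  then have [measurable]: "F \<in> borel_measurable borel" "grad F \<in> borel_measurable borel"
    by (auto intro: borel_measurable_continuous_onI)
  have gz: "grad F x = 0" if "1 < norm x" for x
  proof (rule grad_eqI)
    have "(F has_derivative (\<lambda>v. 0)) (at x)"
      by (rule has_derivative_transform_within_open[of "\<lambda>x. 0" _ _ _ "- cball 0 1"])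
         (use that z in \<open>auto simp: open_Compl\<close>)
    then show "(F has_derivative (\<lambda>v. 0 \<bullet> v)) (at x)" by simp
  qed
  obtain C where C: "0 \<le> C" "\<And>x. norm x \<le> 1 \<Longrightarrow> norm (grad F x) \<le> C"
    using continuous_bounded_on_cball[of 1 "grad F"] continuous_on_subset[OF cont(2)] by blast
  have gC: "norm (grad F x) \<le> C" for x
    using C gz[of x] by (cases "norm x \<le> 1") auto
  have Lip: "norm (F y - F x) \<le> C * norm (y - x)" for x y
  proof (rule differentiable_bound[of UNIV])
    show "(F has_derivative (\<lambda>v. grad F x \<bullet> v)) (at x within UNIV)" for x
      using smooth_on_has_derivative[OF s] .
    show "onorm (\<lambda>v. grad F x \<bullet> v) \<le> C" for x
    proof (rule onorm_le)
      fix v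
      have "norm (grad F x \<bullet> v) \<le> norm (grad F x) * norm v" by (simp add: Cauchy_Schwarz_ineq2)
      also have "\<dots> \<le> C * norm v" by (intro mult_right_mono gC) simp
      finally show "norm (grad F x \<bullet> v) \<le> C * norm v" .
    qed
  qed auto
  have Fi: "integrable lborel F"
    using integrable_indicator_ball[OF cont(1)]
    by (rule Bochner_Integration.integrable_cong[OF refl, THEN iffD1, rotated])
       (use z in \<open>auto simp: indicator_def\<close>)
  have shift: "(LINT x|lborel. F (c + x)) = (LINT x|lborel. F x)" "integrable lborel (\<lambda>x. F (c + x))" for c
  proof -
    have "(LINT x|lborel. F x) = (LINT x|distr lborel borel ((+) c). F x)" by (simp add: lborel_distr_plus)
    then show "(LINT x|lborel. F (c + x)) = (LINT x|lborel. F x)" by (simp add: integral_distr)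
    have "integrable (distr lborel borel ((+) c)) F" using Fi by (simp add: lborel_distr_plus)
    then show "integrable lborel (\<lambda>x. F (c + x))" by (simp add: integrable_distr_eq)
  qed
  define t where "t n = inverse (real (Suc n))" for n
  have t: "0 < t n" "t n \<le> 1" for n by (auto simp: t_def inverse_le_1_iff)
  define s where "s n x = (F (t n *\<^sub>R v + x) - F x) / t n" for n x
  have "(LINT x|lborel. s n x) = 0" for n
    unfolding s_def using shift Fi by (simp add: Bochner_Integration.integral_diff)
  \<comment> \<open>The shifts have length at most \<open>norm v\<close>, so the quotients live in
    the ball of radius \<open>1 + norm v\<close>, where the Lipschitz bound dominates them.\<close>
  moreover have "(\<lambda>n. LINT x|lborel. s n x) \<longlonglongrightarrow> (LINT x|lborel. grad F x \<bullet> v)"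
  proof (rule integral_dominated_convergence[where w = "\<lambda>x. indicator (cball 0 (1 + norm v)) x *\<^sub>R (C * norm v)"])
    show "integrable lborel (\<lambda>x::'a. indicator (cball 0 (1 + norm v)) x *\<^sub>R (C * norm v))"
      by (intro borel_integrable_compact compact_cball continuous_intros)
    show "AE x in lborel. norm (s n x) \<le> indicator (cball 0 (1 + norm v)) x *\<^sub>R (C * norm v)" for n
    proof (intro AE_I2)
      fix x :: 'a
      have n1: "norm (t n *\<^sub>R v) \<le> norm v" using t[of n] by (auto intro: mult_left_le_one_le)
      show "norm (s n x) \<le> indicator (cball 0 (1 + norm v)) x *\<^sub>R (C * norm v)"
      proof (cases "norm x \<le> 1 + norm v")
        case True
        have "norm (F (t n *\<^sub>R v + x) - F x) \<le> C * norm v * t n"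
          using Lip[of "t n *\<^sub>R v + x" x] t[of n] by (simp add: mult_ac)
        then show ?thesis using True t[of n] by (simp add: s_def divide_le_eq)
      next
        case False
        then have "1 \<le> norm x" "1 \<le> norm (t n *\<^sub>R v + x)"
          using n1 norm_triangle_ineq2[of x "- (t n *\<^sub>R v)"] norm_ge_zero[of v]
          by (simp_all add: add.commute del: norm_ge_zero)
        then show ?thesis by (simp add: s_def z C)
      qed
    qed
    show "AE x in lborel. (\<lambda>n. s n x) \<longlonglongrightarrow> grad F x \<bullet> v"
    proof (intro AE_I2)
      fix x :: 'a
      have "((\<lambda>h. h *\<^sub>R v + x) has_derivative (\<lambda>h. h *\<^sub>R v)) (at 0)" by (auto intro!: derivative_eq_intros)
      from has_derivative_compose[OF this smooth_on_has_derivative[OF assms(1)]]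
      have "DERIV (\<lambda>h. F (h *\<^sub>R v + x)) 0 :> grad F x \<bullet> v"
        unfolding has_field_derivative_def by (rule has_derivative_eq_rhs) auto
      then have "(\<lambda>h. (F (h *\<^sub>R v + x) - F x) / h) \<midarrow>0\<rightarrow> grad F x \<bullet> v"
        by (simp add: DERIV_def)
      moreover have "filterlim t (at 0) sequentially"
        unfolding t_def by (rule filterlim_atI[OF LIMSEQ_inverse_real_of_nat]) (simp add: eventually_sequentially)
      ultimately show "(\<lambda>n. s n x) \<longlonglongrightarrow> grad F x \<bullet> v"
        unfolding s_def by (rule filterlim_compose)
    qed
  qed (auto simp: s_def)
  ultimately have "(LINT x|lborel. grad F x \<bullet> v) = 0"
    by (simp add: LIMSEQ_const_iff)
  moreover have "(LINT x|ball_measure. grad F x \<bullet> v) = (LINT x|lborel. indicator (ball 0 1) x * (grad F x \<bullet> v))"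
    by (intro integral_ball_lborel) auto
  moreover have "\<dots> = (LINT x|lborel. grad F x \<bullet> v)"
  proof (intro Bochner_Integration.integral_cong refl)
    fix x :: 'a
    have "continuous (at x) (grad F)" using cont(2) by (simp add: continuous_on_eq_continuous_at)
    \<comment> \<open>On the sphere the gradient is the limit of its zero values from
      outside.\<close>
    have "grad F x = 0" if "norm x = 1"
    proof -
      have "(\<lambda>n. grad F ((1 + t n) *\<^sub>R x)) \<longlonglongrightarrow> grad F ((1 + 0) *\<^sub>R x)"
        unfolding t_def
        by (rule continuous_on_tendsto_compose[OF cont(2)]) (intro tendsto_intros LIMSEQ_inverse_real_of_nat, auto)
      moreover have "grad F ((1 + t n) *\<^sub>R x) = 0" for n
        using t[of n] that by (intro gz) auto
      ultimately show ?thesis by (simp add: LIMSEQ_const_iff)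
    qed
    then show "indicator (ball 0 1) x * (grad F x \<bullet> v) = grad F x \<bullet> v"
      using gz[of x] by (cases "norm x" "1::real" rule: linorder_cases) (auto simp: indicator_def)
  qed
  ultimately show ?thesis by simp
qed

text \<open>The approximating sequence stays visible, so that operations such as ray averages, which
  have no direct meaning for functions given almost everywhere, can be applied to its smooth
  members.\<close>

definition h1_lim :: "(nat \<Rightarrow> 'a::euclidean_space \<Rightarrow> real) \<Rightarrow> ('a \<Rightarrow> real) \<Rightarrow> ('a \<Rightarrow> 'a) \<Rightarrow> bool" where
  "h1_lim \<phi> u U \<longleftrightarrow> (\<forall>n. smooth_on UNIV (\<phi> n)) \<and> l2_lim ball_measure \<phi> u \<and> l2_lim ball_measure (\<lambda>n. grad (\<phi> n)) U"

lemma smooth_square_integrable: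
  fixes f :: "'a::euclidean_space \<Rightarrow> real"
  assumes "smooth_on UNIV f"
  shows "square_integrable ball_measure f" "square_integrable ball_measure (grad f)" "square_integrable sphere_measure f"
  using assms
  by (auto intro: square_integrable_continuous_ball square_integrable_continuous_sphere smooth_on_continuous continuous_on_grad)

text \<open>Integration by parts holds for the smooth members because their product with a test
  function vanishes outside the ball, and both sides are continuous in L^2.\<close>

lemma h1_lim_in_H1:
  fixes \<phi> :: "nat \<Rightarrow> 'a::euclidean_space \<Rightarrow> real"
  assumes h: "h1_lim \<phi> u U"
  shows "in_H1 (ball 0 1) u U"
  unfolding in_H1_def
proof (intro conjI allI impI)
  show "square_integrable ball_measure u" "square_integrable ball_measure U"
    using h by (auto simp: h1_lim_def l2_lim_def)
  fix \<psi> :: "'a \<Rightarrow> real" and v :: 'a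
  assume t: "test_function (ball 0 1) \<psi>"
  then have s: "smooth_on UNIV \<psi>" by (simp add: test_function_def)
  have z: "\<psi> x = 0" if "1 \<le> norm x" for x
    using t that closure_subset[of "{x. \<psi> x \<noteq> 0}"] unfolding test_function_def by force
  have sn: "smooth_on UNIV (\<phi> n)" for n using h by (simp add: h1_lim_def)
  have eq: "(LINT x|ball_measure. \<phi> n x * (grad \<psi> x \<bullet> v)) = - (LINT x|ball_measure. (grad (\<phi> n) x \<bullet> v) * \<psi> x)" for n
  proof -
    have "0 = (LINT x|ball_measure. grad (\<lambda>x. \<phi> n x * \<psi> x) x \<bullet> v)"
      by (rule integral_grad_zero_boundary[symmetric]) (auto intro: smooth_on_mult sn s simp: z)
    also have "\<dots> = (LINT x|ball_measure. \<phi> n x * (grad \<psi> x \<bullet> v) + (grad (\<phi> n) x \<bullet> v) * \<psi> x)"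
      by (simp only: grad_mult[OF sn s] inner_add_left inner_scaleR_left mult.commute[of "\<psi> x" for x])
    also have "\<dots> = (LINT x|ball_measure. \<phi> n x * (grad \<psi> x \<bullet> v)) + (LINT x|ball_measure. (grad (\<phi> n) x \<bullet> v) * \<psi> x)"
      by (intro Bochner_Integration.integral_add square_integrable_mult smooth_square_integrable sn s smooth_on_grad)
    finally show ?thesis by simp
  qed
  have l1: "(\<lambda>n. LINT x|ball_measure. \<phi> n x * (grad \<psi> x \<bullet> v)) \<longlonglongrightarrow> (LINT x|ball_measure. u x * (grad \<psi> x \<bullet> v))"
    using h by (intro l2_lim_mult l2_lim_const smooth_square_integrable smooth_on_grad s) (simp add: h1_lim_def)
  have l2: "(\<lambda>n. LINT x|ball_measure. (grad (\<phi> n) x \<bullet> v) * \<psi> x) \<longlonglongrightarrow> (LINT x|ball_measure. (U x \<bullet> v) * \<psi> x)"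
    using h by (intro l2_lim_mult l2_lim_const smooth_square_integrable s l2_lim_inner_right[where b = "\<lambda>x. v" and C = "norm v"])
      (auto simp: h1_lim_def)
  from LIMSEQ_unique[OF l1[unfolded eq] tendsto_minus[OF l2]]
  show "(LINT x|ball_measure. u x * frechet_derivative \<psi> (at x) v) = - (LINT x|ball_measure. (U x \<bullet> v) * \<psi> x)"
    by (simp add: frechet_eq_grad[OF s])
qed

abbreviation ball_trace :: "('a::euclidean_space \<Rightarrow> real) \<Rightarrow> ('a \<Rightarrow> 'a) \<Rightarrow> ('a \<Rightarrow> real) \<Rightarrow> bool" where
  "ball_trace \<equiv> has_trace (ball 0 1) sphere_measure"

text \<open>Since approximation already implies the weak gradient identity, a trace is established
  by exhibiting a single sequence with three L^2 limits.\<close>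

lemma ball_trace_iff: "ball_trace u U f \<longleftrightarrow> (\<exists>\<phi>. h1_lim \<phi> u U \<and> l2_lim sphere_measure \<phi> f)"
proof
  assume "ball_trace u U f"
  then obtain \<phi> where "in_H1 (ball 0 1) u U" "square_integrable sphere_measure f" "\<And>n. smooth_on UNIV (\<phi> n)"
    "(\<lambda>n. LINT x|ball_measure. (norm (\<phi> n x - u x))\<^sup>2) \<longlonglongrightarrow> 0"
    "(\<lambda>n. LINT x|ball_measure. (norm (grad (\<phi> n) x - U x))\<^sup>2) \<longlonglongrightarrow> 0"
    "(\<lambda>n. LINT x|sphere_measure. (norm (\<phi> n x - f x))\<^sup>2) \<longlonglongrightarrow> 0"
    unfolding has_trace_def by auto
  then show "\<exists>\<phi>. h1_lim \<phi> u U \<and> l2_lim sphere_measure \<phi> f"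
    unfolding h1_lim_def l2_lim_def l2_tendsto_iff
    by (intro exI[of _ \<phi>]) (auto simp: in_H1_def smooth_square_integrable)
next
  assume "\<exists>\<phi>. h1_lim \<phi> u U \<and> l2_lim sphere_measure \<phi> f"
  then obtain \<phi> where \<phi>: "h1_lim \<phi> u U" "l2_lim sphere_measure \<phi> f" by blast
  then have "in_H1 (ball 0 1) u U" by (auto intro: h1_lim_in_H1)
  then show "ball_trace u U f"
    using \<phi> unfolding has_trace_def h1_lim_def l2_lim_def l2_tendsto_iff by auto
qed

lemma ball_traceI: "h1_lim \<phi> u U \<Longrightarrow> l2_lim sphere_measure \<phi> f \<Longrightarrow> ball_trace u U f"
  by (auto simp: ball_trace_iff)

lemma h1_limD:
  assumes "h1_lim \<phi> u U"
  shows "smooth_on UNIV (\<phi> n)" "l2_lim ball_measure \<phi> u" "l2_lim ball_measure (\<lambda>n. grad (\<phi> n)) U"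
  using assms by (auto simp: h1_lim_def)

lemma ball_traceD:
  assumes "ball_trace u U f"
  shows "square_integrable ball_measure u" "square_integrable ball_measure U" "square_integrable sphere_measure f"
  using assms by (auto simp: has_trace_def in_H1_def)

lemma ball_trace_smooth: "smooth_on UNIV \<phi> \<Longrightarrow> ball_trace \<phi> (grad \<phi>) \<phi>"
  by (rule ball_traceI[of "\<lambda>n. \<phi>"]) (auto simp: h1_lim_def intro: l2_lim_const smooth_square_integrable)

lemma h1_lim_add:
  assumes "h1_lim \<phi> u U" "h1_lim \<psi> v V"
  shows "h1_lim (\<lambda>n x. \<phi> n x + \<psi> n x) (\<lambda>x. u x + v x) (\<lambda>x. U x + V x)"
proof -
  have "grad (\<lambda>x. \<phi> n x + \<psi> n x) = (\<lambda>x. grad (\<phi> n) x + grad (\<psi> n) x)" for n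
    by (rule ext, rule grad_add) (use assms in \<open>auto simp: h1_lim_def\<close>)
  then show ?thesis using assms by (auto simp: h1_lim_def intro: l2_lim_add smooth_on_add)
qed

lemma h1_lim_cmult:
  assumes "h1_lim \<phi> u U"
  shows "h1_lim (\<lambda>n x. c * \<phi> n x) (\<lambda>x. c * u x) (\<lambda>x. c *\<^sub>R U x)"
proof -
  have "grad (\<lambda>x. c * \<phi> n x) = (\<lambda>x. c *\<^sub>R grad (\<phi> n) x)" for n
    by (rule ext, subst grad_mult) (use assms in \<open>auto simp: h1_lim_def\<close>)
  then show ?thesis using assms by (auto simp: h1_lim_def intro: l2_lim_cmult l2_lim_scaleR smooth_on_mult)
qed

lemma ball_trace_add:
  "ball_trace u U f \<Longrightarrow> ball_trace v V g \<Longrightarrow> ball_trace (\<lambda>x. u x + v x) (\<lambda>x. U x + V x) (\<lambda>x. f x + g x)"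
  unfolding ball_trace_iff by (blast intro: h1_lim_add l2_lim_add)

lemma ball_trace_cmult:
  "ball_trace u U f \<Longrightarrow> ball_trace (\<lambda>x. c * u x) (\<lambda>x. c *\<^sub>R U x) (\<lambda>x. c * f x)"
  unfolding ball_trace_iff by (blast intro: h1_lim_cmult l2_lim_cmult)

lemma ball_trace_diff:
  "ball_trace u U f \<Longrightarrow> ball_trace v V g \<Longrightarrow> ball_trace (\<lambda>x. u x - v x) (\<lambda>x. U x - V x) (\<lambda>x. f x - g x)"
  using ball_trace_add[OF _ ball_trace_cmult[of v V g "-1"]] by simp

section \<open>Green's formula, trace inequality and Poincare inequality\<close>

lemma norm_le_1_ball_measure: "x \<in> space ball_measure \<Longrightarrow> norm x \<le> 1"
  by (simp add: space_restrict_space)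

lemma id_meas_ball [simp]: "(\<lambda>x. x) \<in> borel_measurable (ball_measure :: 'a::euclidean_space measure)"
  by (intro borel_imp_lebesgue_on) simp

lemma square_integrable_radial:
  "square_integrable ball_measure U \<Longrightarrow> square_integrable ball_measure (\<lambda>x. U x \<bullet> x)"
  by (rule square_integrable_inner_right[where C = 1]) (auto simp: norm_le_1_ball_measure)

lemma l2_lim_radial:
  "l2_lim ball_measure F U \<Longrightarrow> l2_lim ball_measure (\<lambda>n x. F n x \<bullet> x) (\<lambda>x. U x \<bullet> x)"
  by (rule l2_lim_inner_right[where C = 1]) (auto simp: norm_le_1_ball_measure)

text \<open>On the sphere the field x is the unit normal, so its flux is the plain pairing of
  \<open>f\<close> and \<open>g\<close>, with no boundary derivative. For smooth approximants this
  is \<open>radial_divergence\<close> of their product, and every term passes to the limit in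
  L^2.\<close>

theorem radial_green:
  fixes u v :: "'a::euclidean_space \<Rightarrow> real"
  assumes u: "ball_trace u U f" and v: "ball_trace v V g"
  shows "DIM('a) * (LINT x|ball_measure. u x * v x) + (LINT x|ball_measure. (U x \<bullet> x) * v x)
      + (LINT x|ball_measure. u x * (V x \<bullet> x)) = (LINT x|sphere_measure. f x * g x)"
proof -
  obtain \<phi> \<psi> where \<phi>: "h1_lim \<phi> u U" "l2_lim sphere_measure \<phi> f" and \<psi>: "h1_lim \<psi> v V" "l2_lim sphere_measure \<psi> g"
    using u v unfolding ball_trace_iff by blast
  note \<phi>s = h1_limD[OF \<phi>(1)] and \<psi>s = h1_limD[OF \<psi>(1)]
  have eq: "(LINT x|sphere_measure. \<phi> n x * \<psi> n x) = DIM('a) * (LINT x|ball_measure. \<phi> n x * \<psi> n x)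
     + (LINT x|ball_measure. (grad (\<phi> n) x \<bullet> x) * \<psi> n x) + (LINT x|ball_measure. \<phi> n x * (grad (\<psi> n) x \<bullet> x))" for n
  proof -
    have i: "integrable ball_measure (\<lambda>x. \<phi> n x * \<psi> n x)" "integrable ball_measure (\<lambda>x. (grad (\<phi> n) x \<bullet> x) * \<psi> n x)"
      "integrable ball_measure (\<lambda>x. \<phi> n x * (grad (\<psi> n) x \<bullet> x))"
      by (intro square_integrable_mult square_integrable_radial smooth_square_integrable \<phi>s \<psi>s)+
    have "(LINT x|sphere_measure. \<phi> n x * \<psi> n x)
        = (LINT x|ball_measure. DIM('a) * (\<phi> n x * \<psi> n x) + grad (\<lambda>x. \<phi> n x * \<psi> n x) x \<bullet> x)"
      by (intro radial_divergence[symmetric] smooth_on_mult \<phi>s \<psi>s)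
    also have "\<dots> = (LINT x|ball_measure. DIM('a) * (\<phi> n x * \<psi> n x) + (grad (\<phi> n) x \<bullet> x) * \<psi> n x + \<phi> n x * (grad (\<psi> n) x \<bullet> x))"
      by (simp add: grad_mult[OF \<phi>s(1) \<psi>s(1)] inner_add_left algebra_simps)
    also have "\<dots> = DIM('a) * (LINT x|ball_measure. \<phi> n x * \<psi> n x)
     + (LINT x|ball_measure. (grad (\<phi> n) x \<bullet> x) * \<psi> n x) + (LINT x|ball_measure. \<phi> n x * (grad (\<psi> n) x \<bullet> x))"
      using i by simp
    finally show ?thesis .
  qed
  have "(\<lambda>n. LINT x|sphere_measure. \<phi> n x * \<psi> n x) \<longlonglongrightarrow> DIM('a) * (LINT x|ball_measure. u x * v x)
      + (LINT x|ball_measure. (U x \<bullet> x) * v x) + (LINT x|ball_measure. u x * (V x \<bullet> x))"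
    unfolding eq
    by (intro tendsto_add tendsto_mult_left l2_lim_mult l2_lim_radial \<phi>s \<psi>s)
  moreover have "(\<lambda>n. LINT x|sphere_measure. \<phi> n x * \<psi> n x) \<longlonglongrightarrow> (LINT x|sphere_measure. f x * g x)"
    by (intro l2_lim_mult \<phi> \<psi>)
  ultimately show ?thesis using LIMSEQ_unique by blast
qed

text \<open>One identity behind two estimates: solved for the boundary norm it gives the trace
  inequality, solved for the interior norm the Poincare inequality.\<close>

lemma smooth_green:
  fixes \<psi> :: "'a::euclidean_space \<Rightarrow> real"
  assumes s: "smooth_on UNIV \<psi>"
  shows "DIM('a) * (l2 ball_measure \<psi>)\<^sup>2 + 2 * (LINT x|ball_measure. \<psi> x * (grad \<psi> x \<bullet> x)) = (l2 sphere_measure \<psi>)\<^sup>2"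
  using radial_green[OF ball_trace_smooth[OF s] ball_trace_smooth[OF s]]
  unfolding l2_sq by (simp add: power2_eq_square mult.commute)

lemma radial_cross_bound:
  assumes "square_integrable ball_measure (\<psi> :: 'a::euclidean_space \<Rightarrow> real)" "square_integrable ball_measure U"
  shows "\<bar>2 * (LINT x|ball_measure. \<psi> x * (U x \<bullet> x))\<bar> \<le> (l2 ball_measure \<psi>)\<^sup>2 + (l2 ball_measure U)\<^sup>2"
proof -
  have "\<bar>LINT x|ball_measure. \<psi> x * (U x \<bullet> x)\<bar> \<le> l2 ball_measure \<psi> * l2 ball_measure (\<lambda>x. U x \<bullet> x)"
    using l2_Cauchy_Schwarz[OF assms(1) square_integrable_radial[OF assms(2)]] by simp
  also have "\<dots> \<le> l2 ball_measure \<psi> * l2 ball_measure U"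
  proof (rule mult_left_mono)
    have "norm (U x \<bullet> x) \<le> 1 * norm (U x)" if "x \<in> space ball_measure" for x
      using Cauchy_Schwarz_ineq2[of "U x" x] mult_left_mono[OF norm_le_1_ball_measure[OF that], of "norm (U x)"] by simp
    from l2_mono(2)[OF assms(2) _ _ this]
    show "l2 ball_measure (\<lambda>x. U x \<bullet> x) \<le> l2 ball_measure U"
      using square_integrable_radial[OF assms(2)] by (simp add: square_integrable_meas)
  qed simp
  finally show ?thesis
    using sum_squares_bound[of "l2 ball_measure \<psi>" "l2 ball_measure U"] by simp
qed

lemma smooth_trace_inequality:
  fixes \<psi> :: "'a::euclidean_space \<Rightarrow> real"
  assumes s: "smooth_on UNIV \<psi>"
  shows "(l2 sphere_measure \<psi>)\<^sup>2 \<le> (DIM('a) + 1) * (l2 ball_measure \<psi>)\<^sup>2 + (l2 ball_measure (grad \<psi>))\<^sup>2"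
  using smooth_green[OF s] radial_cross_bound[OF smooth_square_integrable(1,2)[OF s]]
  by (simp add: distrib_right)

text \<open>The cross term consumes one of the \<open>DIM('a)\<close> copies of the interior norm,
  so the estimate carries information from dimension 2 on. This is the origin of the dimension
  hypothesis in \<open>Dirichlet_problem\<close>.\<close>

lemma smooth_Poincare:
  fixes \<psi> :: "'a::euclidean_space \<Rightarrow> real"
  assumes s: "smooth_on UNIV \<psi>"
  shows "(real DIM('a) - 1) * (l2 ball_measure \<psi>)\<^sup>2 \<le> (l2 sphere_measure \<psi>)\<^sup>2 + (l2 ball_measure (grad \<psi>))\<^sup>2"
  using smooth_green[OF s] radial_cross_bound[OF smooth_square_integrable(1,2)[OF s]]
  by (simp add: left_diff_distrib)

lemma h1_limit_exists:
  fixes \<phi> :: "nat \<Rightarrow> 'a::euclidean_space \<Rightarrow> real"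
  assumes s: "\<And>n. smooth_on UNIV (\<phi> n)" and "l2_Cauchy ball_measure \<phi>" "l2_Cauchy ball_measure (\<lambda>n. grad (\<phi> n))"
  obtains u U where "h1_lim \<phi> u U"
proof -
  obtain u where "l2_lim ball_measure \<phi> u"
    using Riesz_Fischer[OF smooth_square_integrable(1)[OF s] assms(2)] .
  moreover obtain U where "l2_lim ball_measure (\<lambda>n. grad (\<phi> n)) U"
    using Riesz_Fischer[OF smooth_square_integrable(2)[OF s] assms(3)] .
  ultimately show thesis using s by (intro that) (auto simp: h1_lim_def)
qed

text \<open>By the trace inequality the boundary values form a Cauchy sequence. This serves the ray
  averages, whose boundary values are not prescribed in advance.\<close>

lemma h1_lim_trace:
  fixes \<phi> :: "nat \<Rightarrow> 'a::euclidean_space \<Rightarrow> real"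
  assumes h: "h1_lim \<phi> u U"
  obtains f where "l2_lim sphere_measure \<phi> f"
proof -
  note hs = h1_limD[OF h]
  have "l2_Cauchy sphere_measure \<phi>"
    unfolding l2_Cauchy_def
  proof (intro allI impI)
    fix e :: real assume e: "e > 0"
    define d where "d = e / (DIM('a) + 3)"
    have d: "d > 0" unfolding d_def using e by simp
    obtain N1 where N1: "\<And>m n. m \<ge> N1 \<Longrightarrow> n \<ge> N1 \<Longrightarrow> l2 ball_measure (\<lambda>x. \<phi> m x - \<phi> n x) < d"
      using l2_lim_Cauchy[OF hs(2)] d unfolding l2_Cauchy_def by blast
    obtain N2 where N2: "\<And>m n. m \<ge> N2 \<Longrightarrow> n \<ge> N2 \<Longrightarrow> l2 ball_measure (\<lambda>x. grad (\<phi> m) x - grad (\<phi> n) x) < d"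
      using l2_lim_Cauchy[OF hs(3)] d unfolding l2_Cauchy_def by blast
    have "l2 sphere_measure (\<lambda>x. \<phi> m x - \<phi> n x) < e" if "m \<ge> max N1 N2" "n \<ge> max N1 N2" for m n
    proof -
      have g: "grad (\<lambda>x. \<phi> m x - \<phi> n x) = (\<lambda>x. grad (\<phi> m) x - grad (\<phi> n) x)"
        by (rule ext, rule grad_diff) (rule hs)+
      have "(l2 sphere_measure (\<lambda>x. \<phi> m x - \<phi> n x))\<^sup>2 \<le> (DIM('a) + 1) * (l2 ball_measure (\<lambda>x. \<phi> m x - \<phi> n x))\<^sup>2
          + (l2 ball_measure (\<lambda>x. grad (\<phi> m) x - grad (\<phi> n) x))\<^sup>2"
        using smooth_trace_inequality[OF smooth_on_diff[OF hs(1) hs(1)], of m n] unfolding g .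
      also have "\<dots> \<le> (DIM('a) + 1) * d\<^sup>2 + d\<^sup>2"
        using N1[of m n] N2[of m n] that by (intro add_mono mult_left_mono power_mono) auto
      also have "\<dots> < ((DIM('a) + 3) * d)\<^sup>2"
      proof -
        have "real (DIM('a) + 1) + 1 < (real DIM('a) + 3)\<^sup>2" by (simp add: power2_eq_square algebra_simps add_pos_nonneg)
        then have "(real (DIM('a) + 1) + 1) * d\<^sup>2 < (real DIM('a) + 3)\<^sup>2 * d\<^sup>2"
          using d by (intro mult_strict_right_mono) auto
        then show ?thesis unfolding power_mult_distrib by (simp add: distrib_right)
      qed
      also have "(DIM('a) + 3) * d = e" by (simp add: d_def)
      finally show ?thesis using e by (intro power2_less_imp_less[of _ e]) auto
    qed
    then show "\<exists>N. \<forall>m\<ge>N. \<forall>n\<ge>N. l2 sphere_measure (\<lambda>x. \<phi> m x - \<phi> n x) < e" by blast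
  qed
  from Riesz_Fischer[of sphere_measure \<phi>, OF smooth_square_integrable(3)[OF hs(1)] this] that
  show thesis by metis
qed

section \<open>Multiplication by radial functions\<close>

text \<open>Split the product into \<open>(bn n - b) F n\<close>, a uniformly small factor times a
  norm-bounded sequence, and \<open>b F n\<close>, a bounded multiplier of a convergent one.\<close>

lemma l2_lim_uniform_mult:
  fixes b :: "'a \<Rightarrow> real"
  assumes F: "l2_lim M F f"
    and b: "b \<in> borel_measurable M" "\<And>x. x \<in> space M \<Longrightarrow> \<bar>b x\<bar> \<le> C"
    and bn: "\<And>n. bn n \<in> borel_measurable M" "\<And>n x. x \<in> space M \<Longrightarrow> \<bar>bn n x - b x\<bar> \<le> e n" and e: "e \<longlonglongrightarrow> 0" "\<And>n. 0 \<le> e n"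
  shows "l2_lim M (\<lambda>n x. bn n x *\<^sub>R F n x) (\<lambda>x. b x *\<^sub>R f x)"
proof -
  note Fs = l2_limD[OF F]
  have sq: "square_integrable M (\<lambda>x. (bn n x - b x) *\<^sub>R F n x)" for n
    by (rule square_integrable_bounded_scaleR[OF Fs(1) _ bn(2)]) (use bn b in auto)
  have "l2_lim M (\<lambda>n x. (bn n x - b x) *\<^sub>R F n x) (\<lambda>x. 0)"
    unfolding l2_lim_def
  proof (intro conjI allI sq square_integrable_zero)
    have le: "l2 M (\<lambda>x. (bn n x - b x) *\<^sub>R F n x) \<le> e n * l2 M (F n)" for n
      by (rule l2_mono(2)[OF Fs(1) _ e(2)]) (auto intro: mult_right_mono bn square_integrable_meas[OF sq])
    have "(\<lambda>n. e n * l2 M (F n)) \<longlonglongrightarrow> 0"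
      using tendsto_mult[OF e(1) l2_lim_norm[OF F]] by simp
    then have "(\<lambda>n. l2 M (\<lambda>x. (bn n x - b x) *\<^sub>R F n x)) \<longlonglongrightarrow> 0"
      by (rule Lim_null_comparison[OF always_eventually, rotated]) (simp add: le)
    then show "(\<lambda>n. l2 M (\<lambda>x. (bn n x - b x) *\<^sub>R F n x - 0)) \<longlonglongrightarrow> 0" by simp
  qed
  from l2_lim_add[OF this l2_lim_bounded_scaleR[OF F b]]
  show ?thesis by (simp add: algebra_simps)
qed

lemma grad_radial:
  assumes "\<And>t. (P has_real_derivative p t) (at t)"
  shows "grad (\<lambda>x. P (x \<bullet> x)) x = (2 * p (x \<bullet> x)) *\<^sub>R x"
proof (rule grad_eqI)
  have "((\<lambda>x. x \<bullet> x) has_derivative (\<lambda>v. 2 * (x \<bullet> v))) (at x)"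
    by (auto intro!: derivative_eq_intros simp: inner_commute)
  from has_derivative_compose[OF this assms[THEN has_field_derivative_imp_has_derivative]]
  show "((\<lambda>x. P (x \<bullet> x)) has_derivative (\<lambda>v. ((2 * p (x \<bullet> x)) *\<^sub>R x) \<bullet> v)) (at x)"
    by (simp add: mult_ac)
qed

text \<open>
  A \<open>C\<^sup>1\<close> function of \<open>x \<bullet> x\<close> on the ball need not extend smoothly to the whole space; polynomial
  approximation of its derivative supplies the smooth functions that \<^const>\<open>has_trace\<close> asks for.
\<close>

lemma C1_polynomial_approximation:
  fixes \<eta> c :: "real \<Rightarrow> real"
  assumes der: "\<And>t. t \<in> {0..1} \<Longrightarrow> (\<eta> has_real_derivative c t) (at t within {0..1})"
    and cont: "continuous_on {0..1} c" and e: "e > 0"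
  obtains P p where "\<And>t. (P has_real_derivative p t) (at t)" "P 1 = \<eta> 1"
    "\<And>t. t \<in> {0..1} \<Longrightarrow> \<bar>P t - \<eta> t\<bar> \<le> e" "\<And>t. t \<in> {0..1} \<Longrightarrow> \<bar>p t - c t\<bar> \<le> e"
    "smooth_on UNIV (\<lambda>x::'a::euclidean_space. P (x \<bullet> x))" "continuous_on {0..1} p"
proof -
  obtain p where p: "real_polynomial_function p" "\<And>t. t \<in> {0..1} \<Longrightarrow> \<bar>c t - p t\<bar> < e"
    using Stone_Weierstrass_real_polynomial_function[of "{0..1}" c e] cont e by auto
  obtain a n where a: "p = (\<lambda>x. \<Sum>i\<le>n. a i * x ^ i)"
    using p(1) unfolding real_polynomial_function_iff_sum by blast
  \<comment> \<open>The antiderivative is anchored at 1 instead of 0, so that the boundary value of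
    \<open>\<eta>\<close> is matched exactly and not just up to \<open>e\<close>.\<close>
  define P where "P t = \<eta> 1 + (\<Sum>i\<le>n. a i / (real i + 1) * (t ^ (i + 1) - 1))" for t
  have dP: "(P has_real_derivative p t) (at t)" for t
  proof -
    have "((\<lambda>t. a i / (real i + 1) * (t ^ (i + 1) - 1)) has_real_derivative a i * t ^ i) (at t)" for i
    proof -
      have "((\<lambda>t. t ^ (i + 1) - 1) has_real_derivative (real i + 1) * t ^ i) (at t)"
        by (rule DERIV_cong[OF DERIV_diff[OF DERIV_pow DERIV_const]]) (simp add: add.commute)
      from DERIV_cmult[OF this, of "a i / (real i + 1)"] show ?thesis by (simp add: add_nonneg_eq_0_iff)
    qed
    from DERIV_add[OF DERIV_const DERIV_sum[OF this]]
    show ?thesis unfolding P_def a by simp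
  qed
  have P1: "P 1 = \<eta> 1" by (simp add: P_def)
  have "\<bar>P t - \<eta> t\<bar> \<le> e" if t: "t \<in> {0..1}" for t
  proof -
    have "norm ((P t - \<eta> t) - (P 1 - \<eta> 1)) \<le> e * norm (t - 1)"
    proof (rule differentiable_bound[of "{0..1}" _ "\<lambda>t h. (p t - c t) * h"])
      show "((\<lambda>t. P t - \<eta> t) has_derivative (\<lambda>h. (p s - c s) * h)) (at s within {0..1})" if "s \<in> {0..1}" for s
        using DERIV_diff[OF has_field_derivative_at_within[OF dP] der[OF that]]
        by (simp add: has_field_derivative_def)
      show "onorm (\<lambda>h. (p s - c s) * h) \<le> e" if "s \<in> {0..1}" for s
        using p(2)[OF that] by (intro onorm_le) (auto simp: abs_mult abs_minus_commute intro!: mult_right_mono)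
    qed (use t in auto)
    also have "\<dots> \<le> e * 1" using t e by (intro mult_left_mono) auto
    finally show ?thesis by (simp add: P1)
  qed
  moreover have "\<bar>p t - c t\<bar> \<le> e" if "t \<in> {0..1}" for t
    using p(2)[OF that] by (simp add: abs_minus_commute)
  moreover have "smooth_on UNIV (\<lambda>x::'a. P (x \<bullet> x))"
    unfolding P_def
    by (intro smooth_on_add smooth_on_const smooth_on_sum smooth_on_mult smooth_on_diff smooth_on_power smooth_on_norm_sq)
  moreover have "continuous_on {0..1} p" unfolding a by (intro continuous_intros)
  ultimately show thesis using that[of P p] dP P1 by blast
qed

lemma inner_self_ball_measure: "x \<in> space ball_measure \<Longrightarrow> x \<bullet> x \<in> {0..1}"
  using power_le_one[of "norm x" 2] by (simp add: power2_norm_eq_inner space_restrict_space)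

lemma radial_meas_bounded:
  fixes c :: "real \<Rightarrow> real"
  assumes "continuous_on {0..1} c"
  shows "(\<lambda>x::'a::euclidean_space. c (x \<bullet> x)) \<in> borel_measurable ball_measure"
    "\<exists>C. \<forall>x\<in>space (ball_measure :: 'a measure). \<bar>c (x \<bullet> x)\<bar> \<le> C"
proof -
  have in1: "x \<bullet> x \<in> {0..1}" if "norm x < 1" for x :: 'a
    using that power_le_one[of "norm x" 2] by (simp add: power2_norm_eq_inner)
  show "(\<lambda>x::'a. c (x \<bullet> x)) \<in> borel_measurable ball_measure"
    by (intro continuous_imp_measurable_on_sets_lebesgue continuous_on_compose2[OF assms] continuous_intros)
       (use in1 in auto)
  have "bounded (c ` {0..1})"
    by (intro compact_imp_bounded compact_continuous_image assms) simp
  then obtain C where "\<forall>t\<in>{0..1}. \<bar>c t\<bar> \<le> C" unfolding bounded_iff by auto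
  then show "\<exists>C. \<forall>x\<in>space (ball_measure :: 'a measure). \<bar>c (x \<bullet> x)\<bar> \<le> C"
    using in1 by (intro exI[of _ C]) (auto simp: space_restrict_space)
qed

text \<open>On the sphere the polynomial approximants equal \<open>\<eta> 1\<close> exactly, so the
  trace is only multiplied by a constant. In particular \<open>\<eta> 1 = 0\<close> turns any H^1
  function into one with zero trace, which is how test functions are made later.\<close>

lemma ball_trace_radial_mult:
  fixes u :: "'a::euclidean_space \<Rightarrow> real" and \<eta> c :: "real \<Rightarrow> real"
  assumes u: "ball_trace u U f"
    and der: "\<And>t. t \<in> {0..1} \<Longrightarrow> (\<eta> has_real_derivative c t) (at t within {0..1})"
    and cont: "continuous_on {0..1} c"
  shows "ball_trace (\<lambda>x. \<eta> (x \<bullet> x) * u x) (\<lambda>x. \<eta> (x \<bullet> x) *\<^sub>R U x + (2 * c (x \<bullet> x) * u x) *\<^sub>R x) (\<lambda>x. \<eta> 1 * f x)"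
proof -
  obtain \<phi> where \<phi>: "h1_lim \<phi> u U" "l2_lim sphere_measure \<phi> f" using u unfolding ball_trace_iff by blast
  note \<phi>s = h1_limD[OF \<phi>(1)]
  note in1 = inner_self_ball_measure[where 'a = 'a]
  have cont\<eta>: "continuous_on {0..1} \<eta>"
    by (rule DERIV_continuous_on[OF der])
  define e where "e n = inverse (real (Suc n))" for n
  have e: "e \<longlonglongrightarrow> 0" "0 \<le> e n" "0 < e n" for n unfolding e_def using LIMSEQ_inverse_real_of_nat by auto
  define R where "R n P p \<longleftrightarrow> (\<forall>t. (P has_real_derivative p t) (at t)) \<and> P 1 = \<eta> 1 \<and>
    (\<forall>t \<in> {0..1}. \<bar>P t - \<eta> t\<bar> \<le> e n) \<and> (\<forall>t \<in> {0..1}. \<bar>p t - c t\<bar> \<le> e n) \<and>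
    smooth_on UNIV (\<lambda>x::'a. P (x \<bullet> x)) \<and> continuous_on {0..1} p" for n P p
  have "\<exists>q. R n (fst q) (snd q)" for n
  proof (rule C1_polynomial_approximation[where 'a = 'a, OF der cont e(3)[of n]])
    fix P p :: "real \<Rightarrow> real"
    assume "\<And>t. (P has_real_derivative p t) (at t)" "P 1 = \<eta> 1"
      "\<And>t. t \<in> {0..1} \<Longrightarrow> \<bar>P t - \<eta> t\<bar> \<le> e n" "\<And>t. t \<in> {0..1} \<Longrightarrow> \<bar>p t - c t\<bar> \<le> e n"
      "smooth_on UNIV (\<lambda>x::'a. P (x \<bullet> x))" "continuous_on {0..1} p"
    then have "R n P p" unfolding R_def by blast
    then show "\<exists>q. R n (fst q) (snd q)" by (intro exI[of _ "(P, p)"]) simp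
  qed
  then obtain q where q: "R n (fst (q n)) (snd (q n))" for n using choice[of "\<lambda>n q. R n (fst q) (snd q)"] by blast
  define P where "P n = fst (q n)" for n
  define p where "p n = snd (q n)" for n
  have Rn: "R n (P n) (p n)" for n using q by (simp add: P_def p_def)
  have P: "(P n has_real_derivative p n t) (at t)" "P n 1 = \<eta> 1"
    "t \<in> {0..1} \<Longrightarrow> \<bar>P n t - \<eta> t\<bar> \<le> e n" "t \<in> {0..1} \<Longrightarrow> \<bar>p n t - c t\<bar> \<le> e n"
    "smooth_on UNIV (\<lambda>x::'a. P n (x \<bullet> x))" "continuous_on {0..1} (p n)" for n t
    using Rn[of n] unfolding R_def by blast+
  obtain C1 where C1: "\<And>x::'a. x \<in> space ball_measure \<Longrightarrow> \<bar>\<eta> (x \<bullet> x)\<bar> \<le> C1" using radial_meas_bounded(2)[OF cont\<eta>] by blast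
  obtain C2 where C2: "\<And>x::'a. x \<in> space ball_measure \<Longrightarrow> \<bar>c (x \<bullet> x)\<bar> \<le> C2" using radial_meas_bounded(2)[OF cont] by blast
  define \<psi> where "\<psi> n x = P n (x \<bullet> x) * \<phi> n x" for n x
  have gP: "grad (\<lambda>x::'a. P n (x \<bullet> x)) x = (2 * p n (x \<bullet> x)) *\<^sub>R x" for n x
    by (rule grad_radial[of "P n" "p n"]) (rule P(1))
  have pm: "(\<lambda>x::'a. p n (x \<bullet> x)) \<in> borel_measurable ball_measure" for n
    by (rule radial_meas_bounded(1)[OF P(6)])
  have Pm: "(\<lambda>x::'a. P n (x \<bullet> x)) \<in> borel_measurable ball_measure" for n
    by (rule borel_imp_lebesgue_on[OF borel_measurable_continuous_onI[OF smooth_on_continuous[OF P(5)]]])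
  have sm: "smooth_on UNIV (\<psi> n)" for n unfolding \<psi>_def by (rule smooth_on_mult[OF P(5) \<phi>s(1)])
  have l1: "l2_lim ball_measure \<psi> (\<lambda>x. \<eta> (x \<bullet> x) * u x)"
  proof -
    have "\<psi> = (\<lambda>n x. P n (x \<bullet> x) *\<^sub>R \<phi> n x)"
      by (intro ext) (simp only: \<psi>_def real_scaleR_def)
    then show ?thesis
      using l2_lim_uniform_mult[OF \<phi>s(2) radial_meas_bounded(1)[OF cont\<eta>] C1 Pm P(3)[OF in1] e(1,2)]
      by (simp only: real_scaleR_def)
  qed
  have gr: "grad (\<psi> n) = (\<lambda>x. P n (x \<bullet> x) *\<^sub>R grad (\<phi> n) x + 2 *\<^sub>R (p n (x \<bullet> x) *\<^sub>R (\<phi> n x *\<^sub>R x)))" for n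
  proof
    fix x
    show "grad (\<psi> n) x = P n (x \<bullet> x) *\<^sub>R grad (\<phi> n) x + 2 *\<^sub>R (p n (x \<bullet> x) *\<^sub>R (\<phi> n x *\<^sub>R x))"
      unfolding \<psi>_def grad_mult[OF P(5) \<phi>s(1)] gP by (simp add: mult.commute)
  qed
  have l2a: "l2_lim ball_measure (\<lambda>n x. P n (x \<bullet> x) *\<^sub>R grad (\<phi> n) x) (\<lambda>x. \<eta> (x \<bullet> x) *\<^sub>R U x)"
    by (rule l2_lim_uniform_mult[OF \<phi>s(3) radial_meas_bounded(1)[OF cont\<eta>] C1 Pm P(3)[OF in1] e(1,2)])
  have "l2_lim ball_measure (\<lambda>n x. \<phi> n x *\<^sub>R x) (\<lambda>x. u x *\<^sub>R x)"
  proof (rule l2_lim_bound[OF \<phi>s(2), where C = 1])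
    have le: "norm (h x *\<^sub>R x) \<le> 1 * norm (h x)" if "x \<in> space ball_measure" for h :: "'a \<Rightarrow> real" and x
      using norm_le_1_ball_measure[OF that] by (simp add: mult_left_le)
    have m: "square_integrable ball_measure h \<Longrightarrow> (\<lambda>x. h x *\<^sub>R x) \<in> borel_measurable ball_measure" for h :: "'a \<Rightarrow> real"
      by (intro borel_measurable_scaleR square_integrable_meas id_meas_ball)
    show "square_integrable ball_measure (\<lambda>x. \<phi> n x *\<^sub>R x)" for n
      by (rule l2_mono(1)[OF l2_limD(1)[OF \<phi>s(2)] m[OF l2_limD(1)[OF \<phi>s(2)]] _ le[where h = "\<phi> n"]]) auto
    show "square_integrable ball_measure (\<lambda>x. u x *\<^sub>R x)"
      by (rule l2_mono(1)[OF l2_limD(2)[OF \<phi>s(2)] m[OF l2_limD(2)[OF \<phi>s(2)]] _ le[where h = u]]) auto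
    show "l2 ball_measure (\<lambda>x. \<phi> n x *\<^sub>R x - u x *\<^sub>R x) \<le> 1 * l2 ball_measure (\<lambda>x. \<phi> n x - u x)" for n
    proof -
      have d: "square_integrable ball_measure (\<lambda>x. \<phi> n x - u x)"
        by (intro square_integrable_diff l2_limD[OF \<phi>s(2)])
      show ?thesis
        unfolding scaleR_diff_left[symmetric] by (rule l2_mono(2)[OF d m[OF d] _ le[where h = "\<lambda>x. \<phi> n x - u x"]]) auto
    qed
  qed
  then have "l2_lim ball_measure (\<lambda>n x. p n (x \<bullet> x) *\<^sub>R (\<phi> n x *\<^sub>R x)) (\<lambda>x. c (x \<bullet> x) *\<^sub>R (u x *\<^sub>R x))"
    by (rule l2_lim_uniform_mult[OF _ radial_meas_bounded(1)[OF cont] C2 pm P(4)[OF in1] e(1,2)])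
  from l2_lim_add[OF l2a l2_lim_scaleR[OF this, of 2]]
  have l2: "l2_lim ball_measure (\<lambda>n. grad (\<psi> n)) (\<lambda>x. \<eta> (x \<bullet> x) *\<^sub>R U x + (2 * c (x \<bullet> x) * u x) *\<^sub>R x)"
    unfolding gr by (simp add: mult.assoc)
  have l3: "l2_lim sphere_measure \<psi> (\<lambda>x. \<eta> 1 * f x)"
  proof -
    have "\<psi> n x = \<eta> 1 * \<phi> n x" if "x \<in> space sphere_measure" for n x
    proof -
      have "x \<bullet> x = 1" using that by (simp add: norm_eq_1)
      then show ?thesis by (simp add: \<psi>_def P(2))
    qed
    then have "l2 sphere_measure (\<lambda>x. \<psi> n x - \<eta> 1 * f x) = l2 sphere_measure (\<lambda>x. \<eta> 1 * \<phi> n x - \<eta> 1 * f x)" for n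
      by (intro l2_cong) auto
    then show ?thesis
      using l2_lim_cmult[OF \<phi>(2), of "\<eta> 1"] sm unfolding l2_lim_def by (auto intro: smooth_square_integrable)
  qed
  show ?thesis by (rule ball_traceI[OF _ l3]) (use sm l1 l2 in \<open>auto simp: h1_lim_def\<close>)
qed

section \<open>Weakly harmonic functions\<close>

definition weakly_harmonic :: "('a::euclidean_space \<Rightarrow> 'a) \<Rightarrow> bool" where
  "weakly_harmonic U \<longleftrightarrow> (\<forall>w W. ball_trace w W (\<lambda>_. 0) \<longrightarrow> (LINT x|ball_measure. U x \<bullet> W x) = 0)"

text \<open>Written with the midpoint because the midpoint of two competitors with trace
  \<open>f\<close> is again a competitor; a minimising sequence of gradients is then Cauchy.\<close>

lemma l2_parallelogram:
  assumes "square_integrable M U" "square_integrable M V"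
  shows "(l2 M (\<lambda>x. U x - V x))\<^sup>2 = 2 * (l2 M U)\<^sup>2 + 2 * (l2 M V)\<^sup>2 - 4 * (l2 M (\<lambda>x. (1/2) *\<^sub>R (U x + V x)))\<^sup>2"
proof -
  have i: "integrable M (\<lambda>x. U x \<bullet> U x)" "integrable M (\<lambda>x. U x \<bullet> V x)" "integrable M (\<lambda>x. V x \<bullet> V x)"
    using assms by (auto intro: square_integrable_inner)
  have "(l2 M (\<lambda>x. U x - V x))\<^sup>2 = (LINT x|M. U x \<bullet> U x - 2 * (U x \<bullet> V x) + V x \<bullet> V x)"
    unfolding l2_sq by (intro Bochner_Integration.integral_cong) (auto simp: power2_norm_eq_inner algebra_simps inner_commute)
  also have "\<dots> = (LINT x|M. U x \<bullet> U x) - 2 * (LINT x|M. U x \<bullet> V x) + (LINT x|M. V x \<bullet> V x)"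
    using i by simp
  finally have 1: "(l2 M (\<lambda>x. U x - V x))\<^sup>2 = (LINT x|M. U x \<bullet> U x) - 2 * (LINT x|M. U x \<bullet> V x) + (LINT x|M. V x \<bullet> V x)" .
  have "(l2 M (\<lambda>x. U x + V x))\<^sup>2 = (LINT x|M. U x \<bullet> U x + 2 * (U x \<bullet> V x) + V x \<bullet> V x)"
    unfolding l2_sq by (intro Bochner_Integration.integral_cong) (auto simp: power2_norm_eq_inner algebra_simps inner_commute)
  also have "\<dots> = (LINT x|M. U x \<bullet> U x) + 2 * (LINT x|M. U x \<bullet> V x) + (LINT x|M. V x \<bullet> V x)"
    using i by simp
  finally have 2: "(l2 M (\<lambda>x. U x + V x))\<^sup>2 = (LINT x|M. U x \<bullet> U x) + 2 * (LINT x|M. U x \<bullet> V x) + (LINT x|M. V x \<bullet> V x)" .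
  have 3: "(l2 M U)\<^sup>2 = (LINT x|M. U x \<bullet> U x)" "(l2 M V)\<^sup>2 = (LINT x|M. V x \<bullet> V x)"
    by (simp_all add: l2_sq power2_norm_eq_inner)
  show ?thesis
    unfolding l2_scaleR power_mult_distrib 1 2 3 by (simp add: power2_eq_square field_simps)
qed

lemma ball_trace_smooth_approximation:
  assumes u: "ball_trace u U f" and e: "0 < e"
  obtains \<psi> where "smooth_on UNIV \<psi>" "l2 ball_measure (\<lambda>x. grad \<psi> x - U x) < e"
    "l2 sphere_measure (\<lambda>x. \<psi> x - f x) < e"
proof -
  obtain \<phi> where \<phi>: "h1_lim \<phi> u U" "l2_lim sphere_measure \<phi> f" using u unfolding ball_trace_iff by blast
  have "\<forall>\<^sub>F n in sequentially. l2 ball_measure (\<lambda>x. grad (\<phi> n) x - U x) < e \<and> l2 sphere_measure (\<lambda>x. \<phi> n x - f x) < e"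
    using e order_tendstoD(2)[OF l2_limD(3)[OF h1_limD(3)[OF \<phi>(1)]]] order_tendstoD(2)[OF l2_limD(3)[OF \<phi>(2)]]
    by (intro eventually_conj) auto
  then obtain n where "l2 ball_measure (\<lambda>x. grad (\<phi> n) x - U x) < e \<and> l2 sphere_measure (\<lambda>x. \<phi> n x - f x) < e"
    by (auto simp: eventually_sequentially)
  then show thesis using that[of "\<phi> n"] h1_limD(1)[OF \<phi>(1)] by blast
qed

text \<open>Dirichlet's principle. The minimising sequence is replaced by smooth functions whose
  boundary values merely approach \<open>f\<close>. The Poincare inequality with boundary term still
  makes them Cauchy, so approximation with a fixed trace is avoided.\<close>

theorem Dirichlet_problem:
  fixes f :: "'a::euclidean_space \<Rightarrow> real"
  assumes tr: "ball_trace v V f" and dim: "2 \<le> DIM('a)"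
  obtains H DH where "ball_trace H DH f" "weakly_harmonic DH"
proof -
  define S where "S = {(l2 ball_measure U)\<^sup>2 | u U. ball_trace u U f}"
  define m where "m = Inf S"
  have bdd: "bdd_below S" unfolding S_def bdd_below_def by (intro exI[of _ 0]) auto
  have ne: "S \<noteq> {}" using tr unfolding S_def by blast
  have m_le: "m \<le> (l2 ball_measure U)\<^sup>2" if "ball_trace u U f" for u U
    unfolding m_def using that by (intro cInf_lower bdd) (auto simp: S_def)
  have m0: "m \<ge> 0" unfolding m_def by (intro cInf_greatest ne) (auto simp: S_def)
  define e where "e n = inverse (real (Suc n))" for n
  have e: "0 < e n" for n by (simp add: e_def)
  have e_lim: "e \<longlonglongrightarrow> 0" unfolding e_def by (rule LIMSEQ_inverse_real_of_nat)
  have e_mono: "e n \<le> e N" if "N \<le> n" for n N using that by (simp add: e_def)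
  \<comment> \<open>Each near-minimiser \<open>U\<close> is paired with a smooth
    \<open>\<psi>\<close> close to it in gradient and close to \<open>f\<close> on the
    sphere.\<close>
  define R where "R n U \<psi> \<longleftrightarrow> (\<exists>u. ball_trace u U f) \<and> (l2 ball_measure U)\<^sup>2 < m + e n \<and> smooth_on UNIV \<psi> \<and>
      l2 ball_measure (\<lambda>x. grad \<psi> x - U x) < e n \<and> l2 sphere_measure (\<lambda>x. \<psi> x - f x) < e n" for n U \<psi>
  have "\<exists>q. R n (fst q) (snd q)" for n
  proof -
    obtain s where "s \<in> S" "s < m + e n"
      using cInf_lessD[OF ne, of "m + e n"] e[of n] unfolding m_def by auto
    then obtain u U where u: "ball_trace u U f" "(l2 ball_measure U)\<^sup>2 < m + e n" unfolding S_def by blast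
    obtain \<psi> where "smooth_on UNIV \<psi>" "l2 ball_measure (\<lambda>x. grad \<psi> x - U x) < e n"
      "l2 sphere_measure (\<lambda>x. \<psi> x - f x) < e n"
      by (rule ball_trace_smooth_approximation[OF u(1) e[of n]])
    with u have "R n U \<psi>" unfolding R_def by blast
    then show ?thesis by (intro exI[of _ "(U, \<psi>)"]) simp
  qed
  then obtain q where q: "R n (fst (q n)) (snd (q n))" for n
    using choice[of "\<lambda>n q. R n (fst q) (snd q)"] by blast
  define U where "U n = fst (q n)" for n
  define \<psi> where "\<psi> n = snd (q n)" for n
  have Rn: "R n (U n) (\<psi> n)" for n using q by (simp add: U_def \<psi>_def)
  have U: "\<exists>u. ball_trace u (U n) f" "(l2 ball_measure (U n))\<^sup>2 < m + e n"
    and \<psi>: "smooth_on UNIV (\<psi> n)" "l2 ball_measure (\<lambda>x. grad (\<psi> n) x - U n x) < e n"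
      "l2 sphere_measure (\<lambda>x. \<psi> n x - f x) < e n" for n
    using Rn[of n] unfolding R_def by blast+
  have sqU: "square_integrable ball_measure (U n)" for n using U(1) ball_traceD(2) by blast
  have sqf: "square_integrable sphere_measure f" using ball_traceD(3)[OF tr] .
  note sq\<psi> = smooth_square_integrable[OF \<psi>(1)]
  have UU: "l2 ball_measure (\<lambda>x. U n x - U k x) \<le> 2 * sqrt (e N)" if "N \<le> n" "N \<le> k" for n k N
  proof -
    obtain u u' where "ball_trace u (U n) f" "ball_trace u' (U k) f" using U(1) by metis
    from ball_trace_cmult[OF ball_trace_add[OF this], of "1/2"]
    have "ball_trace (\<lambda>x. 1/2 * (u x + u' x)) (\<lambda>x. (1/2) *\<^sub>R (U n x + U k x)) f" by simp
    note m_le[OF this]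
    moreover have "2 * a + 2 * b - 4 * c \<le> 2 * (m + e n) + 2 * (m + e k) - 4 * m"
      if "m \<le> c" "a < m + e n" "b < m + e k" for a b c
    proof -
      have "2 * a + 2 * b + 4 * m \<le> 2 * (m + e n) + 2 * (m + e k) + 4 * c"
        by (intro add_mono mult_left_mono) (use that in auto)
      then show ?thesis by (simp add: algebra_simps)
    qed
    ultimately have "(l2 ball_measure (\<lambda>x. U n x - U k x))\<^sup>2 \<le> 2 * (m + e n) + 2 * (m + e k) - 4 * m"
      unfolding l2_parallelogram[OF sqU sqU] using U(2) by blast
    also have "\<dots> \<le> (2 * sqrt (e N))\<^sup>2"
      using e_mono[OF that(1)] e_mono[OF that(2)] e[of N] by (simp add: power_mult_distrib)
    finally show ?thesis by (rule power2_le_imp_le) (use e[of N] in simp)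
  qed
  \<comment> \<open>The boundary distance \<open>2 * e N\<close> plus the gradient distance
    \<open>2 * e N + 2 * sqrt (e N)\<close>; its square exceeds the sum of their squares, as the
    Poincare inequality requires.\<close>
  define d where "d N = 4 * e N + 2 * sqrt (e N)" for N
  have d_lim: "d \<longlonglongrightarrow> 0"
    unfolding d_def using tendsto_add[OF tendsto_mult_left[OF e_lim, of 4] tendsto_mult_left[OF tendsto_real_sqrt[OF e_lim], of 2]] by simp
  have grd: "grad (\<lambda>x. \<psi> n x - \<psi> k x) = (\<lambda>x. grad (\<psi> n) x - grad (\<psi> k) x)" for n k
    by (rule ext, rule grad_diff) (rule \<psi>)+
  have GG: "l2 ball_measure (\<lambda>x. grad (\<psi> n) x - grad (\<psi> k) x) \<le> 2 * e N + 2 * sqrt (e N)" if "N \<le> n" "N \<le> k" for n k N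
  proof -
    have "l2 ball_measure (\<lambda>x. grad (\<psi> n) x - grad (\<psi> k) x)
       \<le> l2 ball_measure (\<lambda>x. grad (\<psi> n) x - U n x) + l2 ball_measure (\<lambda>x. U n x - grad (\<psi> k) x)"
      by (intro l2_triangle_diff sq\<psi> sqU)
    also have "l2 ball_measure (\<lambda>x. U n x - grad (\<psi> k) x)
       \<le> l2 ball_measure (\<lambda>x. U n x - U k x) + l2 ball_measure (\<lambda>x. U k x - grad (\<psi> k) x)"
      by (intro l2_triangle_diff sq\<psi> sqU)
    finally show ?thesis
      using UU[OF that] \<psi>(2)[of n] \<psi>(2)[of k] e_mono[OF that(1)] e_mono[OF that(2)]
      unfolding l2_minus_commute[of ball_measure "U k"] by linarith
  qed
  have PP: "l2 ball_measure (\<lambda>x. \<psi> n x - \<psi> k x) \<le> d N" if "N \<le> n" "N \<le> k" for n k N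
  proof -
    have S: "l2 sphere_measure (\<lambda>x. \<psi> n x - \<psi> k x) \<le> 2 * e N"
      using l2_triangle_diff[OF sq\<psi>(3) sqf sq\<psi>(3), of n k] \<psi>(3)[of n] \<psi>(3)[of k] e_mono[OF that(1)] e_mono[OF that(2)]
      unfolding l2_minus_commute[of sphere_measure f] by linarith
    have "1 * (l2 ball_measure (\<lambda>x. \<psi> n x - \<psi> k x))\<^sup>2 \<le> (real DIM('a) - 1) * (l2 ball_measure (\<lambda>x. \<psi> n x - \<psi> k x))\<^sup>2"
      using dim by (intro mult_right_mono) auto
    also have "\<dots> \<le> (l2 sphere_measure (\<lambda>x. \<psi> n x - \<psi> k x))\<^sup>2 + (l2 ball_measure (\<lambda>x. grad (\<psi> n) x - grad (\<psi> k) x))\<^sup>2"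
      using smooth_Poincare[OF smooth_on_diff[OF \<psi>(1) \<psi>(1)], of n k] unfolding grd .
    also have "\<dots> \<le> (2 * e N)\<^sup>2 + (2 * e N + 2 * sqrt (e N))\<^sup>2"
      by (intro add_mono power_mono S GG that) auto
    also have "\<dots> \<le> (d N)\<^sup>2"
    proof -
      have "0 \<le> 2 * e N * (2 * e N + 2 * sqrt (e N))" using e[of N] by simp
      then show ?thesis by (simp add: d_def power2_eq_square algebra_simps)
    qed
    finally have "(l2 ball_measure (\<lambda>x. \<psi> n x - \<psi> k x))\<^sup>2 \<le> (d N)\<^sup>2" by simp
    then show ?thesis by (rule power2_le_imp_le) (use e[of N] in \<open>simp add: d_def\<close>)
  qed
  have dC: "l2_Cauchy M F" if "\<And>n k N. N \<le> n \<Longrightarrow> N \<le> k \<Longrightarrow> l2 M (\<lambda>x. F n x - F k x) \<le> d N"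
    for M :: "'a measure" and F :: "nat \<Rightarrow> 'a \<Rightarrow> 'b::euclidean_space"
    unfolding l2_Cauchy_def
  proof (intro allI impI)
    fix r :: real assume "r > 0"
    then obtain N where "d N < r"
      using order_tendstoD(2)[OF d_lim] by (auto simp: eventually_sequentially)
    then show "\<exists>N. \<forall>m\<ge>N. \<forall>n\<ge>N. l2 M (\<lambda>x. F m x - F n x) < r"
      using that le_less_trans by (intro exI[of _ N]) blast
  qed
  have "l2_Cauchy ball_measure \<psi>" by (rule dC) (rule PP)
  moreover have "l2_Cauchy ball_measure (\<lambda>n. grad (\<psi> n))"
  proof (rule dC)
    fix n k N :: nat assume "N \<le> n" "N \<le> k"
    from GG[OF this] show "l2 ball_measure (\<lambda>x. grad (\<psi> n) x - grad (\<psi> k) x) \<le> d N"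
      unfolding d_def using e[of N] by linarith
  qed
  ultimately obtain H DH where H: "h1_lim \<psi> H DH" by (rule h1_limit_exists[OF \<psi>(1)])
  have "(\<lambda>n. l2 sphere_measure (\<lambda>x. \<psi> n x - f x)) \<longlonglongrightarrow> 0"
  proof (rule Lim_null_comparison[OF always_eventually e_lim], rule allI)
    show "norm (l2 sphere_measure (\<lambda>x. \<psi> n x - f x)) \<le> e n" for n using \<psi>(3)[of n] by simp
  qed
  then have Hf: "ball_trace H DH f"
    by (intro ball_traceI[OF H]) (auto simp: l2_lim_def sq\<psi> sqf)
  have "l2 ball_measure DH \<le> sqrt (m + 0) + 0"
  proof (rule LIMSEQ_le[OF l2_lim_norm[OF h1_limD(3)[OF H]]])
    show "(\<lambda>n. sqrt (m + e n) + e n) \<longlonglongrightarrow> sqrt (m + 0) + 0"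
      by (intro tendsto_intros e_lim)
    have "l2 ball_measure (grad (\<psi> n)) \<le> sqrt (m + e n) + e n" for n
    proof -
      have "l2 ball_measure (U n) \<le> sqrt (m + e n)"
        using U(2)[of n] by (intro real_le_rsqrt) simp
      moreover have "l2 ball_measure (\<lambda>x. grad (\<psi> n) x - 0) \<le> l2 ball_measure (\<lambda>x. grad (\<psi> n) x - U n x) + l2 ball_measure (\<lambda>x. U n x - 0)"
        by (intro l2_triangle_diff sq\<psi> sqU square_integrable_zero)
      ultimately show ?thesis using \<psi>(2)[of n] by simp
    qed
    then show "\<exists>N. \<forall>n\<ge>N. l2 ball_measure (grad (\<psi> n)) \<le> sqrt (m + e n) + e n" by blast
  qed
  then have "(l2 ball_measure DH)\<^sup>2 \<le> (sqrt m)\<^sup>2" by (intro power_mono) auto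
  then have min: "(l2 ball_measure DH)\<^sup>2 \<le> m" using m0 by simp
  have "weakly_harmonic DH"
    unfolding weakly_harmonic_def
  proof (intro allI impI)
    fix w :: "'a \<Rightarrow> real" and W :: "'a \<Rightarrow> 'a" assume w: "ball_trace w W (\<lambda>_. 0)"
    note sq = ball_traceD(2)[OF Hf] ball_traceD(2)[OF w]
    define B C where "B = (LINT x|ball_measure. W x \<bullet> W x)" and "C = (LINT x|ball_measure. DH x \<bullet> W x)"
    have B: "0 \<le> B" unfolding B_def by (intro Bochner_Integration.integral_nonneg) auto
    have q: "0 \<le> 2 * t * C + t\<^sup>2 * B" for t
    proof -
      have "ball_trace (\<lambda>x. H x + t * w x) (\<lambda>x. DH x + t *\<^sub>R W x) f"
        using ball_trace_add[OF Hf ball_trace_cmult[OF w, of t]] by simp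
      from m_le[OF this] min
      have "(l2 ball_measure DH)\<^sup>2 \<le> (l2 ball_measure (\<lambda>x. DH x + t *\<^sub>R W x))\<^sup>2" by linarith
      also have "\<dots> = (LINT x|ball_measure. DH x \<bullet> DH x + 2 * t * (DH x \<bullet> W x) + t\<^sup>2 * (W x \<bullet> W x))"
        unfolding l2_sq power2_norm_eq_inner by (intro Bochner_Integration.integral_cong)
          (auto simp: algebra_simps inner_commute power2_eq_square)
      also have "\<dots> = (l2 ball_measure DH)\<^sup>2 + 2 * t * C + t\<^sup>2 * B"
        unfolding l2_sq power2_norm_eq_inner B_def C_def using sq by (simp add: square_integrable_inner)
      finally show ?thesis by simp
    qed
    have "C = 0"
    proof (rule ccontr)
      assume "C \<noteq> 0"
      \<comment> \<open>With \<open>B + 1\<close> in place of \<open>B\<close> in the optimal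
        \<open>t\<close>, the quadratic becomes negative without a separate case
        \<open>B = 0\<close>.\<close>
      have "0 \<le> (2 * (- C / (B + 1)) * C + (- C / (B + 1))\<^sup>2 * B) * (B + 1)\<^sup>2"
        using q[of "- C / (B + 1)"] by (intro mult_nonneg_nonneg) auto
      also have "\<dots> = - (C\<^sup>2 * (B + 2))"
        using B by (simp add: field_simps power2_eq_square add_nonneg_eq_0_iff)
      finally have "C\<^sup>2 * (B + 2) \<le> 0" by simp
      then show False using \<open>C \<noteq> 0\<close> B by (simp add: mult_le_0_iff)
    qed
    then show "(LINT x|ball_measure. DH x \<bullet> W x) = 0" by (simp add: C_def)
  qed
  with Hf show thesis by (rule that)
qed

section \<open>Averages of harmonic functions along rays\<close>

text \<open>
  For \<open>J = ray_mean j f\<close>, inserting \<open>2 x \<bullet> \<nabla>J = f - (j + 1) J\<close> into Green's formula bounds \<open>J\<close> by \<open>f\<close>,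
  because the boundary term has a sign.
\<close>

lemma l2_ray_mean_le:
  fixes f :: "'a::euclidean_space \<Rightarrow> real"
  assumes s: "smooth_on UNIV f" and j: "DIM('a) \<le> j"
  shows "l2 ball_measure (ray_mean j f) \<le> l2 ball_measure f"
proof -
  let ?J = "ray_mean j f"
  have sJ: "smooth_on UNIV ?J" by (rule smooth_on_ray_mean[OF s])
  have i: "integrable ball_measure (\<lambda>x. ?J x * f x)" "integrable ball_measure (\<lambda>x. ?J x * ?J x)"
    by (intro square_integrable_mult smooth_square_integrable s sJ)+
  have "2 * (LINT x|ball_measure. ?J x * (grad ?J x \<bullet> x)) = (LINT x|ball_measure. ?J x * (2 * (grad ?J x \<bullet> x)))"
    by (subst integral_mult_right_zero[symmetric]) (simp add: mult_ac)
  also have "\<dots> = (LINT x|ball_measure. ?J x * f x - (real j + 1) * (?J x * ?J x))"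
    unfolding radial_derivative_ray_mean[OF s] by (intro Bochner_Integration.integral_cong) (auto simp: algebra_simps)
  also have "\<dots> = (LINT x|ball_measure. ?J x * f x) - (real j + 1) * (l2 ball_measure ?J)\<^sup>2"
    unfolding l2_sq using i by (simp add: power2_eq_square)
  finally have "(real j + 1 - DIM('a)) * (l2 ball_measure ?J)\<^sup>2 \<le> (LINT x|ball_measure. ?J x * f x)"
    using smooth_green[OF sJ] zero_le_power2[of "l2 sphere_measure ?J"]
    unfolding left_diff_distrib by linarith
  also have "\<dots> \<le> l2 ball_measure ?J * l2 ball_measure f"
    using l2_Cauchy_Schwarz[OF smooth_square_integrable(1)[OF sJ] smooth_square_integrable(1)[OF s]] by simp
  finally have 1: "(real j + 1 - DIM('a)) * (l2 ball_measure ?J)\<^sup>2 \<le> l2 ball_measure ?J * l2 ball_measure f" .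
  have "1 * (l2 ball_measure ?J)\<^sup>2 \<le> (real j + 1 - DIM('a)) * (l2 ball_measure ?J)\<^sup>2"
    using j by (intro mult_right_mono) auto
  with 1 have "l2 ball_measure ?J * l2 ball_measure ?J \<le> l2 ball_measure ?J * l2 ball_measure f"
    by (simp add: power2_eq_square)
  then show ?thesis
    by (cases "l2 ball_measure ?J = 0") (auto simp: mult_le_cancel_left less_le)
qed

lemma l2_components:
  fixes U :: "'b \<Rightarrow> 'a::euclidean_space"
  assumes "square_integrable M U"
  shows "(l2 M U)\<^sup>2 = (\<Sum>b\<in>Basis. (l2 M (\<lambda>x. U x \<bullet> b))\<^sup>2)"
proof -
  have "(l2 M U)\<^sup>2 = (LINT x|M. (\<Sum>b\<in>Basis. (U x \<bullet> b)\<^sup>2))"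
    unfolding l2_sq power2_norm_eq_inner
    by (intro Bochner_Integration.integral_cong refl) (subst euclidean_inner, simp add: power2_eq_square)
  also have "\<dots> = (\<Sum>b\<in>Basis. (LINT x|M. (U x \<bullet> b)\<^sup>2))"
  proof (rule Bochner_Integration.integral_sum)
    fix b :: 'a
    have "square_integrable M (\<lambda>x. U x \<bullet> b)"
      by (rule square_integrable_inner_right[OF assms, where C = "norm b"]) auto
    then show "integrable M (\<lambda>x. (U x \<bullet> b)\<^sup>2)" by (simp add: square_integrable_def)
  qed
  finally show ?thesis by (simp add: l2_sq)
qed

text \<open>Componentwise from the preceding bound: each partial derivative of the average is the
  average, with exponent \<open>j + 2\<close>, of that partial derivative.\<close>

lemma l2_grad_ray_mean_le:
  fixes f :: "'a::euclidean_space \<Rightarrow> real"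
  assumes s: "smooth_on UNIV f" and j: "DIM('a) \<le> j"
  shows "l2 ball_measure (grad (ray_mean j f)) \<le> l2 ball_measure (grad f)"
proof (rule power2_le_imp_le)
  have "l2 ball_measure (\<lambda>x. grad (ray_mean j f) x \<bullet> b) \<le> l2 ball_measure (\<lambda>x. grad f x \<bullet> b)" for b
  proof -
    have "(\<lambda>x. grad (ray_mean j f) x \<bullet> b) = ray_mean (j + 2) (\<lambda>x. grad f x \<bullet> b)"
      by (rule ext) (rule grad_ray_mean[OF s])
    then show ?thesis using l2_ray_mean_le[OF smooth_on_grad[OF s], of "j + 2" b] j by simp
  qed
  then show "(l2 ball_measure (grad (ray_mean j f)))\<^sup>2 \<le> (l2 ball_measure (grad f))\<^sup>2"
    unfolding l2_components[OF smooth_square_integrable(2)[OF s]]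
      l2_components[OF smooth_square_integrable(2)[OF smooth_on_ray_mean[OF s]]]
    by (intro sum_mono power_mono) auto
qed simp

text \<open>The average is linear and a contraction for both norms, so it preserves Cauchy
  sequences. For an H^1 function, given only almost everywhere, its average along rays is this
  limit.\<close>

lemma h1_lim_ray_mean:
  fixes \<phi> :: "nat \<Rightarrow> 'a::euclidean_space \<Rightarrow> real"
  assumes h: "h1_lim \<phi> u U" and j: "DIM('a) \<le> j"
  obtains w W where "h1_lim (\<lambda>n. ray_mean j (\<phi> n)) w W"
proof (rule h1_limit_exists)
  note hs = h1_limD[OF h]
  show s: "smooth_on UNIV (ray_mean j (\<phi> n))" for n by (rule smooth_on_ray_mean[OF hs(1)])
  have d: "(\<lambda>x. ray_mean j (\<phi> m) x - ray_mean j (\<phi> n) x) = ray_mean j (\<lambda>x. \<phi> m x - \<phi> n x)" for m n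
    by (rule ext) (simp add: ray_mean_diff[OF smooth_on_continuous[OF hs(1)] smooth_on_continuous[OF hs(1)]])
  have sd: "smooth_on UNIV (\<lambda>x. \<phi> m x - \<phi> n x)" for m n by (rule smooth_on_diff[OF hs(1) hs(1)])
  show "l2_Cauchy ball_measure (\<lambda>n. ray_mean j (\<phi> n))"
    by (rule l2_Cauchy_bound[OF l2_lim_Cauchy[OF hs(2)], where C = 1])
       (use l2_ray_mean_le[OF sd j] in \<open>simp add: d\<close>)
  have g: "(\<lambda>x. grad (ray_mean j (\<phi> m)) x - grad (ray_mean j (\<phi> n)) x) = grad (ray_mean j (\<lambda>x. \<phi> m x - \<phi> n x))" for m n
    unfolding d[symmetric] by (rule ext) (simp add: grad_diff[OF s s])
  have g': "(\<lambda>x. grad (\<phi> m) x - grad (\<phi> n) x) = grad (\<lambda>x. \<phi> m x - \<phi> n x)" for m n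
    by (rule ext) (simp add: grad_diff[OF hs(1) hs(1)])
  show "l2_Cauchy ball_measure (\<lambda>n. grad (ray_mean j (\<phi> n)))"
    by (rule l2_Cauchy_bound[OF l2_lim_Cauchy[OF hs(3)], where C = 1])
       (use l2_grad_ray_mean_le[OF sd j] in \<open>simp add: g g'\<close>)
qed (rule that)

lemma l2_lim_unique_AE:
  assumes "l2_lim M F f" "l2_lim M F g"
  shows "AE x in M. f x = g x"
proof -
  note F = l2_limD[OF assms(1)] and G = l2_limD[OF assms(2)]
  have "l2_lim M (\<lambda>n x. F n x - F n x) (\<lambda>x. f x - g x)" by (rule l2_lim_diff[OF assms])
  from l2_lim_norm[OF this] have "l2 M (\<lambda>x. f x - g x) = 0"
    by (simp add: l2_def LIMSEQ_const_iff)
  then have "(LINT x|M. (norm (f x - g x))\<^sup>2) = 0" by (simp add: l2_def)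
  then have "AE x in M. (norm (f x - g x))\<^sup>2 = 0"
    by (subst (asm) integral_nonneg_eq_0_iff_AE)
       (auto intro!: square_integrable_norm_sq square_integrable_diff F G)
  then show ?thesis by simp
qed

section \<open>Dilation of test functions and harmonicity of the averages\<close>

lemma integral_eq_lborel_indicator:
  fixes f :: "real \<Rightarrow> real"
  assumes "continuous_on {a..b} f"
  shows "integral {a..b} f = (LINT s|lborel. indicator {a..b} s * f s)"
proof -
  have "set_integrable lborel {a..b} f"
    unfolding set_integrable_def by (rule borel_integrable_compact) (use assms in auto)
  from set_borel_integral_eq_integral(2)[OF this] show ?thesis
    by (simp add: set_lebesgue_integral_def)
qed

lemma integral_ball_vanishing:
  fixes F :: "'a::euclidean_space \<Rightarrow> real"
  assumes "F \<in> borel_measurable borel" "\<And>x. 1 \<le> norm x \<Longrightarrow> F x = 0"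
  shows "(LINT x|ball_measure. F x) = (LINT x|lborel. F x)"
proof -
  have "(LINT x|ball_measure. F x) = (LINT x|lborel. indicator (ball 0 1) x * F x)"
    by (rule integral_ball_lborel) (use assms in auto)
  also have "\<dots> = (LINT x|lborel. F x)"
    by (intro Bochner_Integration.integral_cong refl) (use assms(2) in \<open>auto simp: indicator_def\<close>)
  finally show ?thesis .
qed

text \<open>The substitution moves the dilation from \<open>F\<close> to \<open>G\<close> and
  shrinks the ball to radius \<open>c\<close>. As \<open>G (y /\<^sub>R c)\<close> vanishes beyond
  that radius, the result is again an integral over the unit ball, where \<open>F\<close> can be
  compared with a harmonic gradient.\<close>

lemma integral_scaled_vanishing:
  fixes F G :: "'a::euclidean_space \<Rightarrow> 'a"
  assumes F: "continuous_on UNIV F" and G: "continuous_on UNIV G" "\<And>x. 1 \<le> norm x \<Longrightarrow> G x = 0"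
    and c: "0 < c" "c \<le> 1"
  shows "c ^ DIM('a) * (LINT x|lborel. F (c *\<^sub>R x) \<bullet> G x) = (LINT y|ball_measure. F y \<bullet> G (y /\<^sub>R c))"
proof -
  have cont: "continuous_on UNIV (\<lambda>y. F y \<bullet> G (y /\<^sub>R c))"
    by (intro continuous_intros F continuous_on_compose2[OF G(1)]) (use c in auto)
  have "(LINT y|ball_measure. F y \<bullet> G (y /\<^sub>R c)) = (LINT y|lborel. F y \<bullet> G (y /\<^sub>R c))"
  proof (rule integral_ball_vanishing)
    fix y :: 'a assume "1 \<le> norm y"
    then have "1 \<le> norm (y /\<^sub>R c)" using c by (simp add: field_simps)
    then show "F y \<bullet> G (y /\<^sub>R c) = 0" by (simp only: G(2) inner_zero_right)
  qed (intro borel_measurable_continuous_onI cont)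
  also have "\<dots> = \<bar>c\<bar> ^ DIM('a) * (LINT x|lborel. F (c *\<^sub>R x) \<bullet> G ((c *\<^sub>R x) /\<^sub>R c))"
    by (rule integral_lborel_scale) (use c in \<open>auto intro!: borel_measurable_continuous_onI cont\<close>)
  finally show ?thesis using c by simp
qed

text \<open>Fubini expresses the pairing with an average through pairings with the dilates of
  \<open>grad f\<close>. Since \<open>G\<close> vanishes outside the ball, these are integrals over
  the whole space, ready for substitution.\<close>

lemma ray_mean_pairing:
  fixes f :: "'a::euclidean_space \<Rightarrow> real" and G :: "'a \<Rightarrow> 'a"
  assumes s: "smooth_on UNIV f" and G: "continuous_on UNIV G" "\<And>x. 1 \<le> norm x \<Longrightarrow> G x = 0"
  shows "(LINT x|ball_measure. grad (ray_mean j f) x \<bullet> G x)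
      = (LINT s|lborel. indicator {0..1} s * (s ^ (j + 2) * (LINT x|lborel. grad f (s\<^sup>2 *\<^sub>R x) \<bullet> G x)))" (is ?eq)
    "integrable lborel (\<lambda>s. indicator {0..1} s * (s ^ (j + 2) * (LINT x|lborel. grad f (s\<^sup>2 *\<^sub>R x) \<bullet> G x)))" (is ?int)
proof -
  define K where "K s x = indicator {0..1} s * (s ^ (j + 2) * (grad f (s\<^sup>2 *\<^sub>R x) \<bullet> G x))" for s :: real and x :: 'a
  note cg = continuous_on_grad[OF s]
  have contK: "continuous_on UNIV (\<lambda>p::real \<times> 'a. fst p ^ (j + 2) * (grad f ((fst p)\<^sup>2 *\<^sub>R snd p) \<bullet> G (snd p)))"
    by (intro continuous_intros continuous_on_compose2[OF cg] continuous_on_compose2[OF G(1)]) auto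
  have "integrable lborel (\<lambda>p::real \<times> 'a. indicator ({0..1} \<times> cball 0 1) p *\<^sub>R (fst p ^ (j + 2) * (grad f ((fst p)\<^sup>2 *\<^sub>R snd p) \<bullet> G (snd p))))"
    by (intro borel_integrable_compact compact_Times compact_cball continuous_on_subset[OF contK]) auto
  moreover have "indicator ({0..1} \<times> cball 0 1) p *\<^sub>R (fst p ^ (j + 2) * (grad f ((fst p)\<^sup>2 *\<^sub>R snd p) \<bullet> G (snd p))) = case_prod K p" for p
    using G(2)[of "snd p"] by (cases p) (auto simp: K_def indicator_def)
  ultimately have Ki: "integrable (lborel \<Otimes>\<^sub>M lborel) (case_prod K)"
    unfolding lborel_prod by simp
  have inner: "(LINT x|lborel. K s x) = indicator {0..1} s * (s ^ (j + 2) * (LINT x|lborel. grad f (s\<^sup>2 *\<^sub>R x) \<bullet> G x))" for s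
    by (simp add: K_def)
  show ?int using lborel_pair.integrable_fst'[OF Ki] by (simp add: inner)
  have "(LINT s|lborel. K s x) = grad (ray_mean j f) x \<bullet> G x" for x
  proof -
    have "grad (ray_mean j f) x \<bullet> G x = integral {0..1} (\<lambda>s. s ^ (j + 2) * (grad f (s\<^sup>2 *\<^sub>R x) \<bullet> G x))"
      by (simp only: grad_ray_mean[OF s] ray_mean_def)
    also have "\<dots> = (LINT s|lborel. K s x)"
      unfolding K_def
      by (intro integral_eq_lborel_indicator continuous_intros continuous_on_compose2[OF cg]) auto
    finally show ?thesis by simp
  qed
  moreover have "(LINT x|ball_measure. grad (ray_mean j f) x \<bullet> G x) = (LINT x|lborel. grad (ray_mean j f) x \<bullet> G x)"
    by (intro integral_ball_vanishing borel_measurable_continuous_onI continuous_intros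
        continuous_on_grad smooth_on_ray_mean s) (use G in auto)
  ultimately show ?eq
    using lborel_pair.Fubini_integral[OF Ki] by (simp add: inner)
qed

text \<open>
  Scaling by \<open>s\<^sup>2\<close> costs a factor \<open>s\<close> to the power \<open>-2 n\<close> in dimension \<open>n\<close>, and the hypothesis on \<open>j\<close>
  says that the weight of the average cancels it.
\<close>

lemma ray_mean_pairing_bound:
  fixes f :: "'a::euclidean_space \<Rightarrow> real" and G U :: "'a \<Rightarrow> 'a"
  assumes s: "smooth_on UNIV f" and G: "continuous_on UNIV G" "\<And>x. 1 \<le> norm x \<Longrightarrow> G x = 0"
    and U: "square_integrable ball_measure U"
    and orth: "\<And>r. 1 \<le> r \<Longrightarrow> (LINT y|ball_measure. U y \<bullet> G (r *\<^sub>R y)) = 0"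
    and C: "\<And>r. 1 \<le> r \<Longrightarrow> l2 ball_measure (\<lambda>y. G (r *\<^sub>R y)) \<le> C"
    and j: "2 * DIM('a) = j + 2"
  shows "\<bar>LINT x|ball_measure. grad (ray_mean j f) x \<bullet> G x\<bar> \<le> l2 ball_measure (\<lambda>x. grad f x - U x) * C"
proof -
  define D where "D = l2 ball_measure (\<lambda>x. grad f x - U x) * C"
  have C0: "0 \<le> C" using C[of 1] l2_nonneg order.trans by blast
  then have D0: "0 \<le> D" by (simp add: D_def)
  have bound: "\<bar>s ^ (j + 2) * (LINT x|lborel. grad f (s\<^sup>2 *\<^sub>R x) \<bullet> G x)\<bar> \<le> D" if "0 \<le> s" "s \<le> 1" for s
  proof (cases "s = 0")
    case False
    then have s2: "0 < s\<^sup>2" "s\<^sup>2 \<le> 1" using that by (auto simp: power_le_one)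
    have r: "1 \<le> inverse (s\<^sup>2)" using s2 by (simp add: one_le_inverse)
    have sqG: "square_integrable ball_measure (\<lambda>y. G (y /\<^sub>R s\<^sup>2))"
      by (intro square_integrable_continuous_ball continuous_on_compose2[OF G(1)] continuous_intros) auto
    have sqf: "square_integrable ball_measure (grad f)" by (rule smooth_square_integrable(2)[OF s])
    have "s ^ (j + 2) = (s\<^sup>2) ^ DIM('a)" unfolding j[symmetric] by (simp add: power_mult)
    then have "s ^ (j + 2) * (LINT x|lborel. grad f (s\<^sup>2 *\<^sub>R x) \<bullet> G x) = (LINT y|ball_measure. grad f y \<bullet> G (y /\<^sub>R s\<^sup>2))"
      using integral_scaled_vanishing[OF continuous_on_grad[OF s] G s2] by simp
    \<comment> \<open>By orthogonality \<open>U\<close> may be subtracted at no cost, so only the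
      distance between \<open>grad f\<close> and \<open>U\<close> survives.\<close>
    also have "\<dots> = (LINT y|ball_measure. grad f y \<bullet> G (y /\<^sub>R s\<^sup>2)) - (LINT y|ball_measure. U y \<bullet> G (y /\<^sub>R s\<^sup>2))"
      using orth[OF r] by simp
    also have "\<dots> = (LINT y|ball_measure. (grad f y - U y) \<bullet> G (y /\<^sub>R s\<^sup>2))"
      unfolding inner_diff_left
      by (rule Bochner_Integration.integral_diff[symmetric]) (intro square_integrable_inner sqG sqf U)+
    finally have "\<bar>s ^ (j + 2) * (LINT x|lborel. grad f (s\<^sup>2 *\<^sub>R x) \<bullet> G x)\<bar>
        \<le> l2 ball_measure (\<lambda>x. grad f x - U x) * l2 ball_measure (\<lambda>y. G (y /\<^sub>R s\<^sup>2))"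
      using l2_Cauchy_Schwarz[OF square_integrable_diff[OF sqf U] sqG] by simp
    also have "\<dots> \<le> D" unfolding D_def by (intro mult_left_mono C[OF r]) simp
    finally show ?thesis .
  qed (simp add: D0 j[symmetric])
  have "\<bar>LINT s|lborel. indicator {0..1} s * (s ^ (j + 2) * (LINT x|lborel. grad f (s\<^sup>2 *\<^sub>R x) \<bullet> G x))\<bar>
      \<le> (LINT s|lborel. indicator {0..1} (s::real) *\<^sub>R D)"
  proof (rule integral_abs_bound_integral)
    show "integrable lborel (\<lambda>s. indicator {0..1} s * (s ^ (j + 2) * (LINT x|lborel. grad f (s\<^sup>2 *\<^sub>R x) \<bullet> G x)))"
      by (rule ray_mean_pairing(2)[OF s G])
    show "integrable lborel (\<lambda>s::real. indicator {0..1} s *\<^sub>R D)"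
      by (intro borel_integrable_compact) auto
    show "\<bar>indicator {0..1} s * (s ^ (j + 2) * (LINT x|lborel. grad f (s\<^sup>2 *\<^sub>R x) \<bullet> G x))\<bar> \<le> indicator {0..1} s *\<^sub>R D" for s :: real
      using bound[of s] by (auto simp: indicator_def)
  qed
  then show ?thesis by (simp add: D_def ray_mean_pairing(1)[OF s G])
qed

text \<open>The field in the pairing is the gradient of \<eta>(|x|^2) \<psi>(x), which vanishes
  outside the ball together with its derivative. Its composition with a dilation by
  \<open>r \<ge> 1\<close> then has zero trace and is orthogonal to \<open>U\<close>. The preceding
  bound applies, and the distance of \<open>grad (\<phi> n)\<close> to \<open>U\<close> tends to
  0.\<close>

lemma ray_mean_orthogonal_compact:
  fixes \<phi> :: "nat \<Rightarrow> 'a::euclidean_space \<Rightarrow> real" and c \<eta> :: "real \<Rightarrow> real"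
  assumes j: "2 * DIM('a) = j + 2"
    and h: "h1_lim \<phi> u U" and harm: "weakly_harmonic U" and J: "h1_lim (\<lambda>n. ray_mean j (\<phi> n)) w W"
    and s: "smooth_on UNIV \<psi>" and c: "continuous_on UNIV c" "\<And>t. 1 \<le> t \<Longrightarrow> c t = 0"
    and \<eta>: "\<And>t. 0 \<le> t \<Longrightarrow> (\<eta> has_real_derivative c t) (at t)" "\<And>t. 1 \<le> t \<Longrightarrow> \<eta> t = 0"
  shows "(LINT x|ball_measure. W x \<bullet> (\<eta> (x \<bullet> x) *\<^sub>R grad \<psi> x + (2 * c (x \<bullet> x) * \<psi> x) *\<^sub>R x)) = 0"
proof -
  define G where "G x = \<eta> (x \<bullet> x) *\<^sub>R grad \<psi> x + (2 * c (x \<bullet> x) * \<psi> x) *\<^sub>R x" for x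
  have "continuous_on {0..} \<eta>"
    by (rule DERIV_continuous_on[of _ _ c]) (auto intro: has_field_derivative_at_within \<eta>(1))
  then have "continuous_on UNIV (\<lambda>x::'a. \<eta> (x \<bullet> x))"
    by (rule continuous_on_compose2) (auto intro!: continuous_intros)
  moreover have "continuous_on UNIV (\<lambda>x::'a. c (x \<bullet> x))"
    by (rule continuous_on_compose2[OF c(1)]) (auto intro!: continuous_intros)
  ultimately have contG: "continuous_on UNIV G"
    unfolding G_def by (intro continuous_intros continuous_on_grad[OF s] smooth_on_continuous[OF s])
  have G0: "G x = 0" if "1 \<le> norm x" for x
  proof -
    have "1 \<le> x \<bullet> x" using power_mono[OF that, of 2] by (simp add: power2_norm_eq_inner)
    then show ?thesis by (simp add: G_def c(2) \<eta>(2))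
  qed
  obtain C0 where C0: "0 \<le> C0" "\<And>x. norm x \<le> 1 \<Longrightarrow> norm (G x) \<le> C0"
    using continuous_bounded_on_cball[of 1 G] continuous_on_subset[OF contG] by blast
  have C0': "norm (G x) \<le> C0" for x using C0 G0[of x] by (cases "norm x \<le> 1") auto
  define C where "C = C0 * l2 (ball_measure :: 'a measure) (\<lambda>x. 1::real)"
  have C: "l2 ball_measure (\<lambda>y. G (r *\<^sub>R y)) \<le> C" for r
    unfolding C_def
  proof (rule l2_mono(2))
    show "square_integrable ball_measure (\<lambda>x::'a. 1::real)" by (intro square_integrable_continuous_ball) simp
    show "(\<lambda>y. G (r *\<^sub>R y)) \<in> borel_measurable ball_measure"
      by (intro borel_imp_lebesgue_on borel_measurable_continuous_onI continuous_on_compose2[OF contG] continuous_intros) auto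
  qed (use C0(1) C0' in auto)
  have orth: "(LINT y|ball_measure. U y \<bullet> G (r *\<^sub>R y)) = 0" if r: "1 \<le> r" for r
  proof -
    have "ball_trace (\<lambda>x. \<eta> (r\<^sup>2 * (x \<bullet> x)) * \<psi> (r *\<^sub>R x))
      (\<lambda>x. \<eta> (r\<^sup>2 * (x \<bullet> x)) *\<^sub>R grad (\<lambda>x. \<psi> (r *\<^sub>R x)) x + (2 * (r\<^sup>2 * c (r\<^sup>2 * (x \<bullet> x))) * \<psi> (r *\<^sub>R x)) *\<^sub>R x)
      (\<lambda>x. \<eta> (r\<^sup>2 * 1) * \<psi> (r *\<^sub>R x))"
    proof (rule ball_trace_radial_mult[OF ball_trace_smooth[OF smooth_on_scale[OF s]], of "\<lambda>t. \<eta> (r\<^sup>2 * t)" "\<lambda>t. r\<^sup>2 * c (r\<^sup>2 * t)"])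
      fix t :: real assume t: "t \<in> {0..1}"
      have "((\<lambda>t. r\<^sup>2 * t) has_real_derivative r\<^sup>2) (at t)" by (auto intro!: derivative_eq_intros)
      from DERIV_chain2[OF \<eta>(1) this] t
      have "((\<lambda>t. \<eta> (r\<^sup>2 * t)) has_real_derivative c (r\<^sup>2 * t) * r\<^sup>2) (at t)" by simp
      then show "((\<lambda>t. \<eta> (r\<^sup>2 * t)) has_real_derivative r\<^sup>2 * c (r\<^sup>2 * t)) (at t within {0..1})"
        by (simp add: mult.commute has_field_derivative_at_within)
    next
      show "continuous_on {0..1} (\<lambda>t. r\<^sup>2 * c (r\<^sup>2 * t))"
        by (intro continuous_intros continuous_on_compose2[OF c(1)]) auto
    qed
    moreover have "1 \<le> r\<^sup>2 * 1" using r by simp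
    moreover have "\<eta> (r\<^sup>2 * (x \<bullet> x)) *\<^sub>R grad (\<lambda>x. \<psi> (r *\<^sub>R x)) x + (2 * (r\<^sup>2 * c (r\<^sup>2 * (x \<bullet> x))) * \<psi> (r *\<^sub>R x)) *\<^sub>R x = r *\<^sub>R G (r *\<^sub>R x)" for x
      by (simp add: G_def grad_scale[OF s] scaleR_add_right power2_eq_square mult_ac)
    ultimately have "ball_trace (\<lambda>x. \<eta> (r\<^sup>2 * (x \<bullet> x)) * \<psi> (r *\<^sub>R x)) (\<lambda>x. r *\<^sub>R G (r *\<^sub>R x)) (\<lambda>_. 0)"
      by (simp add: \<eta>(2))
    with harm have "(LINT y|ball_measure. U y \<bullet> (r *\<^sub>R G (r *\<^sub>R y))) = 0"
      unfolding weakly_harmonic_def by blast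
    then show ?thesis using r by simp
  qed
  have "(\<lambda>n. LINT x|ball_measure. grad (ray_mean j (\<phi> n)) x \<bullet> G x) \<longlonglongrightarrow> 0"
  proof (rule Lim_null_comparison[OF always_eventually])
    show "\<forall>n. norm (LINT x|ball_measure. grad (ray_mean j (\<phi> n)) x \<bullet> G x) \<le> l2 ball_measure (\<lambda>x. grad (\<phi> n) x - U x) * C"
      using ray_mean_pairing_bound[OF h1_limD(1)[OF h] contG G0 l2_limD(2)[OF h1_limD(3)[OF h]] orth C j] by simp
    show "(\<lambda>n. l2 ball_measure (\<lambda>x. grad (\<phi> n) x - U x) * C) \<longlonglongrightarrow> 0"
      using tendsto_mult_right[OF l2_limD(3)[OF h1_limD(3)[OF h]], of C] by simp
  qed
  moreover have "(\<lambda>n. LINT x|ball_measure. grad (ray_mean j (\<phi> n)) x \<bullet> G x) \<longlonglongrightarrow> (LINT x|ball_measure. W x \<bullet> G x)"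
    by (intro l2_lim_inner h1_limD(3)[OF J] l2_lim_const square_integrable_continuous_ball contG)
  ultimately show ?thesis unfolding G_def using LIMSEQ_unique by blast
qed

lemma square_integrable_radial_weight:
  fixes F :: "'a::euclidean_space \<Rightarrow> 'b::euclidean_space" and a :: "real \<Rightarrow> real"
  assumes "continuous_on {0..1} a" "square_integrable ball_measure F"
  shows "square_integrable ball_measure (\<lambda>x. a (x \<bullet> x) *\<^sub>R F x)"
proof -
  obtain C where "\<forall>x\<in>space (ball_measure :: 'a measure). \<bar>a (x \<bullet> x)\<bar> \<le> C"
    using radial_meas_bounded(2)[OF assms(1)] by blast
  then show ?thesis
    by (intro square_integrable_bounded_scaleR[where C = C] assms(2) radial_meas_bounded(1)[OF assms(1)]) auto
qed

lemma integrable_radial_weight: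
  fixes F :: "'a::euclidean_space \<Rightarrow> real" and a :: "real \<Rightarrow> real"
  assumes "continuous_on {0..1} a" "integrable ball_measure F"
  shows "integrable ball_measure (\<lambda>x. a (x \<bullet> x) * F x)"
proof -
  obtain C where C: "\<forall>x\<in>space (ball_measure :: 'a measure). \<bar>a (x \<bullet> x)\<bar> \<le> C"
    using radial_meas_bounded(2)[OF assms(1)] by blast
  show ?thesis
  proof (rule Bochner_Integration.integrable_bound[OF integrable_mult_right[OF integrable_abs[OF assms(2)], of C]])
    show "(\<lambda>x. a (x \<bullet> x) * F x) \<in> borel_measurable ball_measure"
      by (intro borel_measurable_times radial_meas_bounded(1)[OF assms(1)] borel_measurable_integrable assms(2))
    show "AE x in ball_measure. norm (a (x \<bullet> x) * F x) \<le> norm (C * \<bar>F x\<bar>)"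
    proof (intro AE_I2)
      fix x :: 'a assume "x \<in> space ball_measure"
      with C have "\<bar>a (x \<bullet> x)\<bar> \<le> \<bar>C\<bar>" by force
      then show "norm (a (x \<bullet> x) * F x) \<le> norm (C * \<bar>F x\<bar>)"
        by (simp add: abs_mult mult_right_mono)
    qed
  qed
qed

text \<open>
  The weak form of harmonicity against \<open>\<eta>(|x|\<^sup>2) v\<close> with \<open>\<eta>(1) = 0\<close>: the gradient of the test function is
  \<open>\<eta> \<nabla>v + 2 \<eta>' v x\<close>.
\<close>

definition radially_harmonic :: "('a::euclidean_space \<Rightarrow> 'a) \<Rightarrow> bool" where
  "radially_harmonic U \<longleftrightarrow> (\<forall>v V k \<eta> c. ball_trace v V k \<longrightarrow> continuous_on {0..1} c \<longrightarrow>
     (\<forall>t\<in>{0..1}. (\<eta> has_real_derivative c t) (at t within {0..1})) \<longrightarrow> \<eta> 1 = 0 \<longrightarrow>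
     (LINT x|ball_measure. \<eta> (x \<bullet> x) * (U x \<bullet> V x)) + 2 * (LINT x|ball_measure. c (x \<bullet> x) * ((U x \<bullet> x) * v x)) = 0)"

lemma radial_pairing_split:
  fixes U V :: "'a::euclidean_space \<Rightarrow> 'a" and v :: "'a \<Rightarrow> real" and \<eta> c :: "real \<Rightarrow> real"
  assumes U: "square_integrable ball_measure U" and V: "square_integrable ball_measure V"
    and v: "square_integrable ball_measure v"
    and c: "continuous_on {0..1} \<eta>" "continuous_on {0..1} c"
  shows "(LINT x|ball_measure. U x \<bullet> (\<eta> (x \<bullet> x) *\<^sub>R V x + (2 * c (x \<bullet> x) * v x) *\<^sub>R x))
    = (LINT x|ball_measure. \<eta> (x \<bullet> x) * (U x \<bullet> V x)) + 2 * (LINT x|ball_measure. c (x \<bullet> x) * ((U x \<bullet> x) * v x))"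
proof -
  have "(LINT x|ball_measure. U x \<bullet> (\<eta> (x \<bullet> x) *\<^sub>R V x + (2 * c (x \<bullet> x) * v x) *\<^sub>R x))
    = (LINT x|ball_measure. \<eta> (x \<bullet> x) * (U x \<bullet> V x) + 2 * (c (x \<bullet> x) * ((U x \<bullet> x) * v x)))"
    by (intro Bochner_Integration.integral_cong) (auto simp: inner_add_right)
  also have "\<dots> = (LINT x|ball_measure. \<eta> (x \<bullet> x) * (U x \<bullet> V x)) + (LINT x|ball_measure. 2 * (c (x \<bullet> x) * ((U x \<bullet> x) * v x)))"
    by (intro Bochner_Integration.integral_add integrable_mult_right integrable_radial_weight c
        square_integrable_inner square_integrable_mult square_integrable_radial U V v)
  finally show ?thesis by simp
qed

lemma weakly_harmonic_imp_radially_harmonic: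
  fixes U :: "'a::euclidean_space \<Rightarrow> 'a"
  assumes "weakly_harmonic U" "square_integrable ball_measure U"
  shows "radially_harmonic U"
  unfolding radially_harmonic_def
proof (intro allI impI)
  fix v k :: "'a \<Rightarrow> real" and V :: "'a \<Rightarrow> 'a" and \<eta> c :: "real \<Rightarrow> real"
  assume v: "ball_trace v V k" and c: "continuous_on {0..1} c"
    and d: "\<forall>t\<in>{0..1}. (\<eta> has_real_derivative c t) (at t within {0..1})" and "\<eta> 1 = 0"
  have "continuous_on {0..1} \<eta>" using d by (intro DERIV_continuous_on[of _ _ c]) auto
  note sp = radial_pairing_split[OF assms(2) ball_traceD(2)[OF v] ball_traceD(1)[OF v] this c]
  have "ball_trace (\<lambda>x. \<eta> (x \<bullet> x) * v x) (\<lambda>x. \<eta> (x \<bullet> x) *\<^sub>R V x + (2 * c (x \<bullet> x) * v x) *\<^sub>R x) (\<lambda>x. 0)"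
    using ball_trace_radial_mult[OF v d[rule_format] c] \<open>\<eta> 1 = 0\<close> by simp
  then show "(LINT x|ball_measure. \<eta> (x \<bullet> x) * (U x \<bullet> V x)) + 2 * (LINT x|ball_measure. c (x \<bullet> x) * ((U x \<bullet> x) * v x)) = 0"
    using assms(1) unfolding weakly_harmonic_def sp[symmetric] by blast
qed

lemma radially_harmonic_cmult:
  fixes U :: "'a::euclidean_space \<Rightarrow> 'a"
  assumes "radially_harmonic U"
  shows "radially_harmonic (\<lambda>x. a *\<^sub>R U x)"
  unfolding radially_harmonic_def
proof (intro allI impI)
  fix v k :: "'a \<Rightarrow> real" and V :: "'a \<Rightarrow> 'a" and \<eta> c :: "real \<Rightarrow> real"
  assume "ball_trace v V k" "continuous_on {0..1} c"
    "\<forall>t\<in>{0..1}. (\<eta> has_real_derivative c t) (at t within {0..1})" "\<eta> 1 = 0"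
  with assms have 0: "(LINT x|ball_measure. \<eta> (x \<bullet> x) * (U x \<bullet> V x)) + 2 * (LINT x|ball_measure. c (x \<bullet> x) * ((U x \<bullet> x) * v x)) = 0"
    unfolding radially_harmonic_def by blast
  have 1: "(LINT x|ball_measure. \<eta> (x \<bullet> x) * (a *\<^sub>R U x \<bullet> V x)) = a * (LINT x|ball_measure. \<eta> (x \<bullet> x) * (U x \<bullet> V x))"
    by (subst integral_mult_right_zero[symmetric]) (intro Bochner_Integration.integral_cong, auto)
  have 2: "(LINT x|ball_measure. c (x \<bullet> x) * ((a *\<^sub>R U x \<bullet> x) * v x)) = a * (LINT x|ball_measure. c (x \<bullet> x) * ((U x \<bullet> x) * v x))"
    by (subst integral_mult_right_zero[symmetric]) (intro Bochner_Integration.integral_cong, auto)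
  show "(LINT x|ball_measure. \<eta> (x \<bullet> x) * (a *\<^sub>R U x \<bullet> V x)) + 2 * (LINT x|ball_measure. c (x \<bullet> x) * ((a *\<^sub>R U x \<bullet> x) * v x)) = 0"
    unfolding 1 2 mult.left_commute[of 2 a] distrib_left[symmetric] 0 by simp
qed

text \<open>Density: for fixed radial weights both integrals are continuous in \<open>v\<close> and
  \<open>V\<close>, so the smooth factor can be replaced by any H^1 function.\<close>

lemma ray_mean_orthogonal_compact_trace:
  fixes \<phi> :: "nat \<Rightarrow> 'a::euclidean_space \<Rightarrow> real" and c \<eta> :: "real \<Rightarrow> real"
  assumes j: "2 * DIM('a) = j + 2"
    and h: "h1_lim \<phi> u U" and harm: "weakly_harmonic U" and J: "h1_lim (\<lambda>n. ray_mean j (\<phi> n)) w W"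
    and v: "ball_trace v V k" and c: "continuous_on UNIV c" "\<And>t. 1 \<le> t \<Longrightarrow> c t = 0"
    and \<eta>: "\<And>t. 0 \<le> t \<Longrightarrow> (\<eta> has_real_derivative c t) (at t)" "\<And>t. 1 \<le> t \<Longrightarrow> \<eta> t = 0"
  shows "(LINT x|ball_measure. \<eta> (x \<bullet> x) * (W x \<bullet> V x)) + 2 * (LINT x|ball_measure. c (x \<bullet> x) * ((W x \<bullet> x) * v x)) = 0"
proof -
  obtain \<psi> where \<psi>: "h1_lim \<psi> v V" using v unfolding ball_trace_iff by blast
  note \<psi>s = h1_limD[OF \<psi>]
  have W: "square_integrable ball_measure W" by (rule l2_limD(2)[OF h1_limD(3)[OF J]])
  have c1: "continuous_on {0..1} c" using c(1) by (rule continuous_on_subset) simp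
  have c2: "continuous_on {0..1} \<eta>"
    by (rule DERIV_continuous_on[of _ _ c]) (auto intro: has_field_derivative_at_within \<eta>(1))
  have 0: "(LINT x|ball_measure. \<eta> (x \<bullet> x) * (W x \<bullet> grad (\<psi> n) x)) + 2 * (LINT x|ball_measure. c (x \<bullet> x) * ((W x \<bullet> x) * \<psi> n x)) = 0" for n
    using ray_mean_orthogonal_compact[OF j h harm J \<psi>s(1) c \<eta>, of n]
      radial_pairing_split[OF W smooth_square_integrable(2,1)[OF \<psi>s(1)] c2 c1, of n n] by (simp only:)
  have "(\<lambda>n. (LINT x|ball_measure. (\<eta> (x \<bullet> x) *\<^sub>R W x) \<bullet> grad (\<psi> n) x) + 2 * (LINT x|ball_measure. (c (x \<bullet> x) *\<^sub>R (W x \<bullet> x)) * \<psi> n x))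
     \<longlonglongrightarrow> (LINT x|ball_measure. (\<eta> (x \<bullet> x) *\<^sub>R W x) \<bullet> V x) + 2 * (LINT x|ball_measure. (c (x \<bullet> x) *\<^sub>R (W x \<bullet> x)) * v x)"
    by (intro tendsto_add tendsto_mult_left l2_lim_inner l2_lim_mult l2_lim_const \<psi>s
        square_integrable_radial_weight c1 c2 W square_integrable_radial)
  then show ?thesis unfolding inner_scaleR_left real_scaleR_def mult.assoc 0 LIMSEQ_const_iff by simp
qed

text \<open>The dilation argument needs \<open>c\<close> to vanish on the sphere as well. The factor
  \<open>1 - t ^ n\<close> brings this about while changing \<open>c\<close> noticeably only near 1;
  integrated back from 1, the error in \<open>\<eta>\<close> is at most the integral of
  \<open>C * t ^ n\<close>.\<close>

lemma compact_cutoff: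
  fixes c \<eta> :: "real \<Rightarrow> real"
  assumes c: "continuous_on {0..1} c" and d: "\<And>t. t \<in> {0..1} \<Longrightarrow> (\<eta> has_real_derivative c t) (at t within {0..1})"
    and \<eta>1: "\<eta> 1 = 0" and C: "\<And>t. t \<in> {0..1} \<Longrightarrow> \<bar>c t\<bar> \<le> C"
  obtains cn \<eta>n where "continuous_on UNIV cn" "\<And>t. 1 \<le> t \<Longrightarrow> cn t = 0"
    "\<And>t. 0 \<le> t \<Longrightarrow> (\<eta>n has_real_derivative cn t) (at t)" "\<And>t. 1 \<le> t \<Longrightarrow> \<eta>n t = 0"
    "\<And>t. t \<in> {0..1} \<Longrightarrow> cn t = c t * (1 - t ^ n)" "\<And>t. t \<in> {0..1} \<Longrightarrow> \<bar>\<eta>n t - \<eta> t\<bar> \<le> C / real (Suc n)"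
proof -
  \<comment> \<open>Clamping extends \<open>c\<close> continuously to the line, and beyond 1 the
    factor \<open>1 - clamp t ^ n\<close> is identically 0.\<close>
  define clamp where "clamp t = max 0 (min 1 t)" for t :: real
  have cl: "continuous_on UNIV clamp" "clamp t \<in> {0..1}" "t \<in> {0..1} \<Longrightarrow> clamp t = t" "1 \<le> t \<Longrightarrow> clamp t = 1" for t
    by (auto simp: clamp_def intro!: continuous_intros)
  define cn where "cn t = c (clamp t) * (1 - clamp t ^ n)" for t
  have contcn: "continuous_on S cn" for S
    unfolding cn_def
    by (intro continuous_intros continuous_on_compose2[OF c] continuous_on_subset[OF cl(1)]) (use cl(2) in auto)
  have cn1: "cn t = 0" if "1 \<le> t" for t using cl(4)[OF that] by (simp add: cn_def)
  have cn01: "cn t = c t * (1 - t ^ n)" if "t \<in> {0..1}" for t using cl(3)[OF that] by (simp add: cn_def)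
  have int: "cn integrable_on {a..b}" for a b by (intro integrable_continuous_real contcn)
  \<comment> \<open>The primitive starts at -1, leaving room for a two-sided derivative at
    0.\<close>
  define \<eta>n where "\<eta>n t = integral {-1..t} cn - integral {-1..1} cn" for t
  have der: "(\<eta>n has_real_derivative cn t) (at t)" if "0 \<le> t" for t
  proof -
    have "((\<lambda>x. integral {-1..x} cn) has_real_derivative cn t) (at t within {-1..t + 1})"
      by (rule integral_has_real_derivative[OF contcn]) (use that in auto)
    then have "((\<lambda>x. integral {-1..x} cn) has_real_derivative cn t) (at t)"
      using that by (simp add: at_within_Icc_at)
    from DERIV_diff[OF this DERIV_const] show ?thesis unfolding \<eta>n_def by simp
  qed
  have \<eta>n1: "\<eta>n t = 0" if "1 \<le> t" for t
  proof -
    have "integral {-1..t} cn = integral {-1..1} cn + integral {1..t} cn"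
      by (rule Henstock_Kurzweil_Integration.integral_combine[symmetric]) (use that int in auto)
    moreover have "integral {1..t} cn = integral {1..t} (\<lambda>t. 0)"
      by (rule Henstock_Kurzweil_Integration.integral_cong) (use cn1 in auto)
    ultimately show ?thesis by (simp add: \<eta>n_def)
  qed
  have diff: "\<bar>\<eta>n t - \<eta> t\<bar> \<le> C / real (Suc n)" if t: "t \<in> {0..1}" for t
  proof -
    have "integral {-1..1} cn = integral {-1..t} cn + integral {t..1} cn"
      by (rule Henstock_Kurzweil_Integration.integral_combine[symmetric]) (use t int in auto)
    then have 1: "\<eta>n t = - integral {t..1} cn" by (simp add: \<eta>n_def)
    have sub: "{t..1} \<subseteq> {0..1}" using t by auto
    have "(c has_integral (\<eta> 1 - \<eta> t)) {t..1}"
    proof (rule fundamental_theorem_of_calculus)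
      fix s assume "s \<in> {t..1}"
      with sub have "(\<eta> has_real_derivative c s) (at s within {0..1})" by (intro d) auto
      then show "(\<eta> has_vector_derivative c s) (at s within {t..1})"
        using sub by (simp add: has_real_derivative_iff_has_vector_derivative has_vector_derivative_within_subset)
    qed (use t in auto)
    then have 2: "\<eta> t = - integral {t..1} c" "c integrable_on {t..1}" using \<eta>1 by (auto simp: integral_unique)
    have "\<eta>n t - \<eta> t = integral {t..1} (\<lambda>s. c s - cn s)"
      unfolding 1 2(1) by (subst Henstock_Kurzweil_Integration.integral_diff[OF 2(2) int]) simp
    moreover have "((\<lambda>s. C * s ^ n) has_integral (C * 1 ^ Suc n / real (Suc n) - C * t ^ Suc n / real (Suc n))) {t..1}"
      using t by (intro fundamental_theorem_of_calculus)
        (auto intro!: derivative_eq_intros simp: has_real_derivative_iff_has_vector_derivative[symmetric] simp del: power_Suc)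
    moreover have "norm (integral {t..1} (\<lambda>s. c s - cn s)) \<le> integral {t..1} (\<lambda>s. C * s ^ n)"
    proof (rule integral_norm_bound_integral)
      show "(\<lambda>s. c s - cn s) integrable_on {t..1}" by (intro Henstock_Kurzweil_Integration.integrable_diff 2 int)
      show "(\<lambda>s. C * s ^ n) integrable_on {t..1}" by (intro integrable_continuous_real continuous_intros)
      fix s assume s: "s \<in> {t..1}"
      then have s01: "s \<in> {0..1}" using sub by auto
      have "c s - cn s = c s * s ^ n" by (simp add: cn01[OF s01] algebra_simps)
      then show "norm (c s - cn s) \<le> C * s ^ n"
        using C[OF s01] s01 by (simp add: abs_mult mult_right_mono)
    qed
    moreover have "0 \<le> C * t ^ Suc n / real (Suc n)"
      using C[of 0] t by (intro divide_nonneg_nonneg mult_nonneg_nonneg) auto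
    ultimately show ?thesis unfolding real_norm_def by (simp only: integral_unique power_one mult_1_right)
  qed
  from that[OF contcn cn1 der \<eta>n1 cn01 diff] show thesis .
qed

text \<open>Undoes the cutoff by dominated convergence: the modified \<open>\<eta>\<close> converge
  uniformly, the modified \<open>c\<close> only pointwise, since \<open>(x \<bullet> x) ^ n\<close>
  tends to 0 just inside the open ball.\<close>

lemma ray_mean_radially_harmonic:
  fixes \<phi> :: "nat \<Rightarrow> 'a::euclidean_space \<Rightarrow> real"
  assumes j: "2 * DIM('a) = j + 2"
    and h: "h1_lim \<phi> u U" and harm: "weakly_harmonic U" and J: "h1_lim (\<lambda>n. ray_mean j (\<phi> n)) w W"
  shows "radially_harmonic W"
  unfolding radially_harmonic_def
proof (intro allI impI)
  fix v k :: "'a \<Rightarrow> real" and V :: "'a \<Rightarrow> 'a" and \<eta> c :: "real \<Rightarrow> real"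
  assume v: "ball_trace v V k" and c: "continuous_on {0..1} c"
    and d: "\<forall>t\<in>{0..1}. (\<eta> has_real_derivative c t) (at t within {0..1})" and \<eta>1: "\<eta> 1 = 0"
  have c\<eta>: "continuous_on {0..1} \<eta>" using d by (intro DERIV_continuous_on[of _ _ c]) auto
  have W: "square_integrable ball_measure W" by (rule l2_limD(2)[OF h1_limD(3)[OF J]])
  have i1: "integrable ball_measure (\<lambda>x. W x \<bullet> V x)" by (intro square_integrable_inner W ball_traceD(2)[OF v])
  have i2: "integrable ball_measure (\<lambda>x. (W x \<bullet> x) * v x)"
    by (intro square_integrable_mult square_integrable_radial W ball_traceD(1)[OF v])
  have in1: "x \<bullet> x \<in> {0..1}" "x \<bullet> x < 1" if "x \<in> space ball_measure" for x :: 'a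
    using that power_strict_mono[of "norm x" 1 2] by (auto simp: power2_norm_eq_inner space_restrict_space)
  have "bounded (c ` {0..1})" by (intro compact_imp_bounded compact_continuous_image c) simp
  then obtain C where "\<forall>y\<in>c ` {0..1}. norm y \<le> C" unfolding bounded_iff by blast
  then have C: "\<bar>c t\<bar> \<le> C" if "t \<in> {0..1}" for t using that by auto
  have C0: "0 \<le> C" using C[of 0] by auto
  define R where "R n cn \<eta>n \<longleftrightarrow> continuous_on UNIV cn \<and> (\<forall>t\<ge>1. cn t = 0) \<and>
    (\<forall>t\<ge>0. (\<eta>n has_real_derivative cn t) (at t)) \<and> (\<forall>t\<ge>1. \<eta>n t = 0) \<and>
    (\<forall>t\<in>{0..1}. cn t = c t * (1 - t ^ n)) \<and> (\<forall>t\<in>{0..1}. \<bar>\<eta>n t - \<eta> t\<bar> \<le> C / real (Suc n))" for n cn \<eta>n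
  have "\<exists>q. R n (fst q) (snd q)" for n
  proof (rule compact_cutoff[OF c d[rule_format] \<eta>1 C, of n])
    fix cn \<eta>n :: "real \<Rightarrow> real"
    assume "continuous_on UNIV cn" "\<And>t. 1 \<le> t \<Longrightarrow> cn t = 0"
    "\<And>t. 0 \<le> t \<Longrightarrow> (\<eta>n has_real_derivative cn t) (at t)" "\<And>t. 1 \<le> t \<Longrightarrow> \<eta>n t = 0"
    "\<And>t. t \<in> {0..1} \<Longrightarrow> cn t = c t * (1 - t ^ n)" "\<And>t. t \<in> {0..1} \<Longrightarrow> \<bar>\<eta>n t - \<eta> t\<bar> \<le> C / real (Suc n)"
    then have "R n cn \<eta>n" unfolding R_def by blast
    then show ?thesis by (intro exI[of _ "(cn, \<eta>n)"]) simp
  qed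
  then obtain q where q: "R n (fst (q n)) (snd (q n))" for n
    using choice[of "\<lambda>n q. R n (fst q) (snd q)"] by blast
  define cn where "cn n = fst (q n)" for n
  define \<eta>n where "\<eta>n n = snd (q n)" for n
  have Rn: "R n (cn n) (\<eta>n n)" for n using q by (simp add: cn_def \<eta>n_def)
  have cn: "continuous_on UNIV (cn n)" "1 \<le> t \<Longrightarrow> cn n t = 0" "0 \<le> t \<Longrightarrow> (\<eta>n n has_real_derivative cn n t) (at t)"
    "1 \<le> t \<Longrightarrow> \<eta>n n t = 0" "t \<in> {0..1} \<Longrightarrow> cn n t = c t * (1 - t ^ n)"
    "t \<in> {0..1} \<Longrightarrow> \<bar>\<eta>n n t - \<eta> t\<bar> \<le> C / real (Suc n)" for n t
    using Rn[of n] unfolding R_def by blast+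
  have c\<eta>n: "continuous_on {0..1} (\<eta>n n)" for n
    by (rule DERIV_continuous_on[of _ _ "cn n"]) (auto intro: has_field_derivative_at_within cn(3))
  have ccn: "continuous_on {0..1} (cn n)" for n using cn(1) by (rule continuous_on_subset) simp
  have 0: "(LINT x|ball_measure. \<eta>n n (x \<bullet> x) * (W x \<bullet> V x)) + 2 * (LINT x|ball_measure. cn n (x \<bullet> x) * ((W x \<bullet> x) * v x)) = 0" for n
    by (rule ray_mean_orthogonal_compact_trace[OF j h harm J v cn(1-4)])
  have l1: "(\<lambda>n. LINT x|ball_measure. \<eta>n n (x \<bullet> x) * (W x \<bullet> V x)) \<longlonglongrightarrow> (LINT x|ball_measure. \<eta> (x \<bullet> x) * (W x \<bullet> V x))"
  proof (rule integral_dominated_convergence[where w = "\<lambda>x. \<bar>\<eta> (x \<bullet> x) * (W x \<bullet> V x)\<bar> + C * \<bar>W x \<bullet> V x\<bar>"])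
    show "integrable ball_measure (\<lambda>x. \<bar>\<eta> (x \<bullet> x) * (W x \<bullet> V x)\<bar> + C * \<bar>W x \<bullet> V x\<bar>)"
      by (intro Bochner_Integration.integrable_add integrable_abs integrable_mult_right integrable_radial_weight c\<eta> i1)
    show "AE x in ball_measure. (\<lambda>n. \<eta>n n (x \<bullet> x) * (W x \<bullet> V x)) \<longlonglongrightarrow> \<eta> (x \<bullet> x) * (W x \<bullet> V x)"
    proof (intro AE_I2 tendsto_mult_right)
      fix x :: 'a assume "x \<in> space ball_measure"
      then have le: "\<forall>n. norm (\<eta>n n (x \<bullet> x) - \<eta> (x \<bullet> x)) \<le> C * inverse (real (Suc n))"
        using cn(6)[OF in1(1)] by (simp add: divide_inverse)
      have "(\<lambda>n. C * inverse (real (Suc n))) \<longlonglongrightarrow> 0"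
        using tendsto_mult_left[OF LIMSEQ_inverse_real_of_nat, of C] by simp
      from LIM_zero_cancel[OF Lim_null_comparison[OF always_eventually[OF le] this]]
      show "(\<lambda>n. \<eta>n n (x \<bullet> x)) \<longlonglongrightarrow> \<eta> (x \<bullet> x)" .
    qed
    show "AE x in ball_measure. norm (\<eta>n n (x \<bullet> x) * (W x \<bullet> V x)) \<le> \<bar>\<eta> (x \<bullet> x) * (W x \<bullet> V x)\<bar> + C * \<bar>W x \<bullet> V x\<bar>" for n
    proof (intro AE_I2)
      fix x :: 'a assume "x \<in> space ball_measure"
      from cn(6)[OF in1(1)[OF this], of n] have "\<bar>\<eta>n n (x \<bullet> x) - \<eta> (x \<bullet> x)\<bar> \<le> C / real (Suc n)" .
      also have "\<dots> \<le> C" using C0 by (simp add: divide_le_eq mult_left_mono[of 1 _ C, simplified] distrib_left)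
      finally have "\<bar>\<eta>n n (x \<bullet> x)\<bar> \<le> \<bar>\<eta> (x \<bullet> x)\<bar> + C" by linarith
      from mult_right_mono[OF this, of "\<bar>W x \<bullet> V x\<bar>"]
      show "norm (\<eta>n n (x \<bullet> x) * (W x \<bullet> V x)) \<le> \<bar>\<eta> (x \<bullet> x) * (W x \<bullet> V x)\<bar> + C * \<bar>W x \<bullet> V x\<bar>"
        by (simp add: abs_mult distrib_right)
    qed
  qed (intro borel_measurable_integrable integrable_radial_weight c\<eta> c\<eta>n i1)+
  have l2: "(\<lambda>n. LINT x|ball_measure. cn n (x \<bullet> x) * ((W x \<bullet> x) * v x)) \<longlonglongrightarrow> (LINT x|ball_measure. c (x \<bullet> x) * ((W x \<bullet> x) * v x))"
  proof (rule integral_dominated_convergence[where w = "\<lambda>x. \<bar>c (x \<bullet> x) * ((W x \<bullet> x) * v x)\<bar>"])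
    show "integrable ball_measure (\<lambda>x. \<bar>c (x \<bullet> x) * ((W x \<bullet> x) * v x)\<bar>)"
      by (intro integrable_abs integrable_radial_weight c i2)
    show "AE x in ball_measure. (\<lambda>n. cn n (x \<bullet> x) * ((W x \<bullet> x) * v x)) \<longlonglongrightarrow> c (x \<bullet> x) * ((W x \<bullet> x) * v x)"
    proof (intro AE_I2 tendsto_mult_right)
      fix x :: 'a assume x: "x \<in> space ball_measure"
      have "(\<lambda>n. c (x \<bullet> x) * (1 - (x \<bullet> x) ^ n)) \<longlonglongrightarrow> c (x \<bullet> x) * (1 - 0)"
        using in1[OF x] by (intro tendsto_intros LIMSEQ_power_zero) auto
      then show "(\<lambda>n. cn n (x \<bullet> x)) \<longlonglongrightarrow> c (x \<bullet> x)"
        by (simp add: cn(5)[OF in1(1)[OF x]])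
    qed
    show "AE x in ball_measure. norm (cn n (x \<bullet> x) * ((W x \<bullet> x) * v x)) \<le> \<bar>c (x \<bullet> x) * ((W x \<bullet> x) * v x)\<bar>" for n
    proof (intro AE_I2)
      fix x :: 'a assume x: "x \<in> space ball_measure"
      have "\<bar>cn n (x \<bullet> x)\<bar> \<le> \<bar>c (x \<bullet> x)\<bar> * 1"
        unfolding cn(5)[OF in1(1)[OF x]] abs_mult
        using in1[OF x] power_le_one[of "x \<bullet> x" n] by (intro mult_left_mono) auto
      from mult_right_mono[OF this, of "\<bar>(W x \<bullet> x) * v x\<bar>"]
      show "norm (cn n (x \<bullet> x) * ((W x \<bullet> x) * v x)) \<le> \<bar>c (x \<bullet> x) * ((W x \<bullet> x) * v x)\<bar>"
        by (simp add: abs_mult)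
    qed
  qed (intro borel_measurable_integrable integrable_radial_weight c ccn i2)+
  from tendsto_add[OF l1 tendsto_mult_left[OF l2, of 2]]
  show "(LINT x|ball_measure. \<eta> (x \<bullet> x) * (W x \<bullet> V x)) + 2 * (LINT x|ball_measure. c (x \<bullet> x) * ((W x \<bullet> x) * v x)) = 0"
    unfolding 0 by (simp add: LIMSEQ_const_iff)
qed

section \<open>Transformed conductivity equations\<close>

context
  fixes H h f fh :: "'a::euclidean_space \<Rightarrow> real" and DH Dh :: "'a \<Rightarrow> 'a" and g r q :: "real \<Rightarrow> real"
  assumes dim: "DIM('a) = 3"
    and H: "ball_trace H DH f" "weakly_harmonic DH"
    and h: "ball_trace h Dh fh" "radially_harmonic Dh"
    and radial: "AE x in ball_measure. Dh x \<bullet> x = 5/2 * (H x - h x)"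
    and g_deriv: "\<forall>t\<in>{0..1}. (g has_real_derivative r t) (at t within {0..1})"
    and r_deriv: "\<forall>t\<in>{0..1}. (r has_real_derivative q t) (at t within {0..1})"
    and q: "continuous_on {0..1} q"
    and g1: "g 1 = 1" and g_positive: "\<forall>t\<in>{0..1}. 0 < g t"
    and g_ode: "\<forall>t\<in>{0..1}. 3 * r t + 2 * t * q t = 5 * g t * r t"
begin

definition radial_transform :: "'a \<Rightarrow> real" where
  "radial_transform x = h x + inverse (g (x \<bullet> x)) * (H x - h x)"

definition radial_transform_grad :: "'a \<Rightarrow> 'a" where
  "radial_transform_grad x = Dh x + (inverse (g (x \<bullet> x)) *\<^sub>R (DH x - Dh x)
     + (2 * - (r (x \<bullet> x) / (g (x \<bullet> x))\<^sup>2) * (H x - h x)) *\<^sub>R x)"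

lemma profile_continuous: "continuous_on {0..1} g" "continuous_on {0..1} r"
  by (rule DERIV_continuous_on[OF bspec[OF g_deriv]] DERIV_continuous_on[OF bspec[OF r_deriv]], assumption)+

lemma ball_trace_radial_transform: "ball_trace radial_transform radial_transform_grad f"
proof -
  have g0: "g t \<noteq> 0" if "t \<in> {0..1}" for t using bspec[OF g_positive that] by simp
  have "ball_trace (\<lambda>x. inverse (g (x \<bullet> x)) * (H x - h x))
     (\<lambda>x. inverse (g (x \<bullet> x)) *\<^sub>R (DH x - Dh x) + (2 * - (r (x \<bullet> x) / (g (x \<bullet> x))\<^sup>2) * (H x - h x)) *\<^sub>R x)
     (\<lambda>x. inverse (g 1) * (f x - fh x))"
  proof (rule ball_trace_radial_mult[OF ball_trace_diff[OF H(1) h(1)]])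
    fix t :: real assume "t \<in> {0..1}"
    from DERIV_inverse'[OF bspec[OF g_deriv this] g0[OF this]]
    show "((\<lambda>t. inverse (g t)) has_real_derivative - (r t / (g t)\<^sup>2)) (at t within {0..1})"
      by (simp add: power2_eq_square divide_inverse mult_ac)
  next
    show "continuous_on {0..1} (\<lambda>t. - (r t / (g t)\<^sup>2))"
      using g0 by (intro continuous_intros profile_continuous) auto
  qed
  from ball_trace_add[OF h(1) this] show ?thesis
    unfolding radial_transform_def[abs_def] radial_transform_grad_def[abs_def] by (simp add: g1)
qed

text \<open>Write \<open>e\<close> for \<open>H - h\<close>. Expanded, g^2 \<nabla>u is
  \<open>g\<^sup>2 Dh + g (DH - Dh) - 2 r e x\<close>. Harmonicity strips the weights
  \<open>g\<^sup>2\<close> and \<open>g\<close> at the price of the radial integrals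
  \<open>T\<close>, \<open>LH\<close>, \<open>Lh\<close>. Green's formula exchanges
  \<open>LH - Lh + Z\<close> for the boundary term and \<open>3 * Y + 2 * Q\<close>. Both leftovers
  are multiples of \<open>X\<close>: for \<open>T\<close> by the relation between \<open>Dh\<close>
  and \<open>e\<close>, for \<open>3 * Y + 2 * Q\<close> by the differential equation of
  \<open>g\<close>. They cancel.\<close>

lemma conductivity_form:
  fixes v k :: "'a \<Rightarrow> real" and V :: "'a \<Rightarrow> 'a"
  assumes v: "ball_trace v V k"
  shows "(LINT x|ball_measure. (g (x \<bullet> x))\<^sup>2 * (radial_transform_grad x \<bullet> V x))
    = (LINT x|ball_measure. DH x \<bullet> V x) - 2 * r 1 * (LINT x|sphere_measure. (f x - fh x) * k x)"
proof -
  define e where "e x = H x - h x" for x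
  note sH = ball_traceD[OF H(1)] and sh = ball_traceD[OF h(1)] and sv = ball_traceD[OF v]
  have se: "square_integrable ball_measure e"
    unfolding e_def by (rule square_integrable_diff[OF sH(1) sh(1)])
  have iHV: "integrable ball_measure (\<lambda>x. DH x \<bullet> V x)" and ihV: "integrable ball_measure (\<lambda>x. Dh x \<bullet> V x)"
    and iHv: "integrable ball_measure (\<lambda>x. (DH x \<bullet> x) * v x)" and ihv: "integrable ball_measure (\<lambda>x. (Dh x \<bullet> x) * v x)"
    and ieV: "integrable ball_measure (\<lambda>x. e x * (V x \<bullet> x))" and iev: "integrable ball_measure (\<lambda>x. e x * v x)"
    by (intro square_integrable_inner square_integrable_mult square_integrable_radial sH sh sv se)+
  have cg2: "continuous_on {0..1} (\<lambda>t. (g t)\<^sup>2)" and cgr: "continuous_on {0..1} (\<lambda>t. g t * r t)"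
    and ctq: "continuous_on {0..1} (\<lambda>t. t * q t)"
    by (intro continuous_intros profile_continuous q)+
  define T where "T = (LINT x|ball_measure. g (x \<bullet> x) * r (x \<bullet> x) * ((Dh x \<bullet> x) * v x))"
  define LH where "LH = (LINT x|ball_measure. r (x \<bullet> x) * ((DH x \<bullet> x) * v x))"
  define Lh where "Lh = (LINT x|ball_measure. r (x \<bullet> x) * ((Dh x \<bullet> x) * v x))"
  define Z where "Z = (LINT x|ball_measure. r (x \<bullet> x) * (e x * (V x \<bullet> x)))"
  define Y where "Y = (LINT x|ball_measure. r (x \<bullet> x) * (e x * v x))"
  define Q where "Q = (LINT x|ball_measure. (x \<bullet> x) * q (x \<bullet> x) * (e x * v x))"
  define X where "X = (LINT x|ball_measure. g (x \<bullet> x) * r (x \<bullet> x) * (e x * v x))"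
  define S where "S = (LINT x|sphere_measure. (f x - fh x) * k x)"
  \<comment> \<open>Because \<open>g 1 = 1\<close>, both \<open>g - 1\<close> and
    \<open>g\<^sup>2 - 1\<close> vanish on the sphere and are admissible weights in
    \<open>radially_harmonic\<close>.\<close>
  have dg1: "((\<lambda>t. g t - 1) has_real_derivative r t) (at t within {0..1})" if "t \<in> {0..1}" for t
    using DERIV_diff[OF bspec[OF g_deriv that] DERIV_const] by simp
  have dg2: "((\<lambda>t. (g t)\<^sup>2 - 1) has_real_derivative 2 * (g t * r t)) (at t within {0..1})" if "t \<in> {0..1}" for t
    using DERIV_diff[OF DERIV_power[OF bspec[OF g_deriv that], of 2] DERIV_const] by (simp add: mult_ac)
  have P2: "(LINT x|ball_measure. (g (x \<bullet> x))\<^sup>2 * (Dh x \<bullet> V x)) = (LINT x|ball_measure. Dh x \<bullet> V x) - 4 * T"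
  proof -
    have "(LINT x|ball_measure. ((g (x \<bullet> x))\<^sup>2 - 1) * (Dh x \<bullet> V x))
       + 2 * (LINT x|ball_measure. 2 * (g (x \<bullet> x) * r (x \<bullet> x)) * ((Dh x \<bullet> x) * v x)) = 0"
    proof (rule h(2)[unfolded radially_harmonic_def, rule_format, OF v])
      show "continuous_on {0..1} (\<lambda>t. 2 * (g t * r t))" by (intro continuous_intros cgr)
    qed (auto simp: g1 intro!: dg2)
    moreover have "(LINT x|ball_measure. ((g (x \<bullet> x))\<^sup>2 - 1) * (Dh x \<bullet> V x))
        = (LINT x|ball_measure. (g (x \<bullet> x))\<^sup>2 * (Dh x \<bullet> V x)) - (LINT x|ball_measure. Dh x \<bullet> V x)"
      unfolding left_diff_distrib mult_1 by (intro Bochner_Integration.integral_diff integrable_radial_weight[OF cg2] ihV)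
    ultimately show ?thesis by (simp add: T_def mult.assoc)
  qed
  have P1: "(LINT x|ball_measure. g (x \<bullet> x) * (U x \<bullet> V x))
      = (LINT x|ball_measure. U x \<bullet> V x) - 2 * (LINT x|ball_measure. r (x \<bullet> x) * ((U x \<bullet> x) * v x))"
    if U: "radially_harmonic U" "integrable ball_measure (\<lambda>x. U x \<bullet> V x)" for U
  proof -
    have "(LINT x|ball_measure. (g (x \<bullet> x) - 1) * (U x \<bullet> V x)) + 2 * (LINT x|ball_measure. r (x \<bullet> x) * ((U x \<bullet> x) * v x)) = 0"
      by (rule U(1)[unfolded radially_harmonic_def, rule_format, OF v profile_continuous(2)]) (auto simp: g1 intro!: dg1)
    moreover have "(LINT x|ball_measure. (g (x \<bullet> x) - 1) * (U x \<bullet> V x))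
        = (LINT x|ball_measure. g (x \<bullet> x) * (U x \<bullet> V x)) - (LINT x|ball_measure. U x \<bullet> V x)"
      unfolding left_diff_distrib mult_1 by (intro Bochner_Integration.integral_diff integrable_radial_weight[OF profile_continuous(1)] U(2))
    ultimately show ?thesis by simp
  qed
  \<comment> \<open>The pair is \<open>e\<close> and \<open>r (x \<bullet> x) * v x\<close>. Putting
    the weight \<open>r\<close> on \<open>v\<close> makes its derivative \<open>q\<close> appear,
    which is how the second derivative of \<open>g\<close> enters.\<close>
  have green: "3 * Y + (LH - Lh) + (Z + 2 * Q) = r 1 * S"
  proof -
    have 1: "(LINT x|ball_measure. (H x - h x) * (r (x \<bullet> x) * v x)) = Y"
      unfolding Y_def e_def by (intro Bochner_Integration.integral_cong) auto
    have 2: "(LINT x|ball_measure. ((DH x - Dh x) \<bullet> x) * (r (x \<bullet> x) * v x)) = LH - Lh"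
    proof -
      have "(LINT x|ball_measure. ((DH x - Dh x) \<bullet> x) * (r (x \<bullet> x) * v x))
        = (LINT x|ball_measure. r (x \<bullet> x) * ((DH x \<bullet> x) * v x) - r (x \<bullet> x) * ((Dh x \<bullet> x) * v x))"
        by (intro Bochner_Integration.integral_cong) (auto simp: inner_diff_left algebra_simps)
      also have "\<dots> = LH - Lh"
        unfolding LH_def Lh_def
        by (intro Bochner_Integration.integral_diff integrable_radial_weight[OF profile_continuous(2)] iHv ihv)
      finally show ?thesis .
    qed
    have 3: "(LINT x|ball_measure. (H x - h x) * ((r (x \<bullet> x) *\<^sub>R V x + (2 * q (x \<bullet> x) * v x) *\<^sub>R x) \<bullet> x)) = Z + 2 * Q"
    proof -
      have "(LINT x|ball_measure. (H x - h x) * ((r (x \<bullet> x) *\<^sub>R V x + (2 * q (x \<bullet> x) * v x) *\<^sub>R x) \<bullet> x))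
         = (LINT x|ball_measure. r (x \<bullet> x) * (e x * (V x \<bullet> x)) + 2 * ((x \<bullet> x) * q (x \<bullet> x) * (e x * v x)))"
        by (intro Bochner_Integration.integral_cong) (auto simp: e_def inner_add_left algebra_simps)
      also have "\<dots> = Z + (LINT x|ball_measure. 2 * ((x \<bullet> x) * q (x \<bullet> x) * (e x * v x)))"
        unfolding Z_def
        by (intro Bochner_Integration.integral_add integrable_mult_right integrable_radial_weight[OF profile_continuous(2)]
            integrable_radial_weight[OF ctq] ieV iev)
      finally show ?thesis by (simp add: Q_def)
    qed
    have 4: "(LINT x|sphere_measure. (f x - fh x) * (r 1 * k x)) = r 1 * S"
      unfolding S_def by (subst integral_mult_right_zero[symmetric]) (simp add: mult_ac)
    show ?thesis
      using radial_green[OF ball_trace_diff[OF H(1) h(1)] ball_trace_radial_mult[OF v bspec[OF r_deriv] q]]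
      unfolding 1 2 3 4 dim by simp
  qed
  have TX: "T = 5/2 * X"
  proof -
    have "T = (LINT x|ball_measure. 5/2 * (g (x \<bullet> x) * r (x \<bullet> x) * (e x * v x)))"
      unfolding T_def
    proof (rule integral_cong_AE)
      show "AE x in ball_measure. g (x \<bullet> x) * r (x \<bullet> x) * (Dh x \<bullet> x * v x) = 5/2 * (g (x \<bullet> x) * r (x \<bullet> x) * (e x * v x))"
        using radial by eventually_elim (simp add: e_def)
    qed (intro borel_measurable_integrable integrable_mult_right integrable_radial_weight[OF cgr] ihv iev)+
    then show ?thesis by (simp add: X_def)
  qed
  have YQX: "3 * Y + 2 * Q = 5 * X"
  proof -
    have "3 * Y + 2 * Q = (LINT x|ball_measure. 3 * (r (x \<bullet> x) * (e x * v x)) + 2 * ((x \<bullet> x) * q (x \<bullet> x) * (e x * v x)))"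
    proof -
      have "(LINT x|ball_measure. 3 * (r (x \<bullet> x) * (e x * v x)) + 2 * ((x \<bullet> x) * q (x \<bullet> x) * (e x * v x)))
        = (LINT x|ball_measure. 3 * (r (x \<bullet> x) * (e x * v x))) + (LINT x|ball_measure. 2 * ((x \<bullet> x) * q (x \<bullet> x) * (e x * v x)))"
        by (intro Bochner_Integration.integral_add integrable_mult_right integrable_radial_weight[OF profile_continuous(2)]
            integrable_radial_weight[OF ctq] iev)
      then show ?thesis by (simp only: Y_def Q_def integral_mult_right_zero)
    qed
    also have "\<dots> = (LINT x|ball_measure. 5 * (g (x \<bullet> x) * r (x \<bullet> x) * (e x * v x)))"
    proof (intro Bochner_Integration.integral_cong refl)
      fix x :: 'a assume "x \<in> space ball_measure"
      then have "x \<bullet> x \<in> {0..1}" by (rule inner_self_ball_measure)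
      from bspec[OF g_ode this] have "(3 * r (x \<bullet> x) + 2 * (x \<bullet> x) * q (x \<bullet> x)) * (e x * v x) = 5 * g (x \<bullet> x) * r (x \<bullet> x) * (e x * v x)"
        by simp
      then show "3 * (r (x \<bullet> x) * (e x * v x)) + 2 * ((x \<bullet> x) * q (x \<bullet> x) * (e x * v x)) = 5 * (g (x \<bullet> x) * r (x \<bullet> x) * (e x * v x))"
        by (simp add: algebra_simps)
    qed
    finally show ?thesis by (simp add: X_def)
  qed
  have alg: "G\<^sup>2 * (a + (inverse G * (b - a) + 2 * - (\<rho> / G\<^sup>2) * c * m)) = G\<^sup>2 * a + (G * b - G * a) - 2 * (\<rho> * (c * m))"
    if "G \<noteq> 0" for G a b c m \<rho> :: real
    using that by (simp add: field_simps power2_eq_square)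
  have "(LINT x|ball_measure. (g (x \<bullet> x))\<^sup>2 * (radial_transform_grad x \<bullet> V x))
     = (LINT x|ball_measure. (g (x \<bullet> x))\<^sup>2 * (Dh x \<bullet> V x) + (g (x \<bullet> x) * (DH x \<bullet> V x) - g (x \<bullet> x) * (Dh x \<bullet> V x))
         - 2 * (r (x \<bullet> x) * (e x * (V x \<bullet> x))))"
  proof (intro Bochner_Integration.integral_cong refl)
    fix x :: 'a assume "x \<in> space ball_measure"
    then have "x \<bullet> x \<in> {0..1}" by (rule inner_self_ball_measure)
    then have "0 < g (x \<bullet> x)" by (rule bspec[OF g_positive])
    then have g0: "g (x \<bullet> x) \<noteq> 0" by simp
    have "radial_transform_grad x \<bullet> V x = Dh x \<bullet> V x + (inverse (g (x \<bullet> x)) * (DH x \<bullet> V x - Dh x \<bullet> V x)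
        + 2 * - (r (x \<bullet> x) / (g (x \<bullet> x))\<^sup>2) * e x * (V x \<bullet> x))"
      unfolding radial_transform_grad_def e_def by (simp add: inner_add_left inner_diff_left inner_commute[of x "V x"])
    then show "(g (x \<bullet> x))\<^sup>2 * (radial_transform_grad x \<bullet> V x) = (g (x \<bullet> x))\<^sup>2 * (Dh x \<bullet> V x) + (g (x \<bullet> x) * (DH x \<bullet> V x) - g (x \<bullet> x) * (Dh x \<bullet> V x))
         - 2 * (r (x \<bullet> x) * (e x * (V x \<bullet> x)))"
      using alg[OF g0] by simp
  qed
  also have "\<dots> = (LINT x|ball_measure. (g (x \<bullet> x))\<^sup>2 * (Dh x \<bullet> V x)) + ((LINT x|ball_measure. g (x \<bullet> x) * (DH x \<bullet> V x))
      - (LINT x|ball_measure. g (x \<bullet> x) * (Dh x \<bullet> V x))) - 2 * Z"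
  proof -
    note i = integrable_radial_weight[OF cg2 ihV] integrable_radial_weight[OF profile_continuous(1) iHV]
      integrable_radial_weight[OF profile_continuous(1) ihV] integrable_radial_weight[OF profile_continuous(2) ieV]
    have i5: "integrable ball_measure (\<lambda>x. 2 * (r (x \<bullet> x) * (e x * (V x \<bullet> x))))" using i(4) by (rule integrable_mult_right)
    show ?thesis
      unfolding Z_def
      by (simp only: Bochner_Integration.integral_diff[OF Bochner_Integration.integrable_add[OF i(1) Bochner_Integration.integrable_diff[OF i(2,3)]] i5]
          Bochner_Integration.integral_add[OF i(1) Bochner_Integration.integrable_diff[OF i(2,3)]]
          Bochner_Integration.integral_diff[OF i(2,3)] integral_mult_right_zero)
  qed
  also have "\<dots> = (LINT x|ball_measure. DH x \<bullet> V x) - 4 * T - 2 * LH + 2 * Lh - 2 * Z"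
    unfolding P2 P1[OF weakly_harmonic_imp_radially_harmonic[OF H(2) sH(2)] iHV] P1[OF h(2) ihV] LH_def Lh_def by simp
  \<comment> \<open>Inserting \<open>green\<close>, what remains is
    \<open>- 4 * T + 2 * (3 * Y + 2 * Q)\<close>, that is \<open>- 10 * X + 10 * X\<close>.\<close>
  also have "\<dots> = (LINT x|ball_measure. DH x \<bullet> V x) - 2 * r 1 * S"
    using green TX YQX by (simp add: mult.assoc)
  finally show ?thesis unfolding S_def .
qed

end

section \<open>The Dirichlet-to-Neumann map\<close>

lemma conductivity_bounded:
  fixes \<gamma> :: "'a::euclidean_space \<Rightarrow> real"
  assumes "\<gamma> \<in> conductivities (ball 0 1)"
  obtains C where "\<gamma> \<in> borel_measurable ball_measure" "\<And>x. x \<in> space ball_measure \<Longrightarrow> \<bar>\<gamma> x\<bar> \<le> C"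
    "\<And>x. x \<in> space ball_measure \<Longrightarrow> 0 < \<gamma> x"
proof -
  obtain s where s: "smooth_on UNIV s" "\<And>x. x \<in> cball 0 1 \<Longrightarrow> \<gamma> x = s x" and pos: "\<And>x. x \<in> cball 0 1 \<Longrightarrow> 0 < \<gamma> x"
    using assms unfolding conductivities_def by auto
  have sp: "x \<in> cball 0 1" if "x \<in> space (ball_measure :: 'a measure)" for x
    using that by (simp add: space_restrict_space)
  obtain C where C: "\<And>x. norm x \<le> 1 \<Longrightarrow> norm (s x) \<le> C"
    using continuous_bounded_on_cball[of 1 s] smooth_on_continuous[OF s(1)] by blast
  have "s \<in> borel_measurable ball_measure"
    by (intro borel_imp_lebesgue_on borel_measurable_continuous_onI smooth_on_continuous s(1))
  then have "\<gamma> \<in> borel_measurable ball_measure"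
    by (subst measurable_cong[of _ _ s]) (use s(2) sp in auto)
  moreover have "\<bar>\<gamma> x\<bar> \<le> C" if "x \<in> space ball_measure" for x
    using C[of x] s(2)[OF sp[OF that]] sp[OF that] by simp
  moreover have "0 < \<gamma> x" if "x \<in> space ball_measure" for x using pos[OF sp[OF that]] .
  ultimately show thesis by (rule that)
qed

text \<open>The description in \<open>dn_map\<close> is well posed: the difference of two solutions
  is itself a test function, so its energy is 0 and positivity of \<open>\<gamma>\<close> makes the
  gradients agree almost everywhere; two extensions of \<open>k\<close> differ by a test
  function.\<close>

lemma dn_map_eq:
  fixes \<gamma> f k u v :: "'a::euclidean_space \<Rightarrow> real" and U V :: "'a \<Rightarrow> 'a"
  assumes \<gamma>: "\<gamma> \<in> conductivities (ball 0 1)" and u: "weak_solution (ball 0 1) sphere_measure \<gamma> f u U"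
    and v: "ball_trace v V k"
  shows "dn_map (ball 0 1) sphere_measure \<gamma> f k = (LINT x|ball_measure. \<gamma> x * (U x \<bullet> V x))"
proof -
  obtain C where C: "\<gamma> \<in> borel_measurable ball_measure" "\<And>x. x \<in> space ball_measure \<Longrightarrow> \<bar>\<gamma> x\<bar> \<le> C"
    and pos: "\<And>x. x \<in> space ball_measure \<Longrightarrow> 0 < \<gamma> x"
    using conductivity_bounded[OF \<gamma>] by blast
  define I where "I X Y = (LINT x|ball_measure. \<gamma> x * (X x \<bullet> Y x))" for X Y :: "'a \<Rightarrow> 'a"
  have int: "integrable ball_measure (\<lambda>x. \<gamma> x * (X x \<bullet> Y x))"
    if "square_integrable ball_measure X" "square_integrable ball_measure Y" for X Y :: "'a \<Rightarrow> 'a"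
    using square_integrable_inner[OF square_integrable_bounded_scaleR[OF that(1) C] that(2)] by simp
  have I_diff_right: "I X (\<lambda>x. Y x - Z x) = I X Y - I X Z"
    if "square_integrable ball_measure X" "square_integrable ball_measure Y" "square_integrable ball_measure Z" for X Y Z
    unfolding I_def inner_diff_right right_diff_distrib
    by (rule Bochner_Integration.integral_diff) (intro int that)+
  have I_diff_left: "I (\<lambda>x. Y x - Z x) X = I Y X - I Z X"
    if "square_integrable ball_measure X" "square_integrable ball_measure Y" "square_integrable ball_measure Z" for X Y Z
    unfolding I_def inner_diff_left right_diff_distrib
    by (rule Bochner_Integration.integral_diff) (intro int that)+
  have ut: "ball_trace u U f" and uw: "\<And>w W. ball_trace w W (\<lambda>_. 0) \<Longrightarrow> I U W = 0"
    using u unfolding weak_solution_def I_def by auto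
  have uniq: "I U' V' = I U V"
    if u': "weak_solution (ball 0 1) sphere_measure \<gamma> f u' U'" and v': "ball_trace v' V' k" for u' U' v' V'
  proof -
    have u't: "ball_trace u' U' f" and u'w: "\<And>w W. ball_trace w W (\<lambda>_. 0) \<Longrightarrow> I U' W = 0"
      using u' unfolding weak_solution_def I_def by auto
    note sq = ball_traceD(2)[OF ut] ball_traceD(2)[OF u't] ball_traceD(2)[OF v] ball_traceD(2)[OF v']
    have Vd: "ball_trace (\<lambda>x. v' x - v x) (\<lambda>x. V' x - V x) (\<lambda>_. 0)" using ball_trace_diff[OF v' v] by simp
    have Ud: "ball_trace (\<lambda>x. u' x - u x) (\<lambda>x. U' x - U x) (\<lambda>_. 0)" using ball_trace_diff[OF u't ut] by simp
    define Z where "Z x = U' x - U x" for x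
    have sZ: "square_integrable ball_measure Z" unfolding Z_def by (intro square_integrable_diff sq)
    have "I Z Z = I U' Z - I U Z" unfolding Z_def[abs_def] by (intro I_diff_left square_integrable_diff sq)
    also have "\<dots> = 0" using u'w[OF Ud] uw[OF Ud] unfolding Z_def by simp
    finally have "(LINT x|ball_measure. \<gamma> x * (Z x \<bullet> Z x)) = 0" by (simp add: I_def)
    moreover have "AE x in ball_measure. 0 \<le> \<gamma> x * (Z x \<bullet> Z x)"
      using pos by (intro AE_I2) (simp add: less_imp_le)
    ultimately have "AE x in ball_measure. \<gamma> x * (Z x \<bullet> Z x) = 0"
      using integral_nonneg_eq_0_iff_AE[OF int[OF sZ sZ]] by simp
    then have "AE x in ball_measure. \<gamma> x * (Z x \<bullet> V' x) = 0"
    proof (rule AE_mp, intro AE_I2 impI)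
      fix x :: 'a assume x: "x \<in> space ball_measure" and "\<gamma> x * (Z x \<bullet> Z x) = 0"
      with pos[OF x] have "Z x = 0" by simp
      then show "\<gamma> x * (Z x \<bullet> V' x) = 0" by simp
    qed
    then have "I Z V' = 0" unfolding I_def by (rule integral_eq_zero_AE)
    then have "I U' V' = I U V'" using I_diff_left[OF sq(4,2,1)] unfolding Z_def[abs_def] by simp
    also have "\<dots> = I U V" using uw[OF Vd] I_diff_right[OF sq(1,4,3)] by simp
    finally show ?thesis .
  qed
  have fH: "f \<in> H_half (ball 0 1) sphere_measure" "k \<in> H_half (ball 0 1) sphere_measure"
    using ut v unfolding H_half_def by blast+
  have "(THE c. \<exists>u U v V. weak_solution (ball 0 1) sphere_measure \<gamma> f u U \<and> ball_trace v V k \<and> c = I U V) = I U V"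
    by (rule the_equality) (use u v uniq in blast)+
  then show ?thesis using fH unfolding dn_map_def I_def by simp
qed

text \<open>\<open>conductivity_form\<close> is used twice. Against zero traces both terms on its
  right vanish, which is the weak equation; against an extension of \<open>k\<close> it is the
  boundary pairing.\<close>

lemma dn_map_radial_transform:
  fixes H h f fh v k \<gamma> :: "'a::euclidean_space \<Rightarrow> real" and DH Dh V :: "'a \<Rightarrow> 'a" and g r q :: "real \<Rightarrow> real"
  assumes "DIM('a) = 3" "ball_trace H DH f" "weakly_harmonic DH" "ball_trace h Dh fh" "radially_harmonic Dh"
    "AE x in ball_measure. Dh x \<bullet> x = 5/2 * (H x - h x)"
    "\<forall>t\<in>{0..1}. (g has_real_derivative r t) (at t within {0..1})"
    "\<forall>t\<in>{0..1}. (r has_real_derivative q t) (at t within {0..1})"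
    "continuous_on {0..1} q" "g 1 = 1" "\<forall>t\<in>{0..1}. 0 < g t"
    "\<forall>t\<in>{0..1}. 3 * r t + 2 * t * q t = 5 * g t * r t"
    and v: "ball_trace v V k" and \<gamma>: "\<gamma> \<in> conductivities (ball 0 1)" "\<And>x. x \<in> ball 0 1 \<Longrightarrow> \<gamma> x = (g (x \<bullet> x))\<^sup>2"
  shows "dn_map (ball 0 1) sphere_measure \<gamma> f k
    = (LINT x|ball_measure. DH x \<bullet> V x) - 2 * r 1 * (LINT x|sphere_measure. (f x - fh x) * k x)"
proof -
  let ?u = "radial_transform H h g" and ?U = "radial_transform_grad H h DH Dh g r"
  note form = conductivity_form[OF assms(1-12)]
  have eq: "(LINT x|ball_measure. \<gamma> x * (X x)) = (LINT x|ball_measure. (g (x \<bullet> x))\<^sup>2 * X x)" for X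
    by (intro Bochner_Integration.integral_cong refl) (simp add: \<gamma>(2) space_restrict_space)
  have "weak_solution (ball 0 1) sphere_measure \<gamma> f ?u ?U"
    unfolding weak_solution_def
  proof (intro conjI allI impI)
    show "ball_trace ?u ?U f" by (rule ball_trace_radial_transform[OF assms(1-12)])
    fix w :: "'a \<Rightarrow> real" and W :: "'a \<Rightarrow> 'a" assume w: "ball_trace w W (\<lambda>_. 0)"
    show "(LINT x|ball_measure. \<gamma> x * (?U x \<bullet> W x)) = 0"
      using assms(3) w unfolding eq form[OF w] weakly_harmonic_def by simp
  qed
  from dn_map_eq[OF \<gamma>(1) this v] show ?thesis unfolding eq form[OF v] .
qed

text \<open>\<open>h\<close> is 5 times the average with weight \<open>s ^ 4\<close>, where 5 = 4 +
  1 normalises the weight and 4 solves \<open>2 * 3 = j + 2\<close>. The radial relation comes from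
  computing one L^2 limit in two ways, hence almost everywhere. Nothing depends on the conductivity,
  so one decomposition serves all three.\<close>

lemma harmonic_decomposition:
  fixes f :: "'a::euclidean_space \<Rightarrow> real"
  assumes dim: "DIM('a) = 3" and f: "f \<in> H_half (ball 0 1) sphere_measure"
  obtains H h fh :: "'a \<Rightarrow> real" and DH Dh :: "'a \<Rightarrow> 'a" where "ball_trace H DH f" "weakly_harmonic DH" "ball_trace h Dh fh" "radially_harmonic Dh"
    "AE x in ball_measure. Dh x \<bullet> x = 5/2 * (H x - h x)"
proof -
  obtain v V where "ball_trace v V f" using f unfolding H_half_def by blast
  then obtain H DH where H: "ball_trace H DH f" "weakly_harmonic DH"
    by (rule Dirichlet_problem) (simp add: dim)
  obtain \<phi> where \<phi>: "h1_lim \<phi> H DH" using H(1) unfolding ball_trace_iff by blast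
  obtain w W where J: "h1_lim (\<lambda>n. ray_mean 4 (\<phi> n)) w W"
    by (rule h1_lim_ray_mean[OF \<phi>, of 4]) (simp add: dim)
  have h: "h1_lim (\<lambda>n x. 5 * ray_mean 4 (\<phi> n) x) (\<lambda>x. 5 * w x) (\<lambda>x. 5 *\<^sub>R W x)"
    by (rule h1_lim_cmult[OF J])
  obtain fh where fh: "l2_lim sphere_measure (\<lambda>n x. 5 * ray_mean 4 (\<phi> n) x) fh"
    using h1_lim_trace[OF h] .
  have ht: "ball_trace (\<lambda>x. 5 * w x) (\<lambda>x. 5 *\<^sub>R W x) fh" by (rule ball_traceI[OF h fh])
  have rh: "radially_harmonic (\<lambda>x. 5 *\<^sub>R W x)"
    by (rule radially_harmonic_cmult[OF ray_mean_radially_harmonic[OF _ \<phi> H(2) J]]) (simp add: dim)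
  have "l2_lim ball_measure (\<lambda>n x. 2 * (grad (ray_mean 4 (\<phi> n)) x \<bullet> x)) (\<lambda>x. 2 * (W x \<bullet> x))"
    by (intro l2_lim_cmult l2_lim_radial h1_limD(3)[OF J])
  moreover have "l2_lim ball_measure (\<lambda>n x. 2 * (grad (ray_mean 4 (\<phi> n)) x \<bullet> x)) (\<lambda>x. H x - 5 * w x)"
    unfolding radial_derivative_ray_mean[OF h1_limD(1)[OF \<phi>]]
    using l2_lim_diff[OF h1_limD(2)[OF \<phi>] h1_limD(2)[OF h]] by simp
  ultimately have "AE x in ball_measure. 2 * (W x \<bullet> x) = H x - 5 * w x"
    by (rule l2_lim_unique_AE)
  then have "AE x in ball_measure. 5 *\<^sub>R W x \<bullet> x = 5/2 * (H x - 5 * w x)"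
    by eventually_elim simp
  from that[OF H ht rh this] show thesis .
qed

section \<open>The three explicit conductivities\<close>

lemma radial_conductivity:
  fixes g :: "real \<Rightarrow> real"
  assumes "smooth_on UNIV (\<lambda>x::'a::euclidean_space. g (x \<bullet> x))" "\<And>t. t \<in> {0..1} \<Longrightarrow> 0 < g t"
  shows "(\<lambda>x::'a\<in>closure (ball 0 1). (g (x \<bullet> x))\<^sup>2) \<in> conductivities (ball 0 1)"
proof -
  have "0 < (g (x \<bullet> x))\<^sup>2" if "norm x \<le> 1" for x :: 'a
  proof -
    have "x \<bullet> x \<in> {0..1}" using power_le_one[OF norm_ge_zero that, of 2] by (simp add: power2_norm_eq_inner)
    from assms(2)[OF this] show ?thesis by simp
  qed
  then show ?thesis
    unfolding conductivities_def using smooth_on_power[OF assms(1), of 2] by auto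
qed

text \<open>The signs of \<open>c\<close> and \<open>d\<close> keep the denominator positive on the
  whole space, so the quotient itself is the global smooth extension that
  \<open>conductivities\<close> asks for.\<close>

lemma radial_quotient_smooth:
  fixes a b c d :: real
  assumes "0 < c" "0 \<le> d"
  shows "smooth_on UNIV (\<lambda>x::'a::euclidean_space. (a - b * (x \<bullet> x) ^ n) / (c + d * (x \<bullet> x) ^ n))"
proof (rule smooth_on_divide)
  have "0 < c + d * (x \<bullet> x) ^ n" for x :: 'a using assms by (intro add_pos_nonneg) auto
  then show "c + d * (x \<bullet> x) ^ n \<noteq> 0" for x :: 'a by (metis less_irrefl)
qed (intro smooth_on_add smooth_on_diff smooth_on_mult smooth_on_const smooth_on_power smooth_on_norm_sq)+

theorem corollaryA2:
  shows "\<exists>(\<Gamma> :: (real ^ 3 \<Rightarrow> real) pmf) \<gamma>\<^sub>s.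
    set_pmf \<Gamma> \<subseteq> conductivities (ball 0 1) \<and> card (set_pmf \<Gamma>) = 2 \<and>
    \<gamma>\<^sub>s \<in> conductivities (ball 0 1) \<and>
    expected_dn_map (ball 0 1) sphere_measure \<Gamma> = dn_map (ball 0 1) sphere_measure \<gamma>\<^sub>s \<and>
    \<gamma>\<^sub>s \<noteq> mean_conductivity (ball 0 1) \<Gamma>"
proof -
  \<comment> \<open>The Riccati solutions with value 1 at 1 are ((2 \<kappa> + 1) (\<kappa> + 2) -
    (2 \<kappa> - 1) (\<kappa> - 2) t^\<kappa>) / (5 ((\<kappa> + 2) + (\<kappa> - 2) t^\<kappa>)).
    In lowest terms these are \<open>gs\<close> for \<kappa> = 3 and \<open>g2\<close> for \<kappa>
    = 4, while \<kappa> = 2 gives the constant 1.\<close>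
  define gs g2 where "gs t = (7 - t ^ 3) / (5 + t ^ 3)" and "g2 t = (27 - 7 * t ^ 4) / (15 + 5 * t ^ 4)" for t :: real
  define rs r2 where "rs t = - 36 * t\<^sup>2 / (5 + t ^ 3)\<^sup>2" and "r2 t = - 960 * t ^ 3 / (15 + 5 * t ^ 4)\<^sup>2" for t :: real
  define qs q2 where "qs t = (144 * t ^ 4 - 360 * t) / (5 + t ^ 3) ^ 3"
    and "q2 t = (24000 * t ^ 6 - 43200 * t\<^sup>2) / (15 + 5 * t ^ 4) ^ 3" for t :: real
  define \<gamma>1 \<gamma>s \<gamma>2 where "\<gamma>1 = (\<lambda>x::real^3\<in>closure (ball 0 1). (1::real)\<^sup>2)"
    and "\<gamma>s = (\<lambda>x::real^3\<in>closure (ball 0 1). (gs (x \<bullet> x))\<^sup>2)"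
    and "\<gamma>2 = (\<lambda>x::real^3\<in>closure (ball 0 1). (g2 (x \<bullet> x))\<^sup>2)"
  have den: "0 < 5 + t ^ 3" "0 < 15 + 5 * t ^ 4" if "t \<in> {0..1}" for t :: real
    using that by (auto intro: add_pos_nonneg)
  have pos: "0 < gs t" "0 < g2 t" if t: "t \<in> {0..1}" for t
  proof -
    have "t ^ 3 \<le> 1" "t ^ 4 \<le> 1" using t by (auto intro: power_le_one)
    then show "0 < gs t" "0 < g2 t" unfolding gs_def g2_def using den[OF t] by (auto intro!: divide_pos_pos)
  qed
  have c1: "\<gamma>1 \<in> conductivities (ball 0 1)"
    unfolding \<gamma>1_def by (rule radial_conductivity[where g = "\<lambda>_. 1"]) auto
  have cs: "\<gamma>s \<in> conductivities (ball 0 1)"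
    unfolding \<gamma>s_def
    by (rule radial_conductivity) (use radial_quotient_smooth[of 5 1 7 1 3] pos in \<open>auto simp: gs_def\<close>)
  have c2: "\<gamma>2 \<in> conductivities (ball 0 1)"
    unfolding \<gamma>2_def
    by (rule radial_conductivity) (use radial_quotient_smooth[of 15 5 27 7 4] pos in \<open>auto simp: g2_def\<close>)
  have ds: "(gs has_real_derivative rs t) (at t within {0..1})" "(rs has_real_derivative qs t) (at t within {0..1})"
    "3 * rs t + 2 * t * qs t = 5 * gs t * rs t" if t: "t \<in> {0..1}" for t
  proof -
    define D where "D = 5 + t ^ 3"
    have D: "D \<noteq> 0" using den(1)[OF t] by (simp add: D_def)
    show "(gs has_real_derivative rs t) (at t within {0..1})"
      unfolding gs_def rs_def using den(1)[OF t]
      by (auto intro!: derivative_eq_intros simp: field_simps power2_eq_square power3_eq_cube)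
    have "((\<lambda>t. - 36 * t\<^sup>2 / (5 + t ^ 3)\<^sup>2) has_real_derivative
      ((- 72 * t) * D\<^sup>2 - (- 36 * t\<^sup>2) * (2 * D * (3 * t\<^sup>2))) / (D\<^sup>2 * D\<^sup>2)) (at t within {0..1})"
    proof -
      have A: "((\<lambda>t. - 36 * t\<^sup>2) has_real_derivative - 72 * t) (at t within {0..1})"
        by (auto intro!: derivative_eq_intros)
      have B: "((\<lambda>t. (5 + t ^ 3)\<^sup>2) has_real_derivative 2 * D * (3 * t\<^sup>2)) (at t within {0..1})"
        unfolding D_def by (auto intro!: derivative_eq_intros)
      show ?thesis using DERIV_divide[OF A B] D unfolding D_def by simp
    qed
    also have "((- 72 * t) * D\<^sup>2 - (- 36 * t\<^sup>2) * (2 * D * (3 * t\<^sup>2))) / (D\<^sup>2 * D\<^sup>2) = ((- 72 * t) * D + 216 * t ^ 4) / D ^ 3"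
      using D by (simp add: divide_simps) algebra
    also have "\<dots> = qs t" unfolding qs_def D_def by (simp add: algebra_simps power_numeral_reduce)
    finally show "(rs has_real_derivative qs t) (at t within {0..1})" unfolding rs_def .
    have "3 * rs t + 2 * t * qs t = (3 * (- 36 * t\<^sup>2) * D + 2 * t * (144 * t ^ 4 - 360 * t)) / D ^ 3"
      unfolding rs_def qs_def D_def[symmetric] using D by (simp add: divide_simps) algebra
    also have "\<dots> = 5 * (7 - t ^ 3) * (- 36 * t\<^sup>2) / D ^ 3"
      unfolding D_def by (simp add: algebra_simps power_numeral_reduce)
    also have "\<dots> = 5 * gs t * rs t"
      unfolding rs_def gs_def D_def[symmetric] using D by (simp add: divide_simps) algebra
    finally show "3 * rs t + 2 * t * qs t = 5 * gs t * rs t" .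
  qed
  have d2: "(g2 has_real_derivative r2 t) (at t within {0..1})" "(r2 has_real_derivative q2 t) (at t within {0..1})"
    "3 * r2 t + 2 * t * q2 t = 5 * g2 t * r2 t" if t: "t \<in> {0..1}" for t
  proof -
    define D where "D = 15 + 5 * t ^ 4"
    have D: "D \<noteq> 0" using den(2)[OF t] by (simp add: D_def)
    show "(g2 has_real_derivative r2 t) (at t within {0..1})"
      unfolding g2_def r2_def using den(2)[OF t]
      by (auto intro!: derivative_eq_intros simp: field_simps power_numeral_reduce)
    have "((\<lambda>t. - 960 * t ^ 3 / (15 + 5 * t ^ 4)\<^sup>2) has_real_derivative
      ((- 2880 * t\<^sup>2) * D\<^sup>2 - (- 960 * t ^ 3) * (2 * D * (20 * t ^ 3))) / (D\<^sup>2 * D\<^sup>2)) (at t within {0..1})"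
    proof -
      have A: "((\<lambda>t. - 960 * t ^ 3) has_real_derivative - 2880 * t\<^sup>2) (at t within {0..1})"
        by (auto intro!: derivative_eq_intros)
      have B: "((\<lambda>t. (15 + 5 * t ^ 4)\<^sup>2) has_real_derivative 2 * D * (20 * t ^ 3)) (at t within {0..1})"
        unfolding D_def by (auto intro!: derivative_eq_intros)
      show ?thesis using DERIV_divide[OF A B] D unfolding D_def by simp
    qed
    also have "((- 2880 * t\<^sup>2) * D\<^sup>2 - (- 960 * t ^ 3) * (2 * D * (20 * t ^ 3))) / (D\<^sup>2 * D\<^sup>2) = ((- 2880 * t\<^sup>2) * D + 38400 * t ^ 6) / D ^ 3"
      using D by (simp add: divide_simps) algebra
    also have "\<dots> = q2 t" unfolding q2_def D_def by (simp add: algebra_simps power_numeral_reduce)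
    finally show "(r2 has_real_derivative q2 t) (at t within {0..1})" unfolding r2_def .
    have "3 * r2 t + 2 * t * q2 t = (3 * (- 960 * t ^ 3) * D + 2 * t * (24000 * t ^ 6 - 43200 * t\<^sup>2)) / D ^ 3"
      unfolding r2_def q2_def D_def[symmetric] using D by (simp add: divide_simps) algebra
    also have "\<dots> = 5 * (27 - 7 * t ^ 4) * (- 960 * t ^ 3) / D ^ 3"
      unfolding D_def by (simp add: algebra_simps power_numeral_reduce)
    also have "\<dots> = 5 * g2 t * r2 t"
      unfolding r2_def g2_def D_def[symmetric] using D by (simp add: divide_simps) algebra
    finally show "3 * r2 t + 2 * t * q2 t = 5 * g2 t * r2 t" .
  qed
  have cq: "continuous_on {0..1} qs" "continuous_on {0..1} q2"
    unfolding qs_def q2_def using den by (auto intro!: continuous_intros simp: less_imp_neq[symmetric] dest: less_imp_neq)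
  \<comment> \<open>The boundary coefficients \<open>2 * r 1\<close> are 0, -2 and -24/5 for
    \<kappa> = 2, 3, 4, and 5/12 of the last is the second.\<close>
  have at1: "gs 1 = 1" "g2 1 = 1" "rs 1 = - 1" "r2 1 = - 12 / 5"
    by (simp_all add: gs_def g2_def rs_def r2_def)
  have dim: "DIM(real ^ 3) = 3" by simp
  have avg: "5/12 * dn_map (ball 0 1) sphere_measure \<gamma>2 f k + 7/12 * dn_map (ball 0 1) sphere_measure \<gamma>1 f k
      = dn_map (ball 0 1) sphere_measure \<gamma>s f k"
    if f: "f \<in> H_half (ball 0 1) sphere_measure" and k: "k \<in> H_half (ball 0 1) sphere_measure" for f k :: "real ^ 3 \<Rightarrow> real"
  proof -
    obtain v V where v: "ball_trace v V k" using k unfolding H_half_def by blast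
    obtain H h fh DH Dh where dec: "ball_trace H DH f" "weakly_harmonic DH" "ball_trace h Dh fh" "radially_harmonic Dh"
      "AE x in ball_measure. Dh x \<bullet> x = 5/2 * (H x - h x)"
      by (rule harmonic_decomposition[OF dim f])
    note dn = dn_map_radial_transform[OF dim dec]
    have 1: "dn_map (ball 0 1) sphere_measure \<gamma>1 f k = (LINT x|ball_measure. DH x \<bullet> V x) - 2 * 0 * (LINT x|sphere_measure. (f x - fh x) * k x)"
      by (rule dn[where g = "\<lambda>_. 1" and r = "\<lambda>_. 0" and q = "\<lambda>_. 0", OF _ _ _ _ _ _ v c1])
         (auto simp: \<gamma>1_def intro!: derivative_eq_intros)
    have 2: "dn_map (ball 0 1) sphere_measure \<gamma>s f k = (LINT x|ball_measure. DH x \<bullet> V x) - 2 * rs 1 * (LINT x|sphere_measure. (f x - fh x) * k x)"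
      by (rule dn[where g = gs, OF _ _ cq(1) at1(1) _ _ v cs]) (auto simp: \<gamma>s_def intro: ds pos)
    have 3: "dn_map (ball 0 1) sphere_measure \<gamma>2 f k = (LINT x|ball_measure. DH x \<bullet> V x) - 2 * r2 1 * (LINT x|sphere_measure. (f x - fh x) * k x)"
      by (rule dn[where g = g2, OF _ _ cq(2) at1(2) _ _ v c2]) (auto simp: \<gamma>2_def intro: d2 pos)
    show ?thesis unfolding 1 2 3 at1 by (simp add: field_simps)
  qed
  define \<Gamma> where "\<Gamma> = map_pmf (\<lambda>b. if b then \<gamma>2 else \<gamma>1) (bernoulli_pmf (5/12))"
  have exp: "measure_pmf.expectation \<Gamma> F = 5/12 * F \<gamma>2 + 7/12 * F \<gamma>1" for F :: "(real ^ 3 \<Rightarrow> real) \<Rightarrow> real"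
    unfolding \<Gamma>_def by simp
  \<comment> \<open>At the origin g is (2 \<kappa> + 1)/5, so the mean conductivity there is 7/12 +
    5/12 * 81/25 = 29/15, against 49/25 for \<open>\<gamma>s\<close>.\<close>
  have zero: "\<gamma>1 0 = 1" "\<gamma>s 0 = 49/25" "\<gamma>2 0 = 81/25"
    by (simp_all add: \<gamma>1_def \<gamma>s_def \<gamma>2_def gs_def g2_def power2_eq_square)
  have set: "set_pmf \<Gamma> = {\<gamma>1, \<gamma>2}"
    unfolding \<Gamma>_def by (auto simp: set_pmf_bernoulli)
  have "\<gamma>1 \<noteq> \<gamma>2" using zero by force
  then have card: "card (set_pmf \<Gamma>) = 2" by (simp add: set)
  \<comment> \<open>The claim is an equality of total functions; outside \<open>H_half\<close> both
    sides are the same default value.\<close>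
  have "expected_dn_map (ball 0 1) sphere_measure \<Gamma> f k = dn_map (ball 0 1) sphere_measure \<gamma>s f k" for f k
  proof (cases "f \<in> H_half (ball 0 1) sphere_measure")
    case f: True
    show ?thesis
    proof (cases "k \<in> H_half (ball 0 1) sphere_measure")
      case True
      then show ?thesis using avg[OF f True] f by (simp add: expected_dn_map_def exp)
    qed (use f in \<open>simp add: expected_dn_map_def dn_map_def\<close>)
  qed (simp add: expected_dn_map_def dn_map_def)
  then have "expected_dn_map (ball 0 1) sphere_measure \<Gamma> = dn_map (ball 0 1) sphere_measure \<gamma>s"
    by (intro ext)
  moreover have "\<gamma>s \<noteq> mean_conductivity (ball 0 1) \<Gamma>"
  proof
    assume "\<gamma>s = mean_conductivity (ball 0 1) \<Gamma>"
    then have "\<gamma>s 0 = mean_conductivity (ball 0 1) \<Gamma> 0" by simp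
    then show False by (simp add: mean_conductivity_def exp zero)
  qed
  moreover have "set_pmf \<Gamma> \<subseteq> conductivities (ball 0 1)" using c1 c2 by (simp add: set)
  ultimately show ?thesis using cs card by (intro exI[of _ \<Gamma>] exI[of _ \<gamma>s] conjI)
qed

end
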